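(* There is (and one can construct) an algorithm that, given a minor anti-chain $\mathcal Z$, decides whether $\delta(\mathrm{excl}(\mathcal Z))<1$ in $O(n)$ time, where $n=n(\mathcal Z)$.
   Context: Graphs are finite, without loops or multiple edges, and considered up to isomorphism. A minor anti-chain is a (finite, non-empty) set of graphs pairwise non-comparable under the minor relation; $\mathrm{excl}(\mathcal Z)$ is the class of all graphs having no graph of $\mathcal Z$ as a minor, and $n(\mathcal Z)=\sum_{Z\in\mathcal Z}|V(Z)|$. For a graph class $\mathcal G$ let $\mathrm{ex}(\mathcal G,n)=\max\{|E(G)| : G\in\mathcal G,\ |V(G)|=n\}$. The limiting density of an infinite class is $\delta(\mathcal G)=\lim_{n\to\infty}\mathrm{ex}(\mathcal G,n)/n$; if $\mathcal G$ is finite then $\delta(\mathcal G)=-\infty$. *)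

theory Defs
  imports
    "Graph_Theory.Digraph_Isomorphism"
    "HOL-Library.Extended_Real"
    "HOL-Library.Landau_Symbols"
begin

section \<open>Graphs, minors and limiting density\<close>

text \<open>
  A finite simple graph is a \<^verbatim>\<open>pair_graph\<close> of the Graph Theory entry: a finite vertex set with a
  symmetric irreflexive set of arcs, where an edge \<open>uv\<close> is present as the two arcs \<open>(u, v)\<close> and
  \<open>(v, u)\<close>. Vertices are natural numbers, so every finite graph occurs up to isomorphism.
\<close>

type_synonym graph = "nat pair_pre_digraph"

definition isomorphic :: "graph \<Rightarrow> graph \<Rightarrow> bool" where
  "isomorphic G H \<longleftrightarrow> digraph_iso (with_proj G) (with_proj H)"

definition num_edges :: "graph \<Rightarrow> nat" where
  "num_edges G = card {{u, v} |u v. (u, v) \<in> parcs G}"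

text \<open>
  \<open>H\<close> is a minor of \<open>G\<close>: contracting the branch sets \<open>B v\<close>, which are disjoint, non-empty
  and connected (\<open>Digraph_Component.connected\<close> includes non-emptiness), and deleting superfluous
  vertices and edges turns \<open>G\<close> into a copy of \<open>H\<close>.
\<close>

definition minor :: "graph \<Rightarrow> graph \<Rightarrow> bool" where
  "minor H G \<longleftrightarrow>
    (\<exists>B. (\<forall>v \<in> pverts H. B v \<subseteq> pverts G \<and> Digraph_Component.connected (with_proj G \<restriction> B v)) \<and>
         (\<forall>u \<in> pverts H. \<forall>v \<in> pverts H. u \<noteq> v \<longrightarrow> B u \<inter> B v = {}) \<and>
         (\<forall>(u, v) \<in> parcs H. \<exists>x \<in> B u. \<exists>y \<in> B v. (x, y) \<in> parcs G))"

definition minor_antichain :: "graph set \<Rightarrow> bool" where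
  "minor_antichain \<Z> \<longleftrightarrow>
    finite \<Z> \<and> \<Z> \<noteq> {} \<and> (\<forall>Z \<in> \<Z>. pair_graph Z) \<and> pairwise (\<lambda>Y Z. \<not> minor Y Z) \<Z>"

definition excl :: "graph set \<Rightarrow> graph set" where
  "excl \<Z> = {G. pair_graph G \<and> (\<forall>Z \<in> \<Z>. \<not> minor Z G)}"

definition total_order :: "graph set \<Rightarrow> nat" where
  "total_order \<Z> = (\<Sum>Z \<in> \<Z>. card (pverts Z))"

definition ex :: "graph set \<Rightarrow> nat \<Rightarrow> nat" where
  "ex \<G> n = Max {num_edges G |G. G \<in> \<G> \<and> card (pverts G) = n}"

definition finite_up_to_iso :: "graph set \<Rightarrow> bool" where
  "finite_up_to_iso \<G> \<longleftrightarrow> finite (\<G> // {(G, H). pair_graph G \<and> pair_graph H \<and> isomorphic G H})"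

text \<open>
  \<open>has_limiting_density \<G> d\<close> says that \<open>\<delta>(\<G>)\<close> is defined and equal to \<open>d\<close>. As a relation it
  does not assign an arbitrary value to a class for which the limit does not exist.
\<close>

definition has_limiting_density :: "graph set \<Rightarrow> ereal \<Rightarrow> bool" where
  "has_limiting_density \<G> d \<longleftrightarrow>
    (if finite_up_to_iso \<G> then d = -\<infinity>
     else (\<lambda>n. ereal (real (ex \<G> n) / real n)) \<longlonglongrightarrow> d)"

section \<open>Random access machines\<close>

text \<open>
  Programs of a unit-cost RAM whose arithmetic is addition and (truncated) subtraction. There are
  named registers and a separate addressable memory; a program mentions only finitely many
  registers, and unbounded storage is reached through \<open>Load\<close> and \<open>Store\<close>.
  Control flow is structured; conditional jumps simulate it with constant overhead.
\<close>

datatype operand = Imm nat | Reg nat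

datatype test = Less operand operand | Equal operand operand

datatype program =
    Skip
  | Move nat operand
  | Add nat operand operand
  | Sub nat operand operand
  | Load nat operand
  | Store operand operand
  | Seq program program
  | Cond test program program
  | Loop test program

text \<open>A state consists of the contents of the registers and of the memory.\<close>

type_synonym state = "(nat \<Rightarrow> nat) \<times> (nat \<Rightarrow> nat)"

fun val :: "operand \<Rightarrow> (nat \<Rightarrow> nat) \<Rightarrow> nat" where
  "val (Imm k) r = k"
| "val (Reg i) r = r i"

fun holds :: "test \<Rightarrow> (nat \<Rightarrow> nat) \<Rightarrow> bool" where
  "holds (Less a b) r \<longleftrightarrow> val a r < val b r"
| "holds (Equal a b) r \<longleftrightarrow> val a r = val b r"

text \<open>\<open>exec P s t s'\<close>: started in state \<open>s\<close>, \<open>P\<close> halts after exactly \<open>t\<close> steps in state \<open>s'\<close>.\<close>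

inductive exec :: "program \<Rightarrow> state \<Rightarrow> nat \<Rightarrow> state \<Rightarrow> bool" where
  Skip: "exec Skip s 1 s"
| Move: "exec (Move i a) (r, m) 1 (r(i := val a r), m)"
| Add: "exec (Add i a b) (r, m) 1 (r(i := val a r + val b r), m)"
| Sub: "exec (Sub i a b) (r, m) 1 (r(i := val a r - val b r), m)"
| Load: "exec (Load i a) (r, m) 1 (r(i := m (val a r)), m)"
| Store: "exec (Store a b) (r, m) 1 (r, m(val a r := val b r))"
| Seq: "exec P s t s' \<Longrightarrow> exec Q s' t' s'' \<Longrightarrow> exec (Seq P Q) s (t + t') s''"
| Cond_True: "holds c (fst s) \<Longrightarrow> exec P s t s' \<Longrightarrow> exec (Cond c P Q) s (t + 1) s'"
| Cond_False: "\<not> holds c (fst s) \<Longrightarrow> exec Q s t s' \<Longrightarrow> exec (Cond c P Q) s (t + 1) s'"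
| Loop_False: "\<not> holds c (fst s) \<Longrightarrow> exec (Loop c P) s 1 s"
| Loop_True: "holds c (fst s) \<Longrightarrow> exec P s t s' \<Longrightarrow> exec (Loop c P) s' t' s'' \<Longrightarrow>
    exec (Loop c P) s (t + t' + 1) s''"

inductive_cases exec_SkipE: "exec Skip s t s'"
  and exec_MoveE: "exec (Move i a) s t s'"
  and exec_AddE: "exec (Add i a b) s t s'"
  and exec_SubE: "exec (Sub i a b) s t s'"
  and exec_LoadE: "exec (Load i a) s t s'"
  and exec_StoreE: "exec (Store a b) s t s'"
  and exec_SeqE: "exec (Seq P Q) s t s'"
  and exec_CondE: "exec (Cond c P Q) s t s'"
  and exec_LoopE: "exec (Loop c P) s t s'"

lemma exec_deterministic:
  "exec P s t s' \<Longrightarrow> exec P s u s'' \<Longrightarrow> t = u \<and> s' = s''"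
proof (induction arbitrary: u s'' rule: exec.induct)
  case (Seq P s t s' Q t' s1)
  from Seq.prems obtain v v' s2 where
    "exec P s v s2" "exec Q s2 v' s''" "u = v + v'" by (cases rule: exec_SeqE)
  with Seq.IH show ?case by metis
next
  case (Loop_True c s P t s' t' s1)
  from Loop_True.prems Loop_True.hyps(1) obtain v v' s2 where
    "exec P s v s2" "exec (Loop c P) s2 v' s''" "u = v + v' + 1" by (cases rule: exec_LoopE) auto
  with Loop_True.IH show ?case by metis
next
  case (Cond_True c s P t s' Q)
  from Cond_True.prems Cond_True.hyps(1) obtain v where "exec P s v s''" "u = v + 1"
    by (cases rule: exec_CondE) auto
  with Cond_True.IH show ?case by metis
next
  case (Cond_False c s Q t s' P)
  from Cond_False.prems Cond_False.hyps(1) obtain v where "exec Q s v s''" "u = v + 1"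
    by (cases rule: exec_CondE) auto
  with Cond_False.IH show ?case by metis
next
  case (Loop_False c s P)
  from Loop_False.prems Loop_False.hyps show ?case by (cases rule: exec_LoopE) auto
qed (auto elim: exec_SkipE exec_MoveE exec_AddE exec_SubE exec_LoadE exec_StoreE)

section \<open>Input format\<close>

text \<open>
  A graph on the vertices \<open>0, \<dots>, k - 1\<close> is given by the list of its \<open>k\<close> adjacency lists, in which
  the neighbours of each vertex are listed once each, in any order.
\<close>

definition graph_of :: "nat list list \<Rightarrow> graph" where
  "graph_of g = \<lparr>pverts = {..<length g}, parcs = {(u, v). u < length g \<and> v \<in> set (g ! u)}\<rparr>"

definition represents :: "nat list list list \<Rightarrow> graph set \<Rightarrow> bool" where
  "represents gs \<Z> \<longleftrightarrow>
    (\<exists>Zs. distinct Zs \<and> set Zs = \<Z> \<and>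
      list_all2 (\<lambda>g Z. (\<forall>ns \<in> set g. distinct ns) \<and> isomorphic (graph_of g) Z) gs Zs)"

text \<open>
  A sequence of blocks is laid out in memory as the number of blocks, then the offset of each
  block from the start of the sequence, then the blocks. The input is a sequence of graphs, a graph
  is a sequence of adjacency lists, and an adjacency list is its length followed by its entries.
  So any entry of any adjacency list is found in constant time. Note that the input can be of
  size quadratic in the number of vertices, so that a linear-time algorithm cannot read all of it.
\<close>

definition encode_seq :: "nat list list \<Rightarrow> nat list" where
  "encode_seq bs =
    length bs # map (\<lambda>i. 1 + length bs + length (concat (take i bs))) [0..<length bs] @ concat bs"

definition encode_list :: "nat list \<Rightarrow> nat list" where
  "encode_list ns = length ns # ns"

definition encode_graph :: "nat list list \<Rightarrow> nat list" where
  "encode_graph g = encode_seq (map encode_list g)"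

definition encode_graphs :: "nat list list list \<Rightarrow> nat list" where
  "encode_graphs gs = encode_seq (map encode_graph gs)"

definition initial :: "nat list \<Rightarrow> state" where
  "initial xs = (\<lambda>_. 0, \<lambda>a. if a < length xs then xs ! a else 0)"

text \<open>The answer of a halted program is read off register \<open>0\<close>: \<open>1\<close> for yes and \<open>0\<close> for no.\<close>

definition answer :: "state \<Rightarrow> nat" where
  "answer s = fst s 0"

end

theory Submission
  imports Defs
begin

text \<open>
  Paths, stars and disjoint unions of triangles have density tending to \<open>1\<close>, so
  \<open>\<delta>(excl \<Z>) < 1\<close> forces \<open>\<Z>\<close> to contain a minor of a path, a minor of a star and a minor of a
  union of disjoint triangles. Conversely, if such members exist, then the components of a graph in
  \<open>excl \<Z>\<close> have bounded size, as paths and stars are excluded, and boundedly many of them contain a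
  cycle, as triangles are excluded. If \<open>i\<close> is the largest size of which arbitrarily many
  components can occur, then the limiting density is \<open>1 - 1 / i\<close>.

  Each of the three conditions on a member with \<open>k\<close> vertices is decided in \<open>O(k)\<close> steps. All edges
  share a vertex iff the sum of the degrees is twice their maximum. The other two conditions require
  maximum degree at most two, so that all adjacency lists can be read. Components of at most three
  vertices are recognised locally. Linear forests are recognised by adding the edges one by one and
  storing, at either end of each path formed so far, its opposite end: an edge closes a cycle iff it
  joins two opposite ends.
\<close>

section \<open>Minors\<close>

text \<open>The definition of density asks for a limit, so its existence has to be proved. A graph
  with n vertices and k components has n - k edges up to O(1); since k is at least n / i up to O(1),
  and n / i components of size i are attainable, the upper and lower bounds on the number of edges
  share the constant 1 - 1 / i. Linear forests are treated as orders in which no vertex separates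
  two adjacent ones. This refutes cycles and vertices of degree three directly, without a
  classification of the minors of paths. Two obstacles shape the time bound. The number of graphs
  must be linear in n, which incomparability provides: a graph without vertices can only be alone in
  an anti-chain. And reading all entries may take quadratic time; but degrees are stored as lengths
  of lists, so that degrees alone settle the star condition and the degree bound. The table of
  opposite ends lies directly behind the input, whose end has to be computed first, and it is reset
  for every graph.\<close>

lemma pair_graph_iff:
  "pair_graph G \<longleftrightarrow> finite (pverts G) \<and> parcs G \<subseteq> pverts G \<times> pverts G \<and> sym (parcs G) \<and> irrefl (parcs G)"
proof
  assume "pair_graph G"
  then interpret pair_graph G .
  have "sym (parcs G)" using pair_sym_arcs by (simp add: symmetric_def)
  moreover have "irrefl (parcs G)" using pair_no_loops by (force intro: irreflI)
  moreover have "parcs G \<subseteq> pverts G \<times> pverts G" using arc_fst_in_verts arc_snd_in_verts by force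
  ultimately show "finite (pverts G) \<and> parcs G \<subseteq> pverts G \<times> pverts G \<and> sym (parcs G) \<and> irrefl (parcs G)"
    using pair_finite_verts by simp
next
  assume *: "finite (pverts G) \<and> parcs G \<subseteq> pverts G \<times> pverts G \<and> sym (parcs G) \<and> irrefl (parcs G)"
  then have "finite (parcs G)" by (meson finite_SigmaI finite_subset)
  with * show "pair_graph G"
    by unfold_locales (auto simp: symmetric_def irrefl_def)
qed

text \<open>Matches \<open>connected\<close> for symmetric arcs, but over a bare relation, so that
  branch sets are handled as plain sets without the digraph records.\<close>

definition conn :: "'a rel \<Rightarrow> 'a set \<Rightarrow> bool" where
  "conn E S \<longleftrightarrow> S \<noteq> {} \<and> (\<forall>u\<in>S. \<forall>v\<in>S. (u, v) \<in> (Restr E S)\<^sup>*)"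

lemma rtrancl_on_iff_Restr:
  assumes "u \<in> S"
  shows "(u, v) \<in> rtrancl_on S R \<longleftrightarrow> (u, v) \<in> (Restr R S)\<^sup>*"
proof
  assume "(u, v) \<in> rtrancl_on S R"
  then show "(u, v) \<in> (Restr R S)\<^sup>*"
    by (induction rule: rtrancl_on_induct) (auto intro: rtrancl_into_rtrancl)
next
  assume "(u, v) \<in> (Restr R S)\<^sup>*"
  then show "(u, v) \<in> rtrancl_on S R"
    using assms by (induction rule: rtrancl_induct) (auto intro: rtrancl_on.intros)
qed

lemma connected_induce_subgraph_iff:
  assumes "sym (parcs G)"
  shows "Digraph_Component.connected (with_proj G \<restriction> S) \<longleftrightarrow> conn (parcs G) S"
proof -
  have "parcs (mk_symmetric (with_proj G \<restriction> S)) = Restr (parcs G) S"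
    using assms by (auto simp: parcs_mk_symmetric sym_def)
  then show ?thesis
    unfolding Digraph_Component.connected_def strongly_connected_def conn_def reachable_def
    by (simp add: rtrancl_on_iff_Restr)
qed

definition minor_model :: "graph \<Rightarrow> graph \<Rightarrow> (nat \<Rightarrow> nat set) \<Rightarrow> bool" where
  "minor_model H G B \<longleftrightarrow>
    (\<forall>v \<in> pverts H. B v \<subseteq> pverts G \<and> conn (parcs G) (B v)) \<and>
    (\<forall>u \<in> pverts H. \<forall>v \<in> pverts H. u \<noteq> v \<longrightarrow> B u \<inter> B v = {}) \<and>
    (\<forall>(u, v) \<in> parcs H. \<exists>x \<in> B u. \<exists>y \<in> B v. (x, y) \<in> parcs G)"

lemma minor_iff_model:
  assumes "sym (parcs G)"
  shows "minor H G \<longleftrightarrow> (\<exists>B. minor_model H G B)"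
  unfolding minor_def minor_model_def using connected_induce_subgraph_iff[OF assms] by simp

lemma minor_modelD:
  assumes "minor_model H G B"
  shows "v \<in> pverts H \<Longrightarrow> B v \<subseteq> pverts G"
    and "v \<in> pverts H \<Longrightarrow> conn (parcs G) (B v)"
    and "u \<in> pverts H \<Longrightarrow> v \<in> pverts H \<Longrightarrow> u \<noteq> v \<Longrightarrow> B u \<inter> B v = {}"
    and "(u, v) \<in> parcs H \<Longrightarrow> \<exists>x \<in> B u. \<exists>y \<in> B v. (x, y) \<in> parcs G"
  using assms unfolding minor_model_def by fast+

lemma minor_modelI:
  assumes "\<And>v. v \<in> pverts H \<Longrightarrow> B v \<subseteq> pverts G"
    and "\<And>v. v \<in> pverts H \<Longrightarrow> conn (parcs G) (B v)"
    and "\<And>u v. u \<in> pverts H \<Longrightarrow> v \<in> pverts H \<Longrightarrow> u \<noteq> v \<Longrightarrow> B u \<inter> B v = {}"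
    and "\<And>u v. (u, v) \<in> parcs H \<Longrightarrow> \<exists>x \<in> B u. \<exists>y \<in> B v. (x, y) \<in> parcs G"
  shows "minor_model H G B"
  using assms unfolding minor_model_def by fast

lemma conn_singleton [simp]: "conn E {x}"
  by (simp add: conn_def)

text \<open>Walks lift from \<open>D\<close> to the union: an arc of \<open>F\<close> is realised by
  an arc between the two sets, and within one set every point is reachable. This is what makes
  composed branch sets connected.\<close>

lemma conn_UN:
  assumes D: "conn F D"
    and B: "\<And>w. w \<in> D \<Longrightarrow> conn E (B w)"
    and adj: "\<And>v w. (v, w) \<in> F \<Longrightarrow> v \<in> D \<Longrightarrow> w \<in> D \<Longrightarrow> \<exists>x\<in>B v. \<exists>y\<in>B w. (x, y) \<in> E"
  shows "conn E (\<Union>w\<in>D. B w)"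
proof -
  let ?U = "\<Union>w\<in>D. B w"
  have inside: "(x, y) \<in> (Restr E ?U)\<^sup>*" if "w \<in> D" "x \<in> B w" "y \<in> B w" for w x y
  proof -
    have "(x, y) \<in> (Restr E (B w))\<^sup>*" using B[OF that(1)] that by (auto simp: conn_def)
    moreover have "Restr E (B w) \<subseteq> Restr E ?U" using that by auto
    ultimately show ?thesis using rtrancl_mono by blast
  qed
  have reach: "\<forall>y\<in>B w. (x, y) \<in> (Restr E ?U)\<^sup>*"
    if "(v, w) \<in> (Restr F D)\<^sup>*" "v \<in> D" "x \<in> B v" for v w x
    using that
  proof (induction rule: rtrancl_induct)
    case base
    then show ?case using inside by blast
  next
    case (step w w')
    then have ww: "(w, w') \<in> F" "w \<in> D" "w' \<in> D" by auto
    obtain a b where ab: "a \<in> B w" "b \<in> B w'" "(a, b) \<in> E" using adj[OF ww] by blast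
    have "(x, a) \<in> (Restr E ?U)\<^sup>*" using step ab by blast
    moreover have "(a, b) \<in> Restr E ?U" using ab ww by auto
    ultimately have "(x, b) \<in> (Restr E ?U)\<^sup>*" by (rule rtrancl_into_rtrancl)
    then show ?case using inside[OF ww(3) ab(2)] by (meson rtrancl_trans)
  qed
  have "?U \<noteq> {}" using D B by (fastforce simp: conn_def)
  moreover have "(x, y) \<in> (Restr E ?U)\<^sup>*" if "x \<in> ?U" "y \<in> ?U" for x y
    using that D reach unfolding conn_def by blast
  ultimately show ?thesis unfolding conn_def by blast
qed

text \<open>The index interval is connected by successor steps, and \<open>conn_UN\<close> with
  singletons transports this along \<open>p\<close>.\<close>

lemma conn_image_segment:
  assumes "i < j" and walk: "\<And>l. i \<le> l \<Longrightarrow> Suc l < j \<Longrightarrow> (p l, p (Suc l)) \<in> E" and "sym E"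
  shows "conn E (p ` {i..<j})"
proof -
  define F where "F = {(a, b). b = Suc a \<or> a = Suc b}"
  have "(i, l) \<in> (Restr F {i..<j})\<^sup>*" if "i \<le> l" "l < j" for l
    using that
  proof (induction l rule: dec_induct)
    case (step n)
    then have "(i, n) \<in> (Restr F {i..<j})\<^sup>*" "(n, Suc n) \<in> Restr F {i..<j}"
      by (simp_all add: F_def)
    then show ?case by (rule rtrancl_into_rtrancl)
  qed simp
  moreover have "sym ((Restr F {i..<j})\<^sup>*)"
    unfolding F_def by (rule sym_rtrancl) (auto intro: symI)
  ultimately have "(l, l') \<in> (Restr F {i..<j})\<^sup>*" if "l \<in> {i..<j}" "l' \<in> {i..<j}" for l l'
    using that by (meson atLeastLessThan_iff rtrancl_trans symD)
  then have "conn F {i..<j}"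
    unfolding conn_def using \<open>i < j\<close> by simp
  then have "conn E (\<Union>l\<in>{i..<j}. {p l})"
  proof (rule conn_UN)
    fix a b assume "(a, b) \<in> F" "a \<in> {i..<j}" "b \<in> {i..<j}"
    then show "\<exists>x\<in>{p a}. \<exists>y\<in>{p b}. (x, y) \<in> E"
      using walk[of a] symD[OF \<open>sym E\<close> walk[of b]] by (auto simp: F_def)
  qed simp
  then show ?thesis by (simp add: UNION_singleton_eq_range)
qed

text \<open>Branch sets compose: \<open>v\<close> receives the union of the sets \<open>B w\<close>
  over all \<open>w\<close> in \<open>D v\<close>.\<close>

lemma minor_trans:
  assumes HF: "minor H F" and FG: "minor F G"
    and "sym (parcs F)" "sym (parcs G)" "parcs H \<subseteq> pverts H \<times> pverts H"
  shows "minor H G"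
proof -
  from HF obtain D where "minor_model H F D" unfolding minor_iff_model[OF assms(3)] by blast
  note D = minor_modelD[OF this]
  from FG obtain B where "minor_model F G B" unfolding minor_iff_model[OF assms(4)] by blast
  note B = minor_modelD[OF this]
  let ?A = "\<lambda>v. \<Union>w\<in>D v. B w"
  have "?A v \<subseteq> pverts G \<and> conn (parcs G) (?A v)" if "v \<in> pverts H" for v
  proof
    show "?A v \<subseteq> pverts G" using D(1)[OF that] B(1) by blast
    show "conn (parcs G) (?A v)"
      using D(1,2)[OF that] B(2,4) by (intro conn_UN[of "parcs F"]) auto
  qed
  moreover have "?A u \<inter> ?A v = {}" if "u \<in> pverts H" "v \<in> pverts H" "u \<noteq> v" for u v
  proof -
    have "B w \<inter> B w' = {}" if "w \<in> D u" "w' \<in> D v" for w w'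
      using that D(1)[OF \<open>u \<in> pverts H\<close>] D(1)[OF \<open>v \<in> pverts H\<close>]
        D(3)[OF \<open>u \<in> pverts H\<close> \<open>v \<in> pverts H\<close> \<open>u \<noteq> v\<close>] B(3)[of w w'] by blast
    then show ?thesis by blast
  qed
  moreover have "\<exists>x \<in> ?A u. \<exists>y \<in> ?A v. (x, y) \<in> parcs G" if "(u, v) \<in> parcs H" for u v
    using D(4)[OF that] B(4) by blast
  ultimately have "minor_model H G ?A" by (intro minor_modelI) auto
  then show ?thesis using minor_iff_model[OF assms(4)] by blast
qed

text \<open>Singleton branch sets suffice, as an embedding needs no contraction.\<close>

lemma minor_if_embedding:
  assumes "sym (parcs G)" "inj_on f (pverts H)" "f ` pverts H \<subseteq> pverts G"
    and "\<And>u v. (u, v) \<in> parcs H \<Longrightarrow> (f u, f v) \<in> parcs G"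
  shows "minor H G"
proof -
  have "minor_model H G (\<lambda>v. {f v})"
    using assms(2-4) by (intro minor_modelI) (auto dest: inj_onD)
  then show ?thesis using minor_iff_model[OF assms(1)] by blast
qed

section \<open>Isomorphism and its compatibility with minors\<close>

lemma isomorphic_obtain:
  assumes "isomorphic G H"
  obtains f where "bij_betw f (pverts G) (pverts H)" "parcs H = map_prod f f ` parcs G"
    "parcs G \<subseteq> pverts G \<times> pverts G"
proof -
  from assms obtain h where h: "pre_digraph.digraph_isomorphism (with_proj G) h"
    and eq: "with_proj H = app_iso h (with_proj G)"
    unfolding isomorphic_def digraph_iso_def by blast
  let ?f = "iso_verts h"
  have V: "pverts H = ?f ` pverts G" using arg_cong[OF eq, of verts] by simp
  have A: "parcs H = iso_arcs h ` parcs G" using arg_cong[OF eq, of arcs] by simp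
  have tl: "iso_tail h = fst" "iso_head h = snd"
    using arg_cong[OF eq, of tail] arg_cong[OF eq, of head] by simp_all
  have "iso_arcs h a = map_prod ?f ?f a" if "a \<in> parcs G" for a
    using h that tl by (auto simp: pre_digraph.digraph_isomorphism_def prod_eq_iff)
  then have "parcs H = map_prod ?f ?f ` parcs G" unfolding A by simp
  moreover have "bij_betw ?f (pverts G) (pverts H)"
    using h V by (simp add: pre_digraph.digraph_isomorphism_def bij_betw_def)
  moreover have "parcs G \<subseteq> pverts G \<times> pverts G"
    using h by (force simp: pre_digraph.digraph_isomorphism_def wf_digraph_def)
  ultimately show ?thesis using that by blast
qed

lemma isomorphicI:
  assumes "bij_betw f (pverts G) (pverts H)" "parcs H = map_prod f f ` parcs G"
    "parcs G \<subseteq> pverts G \<times> pverts G"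
  shows "isomorphic G H"
proof -
  let ?h = "\<lparr>iso_verts = f, iso_arcs = map_prod f f, iso_head = snd, iso_tail = fst\<rparr>"
  have inj: "inj_on f (pverts G)" using assms(1) by (simp add: bij_betw_def)
  have "inj_on (map_prod f f) (parcs G)"
    using map_prod_inj_on[OF inj inj] assms(3) inj_on_subset by blast
  moreover have "wf_digraph (with_proj G)" using assms(3) by unfold_locales auto
  ultimately have "pre_digraph.digraph_isomorphism (with_proj G) ?h"
    using inj by (simp add: pre_digraph.digraph_isomorphism_def)
  moreover have "with_proj H = app_iso ?h (with_proj G)"
    using assms(1,2) by (simp add: app_iso_def with_proj_def bij_betw_def)
  ultimately show ?thesis unfolding isomorphic_def digraph_iso_def by blast
qed

lemma isomorphic_sym:
  assumes "isomorphic G H"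
  shows "isomorphic H G"
proof -
  from assms obtain f where f: "bij_betw f (pverts G) (pverts H)" "parcs H = map_prod f f ` parcs G"
    "parcs G \<subseteq> pverts G \<times> pverts G" by (rule isomorphic_obtain)
  let ?g = "the_inv_into (pverts G) f"
  have inv: "?g (f x) = x" if "x \<in> pverts G" for x
    using f(1) that by (simp add: bij_betw_def the_inv_into_f_f)
  show ?thesis
  proof (rule isomorphicI)
    show "bij_betw ?g (pverts H) (pverts G)" using f(1) by (rule bij_betw_the_inv_into)
    have "map_prod ?g ?g ` parcs H = (\<lambda>a. a) ` parcs G"
      unfolding f(2) image_image using f(3) inv by (intro image_cong) auto
    then show "parcs G = map_prod ?g ?g ` parcs H" by simp
    show "parcs H \<subseteq> pverts H \<times> pverts H" using f by (auto simp: bij_betw_def)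
  qed
qed

text \<open>This is how an input list is known to describe a simple graph: \<open>represents\<close>
  only supplies an isomorphism to a member of the anti-chain.\<close>

lemma pair_graph_isomorphic:
  assumes "isomorphic G H" "pair_graph H"
  shows "pair_graph G"
proof -
  from isomorphic_sym[OF assms(1)] obtain f where f: "bij_betw f (pverts H) (pverts G)"
    "parcs G = map_prod f f ` parcs H" by (rule isomorphic_obtain)
  show ?thesis
    unfolding pair_graph_iff
  proof (intro conjI)
    have H: "finite (pverts H)" "parcs H \<subseteq> pverts H \<times> pverts H" "sym (parcs H)" "irrefl (parcs H)"
      using assms(2) by (auto simp: pair_graph_iff)
    show "finite (pverts G)" using f(1) H(1) bij_betw_finite by blast
    show "parcs G \<subseteq> pverts G \<times> pverts G" using f H(2) by (auto simp: bij_betw_def)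
    show "sym (parcs G)" unfolding f(2) using H(3) by (force simp: sym_def)
    show "irrefl (parcs G)" unfolding f(2) irrefl_def
    proof (intro allI notI)
      fix a assume "(a, a) \<in> map_prod f f ` parcs H"
      then obtain x y where xy: "(x, y) \<in> parcs H" "f x = f y" by auto
      then have "x = y" using H(2) f(1) by (auto simp: bij_betw_def dest: inj_onD)
      then show False using xy H(4) by (auto simp: irrefl_def)
    qed
  qed
qed

lemma isomorphic_minor:
  assumes "isomorphic G H" "sym (parcs H)"
  shows "minor G H"
proof -
  from assms(1) obtain f where "bij_betw f (pverts G) (pverts H)" "parcs H = map_prod f f ` parcs G"
    by (rule isomorphic_obtain)
  then show ?thesis
    using assms(2) by (intro minor_if_embedding[of _ f]) (auto simp: bij_betw_def)
qed

lemma minor_cong_isomorphic: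
  assumes "isomorphic G H" "pair_graph H" "pair_graph X"
  shows "minor G X \<longleftrightarrow> minor H X"
proof -
  have G: "pair_graph G" using pair_graph_isomorphic assms(1,2) .
  show ?thesis
    using isomorphic_minor[OF assms(1)] isomorphic_minor[OF isomorphic_sym[OF assms(1)]]
      minor_trans[of H G X] minor_trans[of G H X] G assms(2,3)
    unfolding pair_graph_iff by blast
qed

section \<open>Linear forests, stars and disjoint triangles\<close>

definition path_graph :: "nat \<Rightarrow> graph" where
  "path_graph n = \<lparr>pverts = {..<n}, parcs = {(i, j). i < n \<and> j < n \<and> (i = Suc j \<or> j = Suc i)}\<rparr>"

definition star_graph :: "nat \<Rightarrow> graph" where
  "star_graph n = \<lparr>pverts = {..n}, parcs = {(i, j). i \<le> n \<and> j \<le> n \<and> i \<noteq> j \<and> (i = 0 \<or> j = 0)}\<rparr>"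

definition triangles :: "nat \<Rightarrow> graph" where
  "triangles n = \<lparr>pverts = {..<3 * n},
    parcs = {(i, j). i < 3 * n \<and> j < 3 * n \<and> i \<noteq> j \<and> i div 3 = j div 3}\<rparr>"

lemma pair_graph_path_graph [simp]: "pair_graph (path_graph n)"
  and pair_graph_star_graph [simp]: "pair_graph (star_graph n)"
  and pair_graph_triangles [simp]: "pair_graph (triangles n)"
  by (auto simp: pair_graph_iff path_graph_def star_graph_def triangles_def sym_def irrefl_def)

text \<open>Linear forests seen as orders. The values of \<open>f\<close> may have gaps, so that the
  least elements of branch sets in a path can serve as positions.\<close>

definition path_layout :: "'a set \<Rightarrow> 'a rel \<Rightarrow> bool" where
  "path_layout V E \<longleftrightarrow> (\<exists>f :: 'a \<Rightarrow> nat. inj_on f V \<and>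
    (\<forall>(u, v) \<in> E. \<forall>w \<in> V. \<not> (f u < f w \<and> f w < f v)))"

text \<open>A walk on the path changes its position by one at each step and cannot jump over
  \<open>c\<close>.\<close>

lemma conn_path_convex:
  assumes "conn (parcs (path_graph n)) S" "a \<in> S" "b \<in> S" "a \<le> c" "c \<le> b"
  shows "c \<in> S"
proof (rule ccontr)
  assume c: "c \<notin> S"
  have "(a, b) \<in> (Restr (parcs (path_graph n)) S)\<^sup>*" using assms by (simp add: conn_def)
  then have "b < c"
  proof (induction rule: rtrancl_induct)
    case base
    then show ?case using c assms by (metis le_neq_implies_less)
  next
    case (step y z)
    then have "z \<in> S" "z \<le> Suc y" by (auto simp: path_graph_def)
    then show ?case using step.IH c by (metis Suc_leI le_trans nat_less_le)
  qed
  then show False using assms by simp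
qed

text \<open>A vertex is placed at the least element of its branch set. If \<open>w\<close> were
  placed between adjacent \<open>u\<close> and \<open>v\<close>, its position would lie in the
  interval \<open>B u\<close>, which extends up to \<open>B v\<close>.\<close>

lemma path_layout_if_minor_path:
  assumes "minor H (path_graph n)" "finite (pverts H)" "parcs H \<subseteq> pverts H \<times> pverts H"
  shows "path_layout (pverts H) (parcs H)"
proof -
  let ?P = "parcs (path_graph n)"
  have symP: "sym ?P" using pair_graph_path_graph by (simp only: pair_graph_iff)
  from assms(1) obtain B where "minor_model H (path_graph n) B" unfolding minor_iff_model[OF symP] by blast
  note B = minor_modelD[OF this]
  define f where "f v = (LEAST x. x \<in> B v)" for v
  have mem: "f v \<in> B v" if "v \<in> pverts H" for v
  proof -
    have "B v \<noteq> {}" using B(2)[OF that] unfolding conn_def by (rule conjunct1)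
    then show ?thesis unfolding f_def by (metis LeastI_ex ex_in_conv)
  qed
  have least: "f v \<le> x" if "x \<in> B v" for v x
    unfolding f_def using that by (rule Least_le)
  have "inj_on f (pverts H)"
    using mem B(3) by (intro inj_onI) (metis disjoint_iff)
  moreover have False if uv: "(u, v) \<in> parcs H" and w: "w \<in> pverts H" and
    lt: "f u < f w" "f w < f v" for u v w
  proof -
    have V: "u \<in> pverts H" "v \<in> pverts H" using uv assms(3) by auto
    obtain x y where xy: "x \<in> B u" "y \<in> B v" "(x, y) \<in> ?P" using B(4)[OF uv] by blast
    have "f w \<in> B u"
    proof (rule conn_path_convex)
      show "conn ?P (B u)" using B(2)[OF V(1)] by simp
      show "f u \<in> B u" "x \<in> B u" using mem V xy by auto
      \<comment> \<open>Since \<open>f w < f v\<close> and \<open>f v \<le> y\<close>, the position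
        \<open>f w\<close> is at most \<open>x\<close> and so between two elements of
        \<open>B u\<close>.\<close>
      have "y \<le> Suc x" using xy(3) by (auto simp: path_graph_def)
      then show "f w \<le> x" using least[OF xy(2)] lt by linarith
    qed (use lt in simp)
    moreover have "f w \<in> B w" "w \<noteq> u" using mem[OF w] lt by auto
    ultimately show False using B(3)[OF V(1) w] by blast
  qed
  ultimately show ?thesis unfolding path_layout_def by blast
qed

text \<open>Every edge of a star contains 0, so each edge of \<open>H\<close> ends in the only
  vertex whose branch set contains 0.\<close>

lemma incident_if_minor_star:
  assumes "minor H (star_graph n)" "parcs H \<subseteq> pverts H \<times> pverts H"
  shows "\<exists>c. \<forall>(u, v) \<in> parcs H. c = u \<or> c = v"
proof -
  let ?S = "parcs (star_graph n)"
  have symS: "sym ?S" using pair_graph_star_graph by (simp only: pair_graph_iff)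
  from assms(1) obtain B where "minor_model H (star_graph n) B" unfolding minor_iff_model[OF symS] by blast
  note B = minor_modelD[OF this]
  have z: "0 \<in> B u \<or> 0 \<in> B v" if "(u, v) \<in> parcs H" for u v
    using B(4)[OF that] by (auto simp: star_graph_def)
  show ?thesis
  proof (cases "\<exists>c\<in>pverts H. 0 \<in> B c")
    case True
    then obtain c where "c \<in> pverts H" "0 \<in> B c" by blast
    then show ?thesis using z B(3) assms(2) by (intro exI[of _ c]) blast
  next
    case False
    have "parcs H = {}"
    proof (rule equals0I)
      fix a assume "a \<in> parcs H"
      then show False using False z[of "fst a" "snd a"] assms(2) by (cases a) auto
    qed
    then show ?thesis by simp
  qed
qed

lemma minor_star_if_incident:
  assumes "pair_graph H" and c: "\<forall>(u, v) \<in> parcs H. c = u \<or> c = v"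
  shows "\<exists>n. minor H (star_graph n)"
proof -
  have H: "finite (pverts H)" "parcs H \<subseteq> pverts H \<times> pverts H" "irrefl (parcs H)"
    using assms(1) by (auto simp: pair_graph_iff)
  define f where "f v = (if v = c then 0 else Suc v)" for v :: nat
  let ?n = "Suc (Max (pverts H))"
  have "f v \<le> ?n" if "v \<in> pverts H" for v
    using Max_ge[OF H(1) that] by (auto simp: f_def)
  moreover have "sym (parcs (star_graph ?n))" using pair_graph_star_graph by (simp only: pair_graph_iff)
  ultimately have "minor H (star_graph ?n)"
  proof (intro minor_if_embedding[of _ f])
    show inj: "inj_on f (pverts H)" by (auto simp: f_def inj_on_def split: if_splits)
    fix u v assume uv: "(u, v) \<in> parcs H"
    then have "u \<in> pverts H" "v \<in> pverts H" "u \<noteq> v" using H by (auto simp: irrefl_def)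
    moreover have "f u = 0 \<or> f v = 0" using c uv by (auto simp: f_def)
    ultimately show "(f u, f v) \<in> parcs (star_graph ?n)"
      using \<open>\<And>v. v \<in> pverts H \<Longrightarrow> f v \<le> ?n\<close> inj by (simp add: star_graph_def inj_on_eq_iff)
  qed (auto simp: star_graph_def)
  then show ?thesis by blast
qed

text \<open>A branch set stays inside one triangle, whose number is \<open>h v\<close>, and disjoint
  branch sets in a triangle are at most three. A block may gather several components, so components
  themselves need not be mentioned.\<close>

lemma small_blocks_if_minor_triangles:
  assumes "minor H (triangles n)" "finite (pverts H)" "parcs H \<subseteq> pverts H \<times> pverts H"
  shows "\<exists>h :: nat \<Rightarrow> nat. (\<forall>(u, v) \<in> parcs H. h u = h v) \<and> (\<forall>j. card {v \<in> pverts H. h v = j} \<le> 3)"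
proof -
  let ?T = "parcs (triangles n)"
  have symT: "sym ?T" using pair_graph_triangles by (simp only: pair_graph_iff)
  from assms(1) obtain B where "minor_model H (triangles n) B" unfolding minor_iff_model[OF symT] by blast
  note B = minor_modelD[OF this]
  define r where "r v = (SOME x. x \<in> B v)" for v
  have r: "r v \<in> B v" if "v \<in> pverts H" for v
  proof -
    have "B v \<noteq> {}" using B(2)[OF that] unfolding conn_def by (rule conjunct1)
    then show ?thesis unfolding r_def by (simp add: some_in_eq)
  qed
  have same: "x div 3 = y div 3" if "v \<in> pverts H" "x \<in> B v" "y \<in> B v" for v x y
  proof -
    have "(x, y) \<in> (Restr ?T (B v))\<^sup>*" using B(2) that by (auto simp: conn_def)
    then show ?thesis
      by (induction rule: rtrancl_induct) (auto simp: triangles_def)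
  qed
  define h where "h v = r v div 3" for v
  have "h u = h v" if uv: "(u, v) \<in> parcs H" for u v
  proof -
    have V: "u \<in> pverts H" "v \<in> pverts H" using uv assms(3) by auto
    obtain x y where "x \<in> B u" "y \<in> B v" "(x, y) \<in> ?T" using B(4)[OF uv] by blast
    moreover from this have "x div 3 = y div 3" by (simp add: triangles_def)
    ultimately show ?thesis
      using same[OF V(1) r[OF V(1)], of x] same[OF V(2) r[OF V(2)], of y] by (simp add: h_def)
  qed
  moreover have "card {v \<in> pverts H. h v = j} \<le> 3" for j
  proof -
    have "inj_on r {v \<in> pverts H. h v = j}"
    proof (rule inj_onI)
      fix u v assume "u \<in> {v \<in> pverts H. h v = j}" "v \<in> {v \<in> pverts H. h v = j}" "r u = r v"
      then show "u = v" using r[of u] r[of v] B(3)[of u v] by auto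
    qed
    moreover have "r ` {v \<in> pverts H. h v = j} \<subseteq> {3 * j..<3 * j + 3}"
      by (auto simp: h_def)
    ultimately have "card {v \<in> pverts H. h v = j} \<le> card {3 * j..<3 * j + 3}"
      by (rule card_inj_on_le) simp
    then show ?thesis by simp
  qed
  ultimately show ?thesis by blast
qed

text \<open>Block \<open>j\<close> is placed injectively on the vertices \<open>3 * j\<close> to
  \<open>3 * j + 2\<close> of triangle \<open>j\<close>.\<close>

lemma minor_triangles_if_small_blocks:
  assumes "pair_graph H" and h: "\<forall>(u, v) \<in> parcs H. h u = (h v :: nat)"
    and card: "\<And>j. card {v \<in> pverts H. h v = j} \<le> 3"
  shows "\<exists>n. minor H (triangles n)"
proof -
  have H: "finite (pverts H)" "parcs H \<subseteq> pverts H \<times> pverts H" "irrefl (parcs H)"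
    using assms(1) by (auto simp: pair_graph_iff)
  have "\<exists>g. g ` {v \<in> pverts H. h v = j} \<subseteq> {..<3 :: nat} \<and> inj_on g {v \<in> pverts H. h v = j}" for j
    using H(1) card[of j] by (intro card_le_inj) auto
  then have "\<exists>g. \<forall>j. g j ` {v \<in> pverts H. h v = j} \<subseteq> {..<3 :: nat} \<and> inj_on (g j) {v \<in> pverts H. h v = j}"
    by (intro choice allI)
  then obtain g where g: "\<And>j. g j ` {v \<in> pverts H. h v = j} \<subseteq> {..<3 :: nat}"
    "\<And>j. inj_on (g j) {v \<in> pverts H. h v = j}" by blast
  define f where "f v = 3 * h v + g (h v) v" for v
  have g3: "g (h v) v < 3" if "v \<in> pverts H" for v using g(1)[of "h v"] that by blast
  have dv: "f v div 3 = h v" if "v \<in> pverts H" for v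
    using g3[OF that] by (simp add: f_def)
  have inj: "inj_on f (pverts H)"
  proof (rule inj_onI)
    fix u v assume uv: "u \<in> pverts H" "v \<in> pverts H" "f u = f v"
    then have "h u = h v" using dv by metis
    moreover from this have "g (h v) u = g (h v) v" using uv by (simp add: f_def)
    ultimately show "u = v" using g(2)[of "h v"] uv by (auto dest: inj_onD)
  qed
  let ?n = "Suc (Max (h ` pverts H))"
  have lt: "f v < 3 * ?n" if "v \<in> pverts H" for v
  proof -
    have "h v \<le> Max (h ` pverts H)" using H(1) that by simp
    then show ?thesis using g3[OF that] by (simp add: f_def)
  qed
  have "minor H (triangles ?n)"
  proof (rule minor_if_embedding[of _ f])
    show "sym (parcs (triangles ?n))" using pair_graph_triangles by (simp only: pair_graph_iff)
    show "f ` pverts H \<subseteq> pverts (triangles ?n)" using lt by (auto simp: triangles_def)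
    fix u v assume uv: "(u, v) \<in> parcs H"
    then have V: "u \<in> pverts H" "v \<in> pverts H" "u \<noteq> v" using H by (auto simp: irrefl_def)
    then have "f u \<noteq> f v" using inj by (auto dest: inj_onD)
    moreover have "f u div 3 = f v div 3" using dv V h uv by auto
    ultimately show "(f u, f v) \<in> parcs (triangles ?n)" using lt V by (simp add: triangles_def)
  qed fact
  then show ?thesis by blast
qed

section \<open>Components\<close>

definition edges :: "'a rel \<Rightarrow> 'a set set" where
  "edges E = (\<lambda>(u, v). {u, v}) ` E"

lemma in_edges_iff: "e \<in> edges E \<longleftrightarrow> (\<exists>u v. e = {u, v} \<and> (u, v) \<in> E)"
  by (auto simp: edges_def)

lemma num_edges_eq: "num_edges G = card (edges (parcs G))"
  unfolding num_edges_def by (rule arg_cong[of _ _ card]) (simp add: set_eq_iff in_edges_iff)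

lemma edges_mono: "E \<subseteq> F \<Longrightarrow> edges E \<subseteq> edges F"
  unfolding edges_def by (rule image_mono)

lemma edges_empty [simp]: "edges {} = {}"
  by (simp add: edges_def)

lemma finite_edges: "finite E \<Longrightarrow> finite (edges E)"
  by (simp add: edges_def)

lemma finite_edges_Restr: "finite S \<Longrightarrow> finite (edges (Restr E S))"
  by (intro finite_edges finite_Int disjI2 finite_cartesian_product)

lemma card_edges_le_square: "finite S \<Longrightarrow> card (edges (Restr E S)) \<le> card S * card S"
proof -
  assume "finite S"
  then have "card (edges (Restr E S)) \<le> card (Restr E S)"
    unfolding edges_def by (intro card_image_le) simp
  also have "\<dots> \<le> card (S \<times> S)" using \<open>finite S\<close> by (intro card_mono) auto
  finally show ?thesis by (simp add: card_cartesian_product)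
qed

text \<open>A bare vertex set and relation, so that the results also apply after deleting a vertex
  or restricting to a component.\<close>

locale fin_graph =
  fixes V :: "'a set" and E :: "'a rel"
  assumes finite_V: "finite V" and E_subset: "E \<subseteq> V \<times> V" and sym_E: "sym E" and irrefl_E: "irrefl E"
begin

definition comps :: "'a set set" where
  "comps = (\<lambda>v. E\<^sup>* `` {v}) ` V"

lemma finite_E: "finite E"
  using finite_V E_subset by (meson finite_SigmaI finite_subset)

lemma sym_rtrancl_E: "(x, y) \<in> E\<^sup>* \<Longrightarrow> (y, x) \<in> E\<^sup>*"
  using sym_rtrancl[OF sym_E] by (rule symD)

lemma reach_in_V: "(x, y) \<in> E\<^sup>* \<Longrightarrow> x \<in> V \<Longrightarrow> y \<in> V"
  by (induction rule: rtrancl_induct) (use E_subset in auto)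

lemma comps_subset: "S \<in> comps \<Longrightarrow> S \<subseteq> V"
  unfolding comps_def using reach_in_V by auto

lemma finite_comp: "S \<in> comps \<Longrightarrow> finite S"
  using comps_subset finite_V finite_subset by blast

lemma finite_comps: "finite comps"
  unfolding comps_def using finite_V by simp

lemma comps_nonempty: "S \<in> comps \<Longrightarrow> S \<noteq> {}"
  unfolding comps_def by auto

lemma comp_eq:
  assumes "S \<in> comps" "x \<in> S"
  shows "S = E\<^sup>* `` {x}"
proof -
  obtain v where v: "S = E\<^sup>* `` {v}" using assms(1) unfolding comps_def by auto
  then have "(v, x) \<in> E\<^sup>*" "(x, v) \<in> E\<^sup>*" using assms(2) sym_rtrancl_E by auto
  then show ?thesis unfolding v by (auto intro: rtrancl_trans)
qed

lemma disjoint_comps: "disjoint comps"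
proof (rule disjointI)
  fix S T assume ST: "S \<in> comps" "T \<in> comps" "S \<noteq> T"
  then show "S \<inter> T = {}" using comp_eq by blast
qed

lemma Union_comps: "\<Union>comps = V"
  using comps_subset unfolding comps_def by blast

lemma sum_card_comps: "(\<Sum>S\<in>comps. card S) = card V"
proof -
  have "card (\<Union>comps) = (\<Sum>S\<in>comps. card S)"
    using disjoint_comps finite_comp
    by (intro card_Union_disjoint) (auto simp: disjoint_def pairwise_def disjnt_def)
  then show ?thesis by (simp add: Union_comps)
qed

text \<open>For any set of components, because the lower bound on the density keeps only some of
  them.\<close>

lemma sum_edges_Union:
  assumes "Q \<subseteq> comps"
  shows "(\<Sum>S\<in>Q. card (edges (Restr E S))) = card (\<Union>S\<in>Q. edges (Restr E S))"
proof (rule card_UN_disjoint[symmetric])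
  show "finite Q" using assms finite_comps by (rule finite_subset)
  show "\<forall>S\<in>Q. finite (edges (Restr E S))"
    using finite_comp assms by (blast intro: finite_edges_Restr)
  show "\<forall>S\<in>Q. \<forall>T\<in>Q. S \<noteq> T \<longrightarrow> edges (Restr E S) \<inter> edges (Restr E T) = {}"
  proof (intro ballI impI)
    fix S T assume "S \<in> Q" "T \<in> Q" "S \<noteq> T"
    then have "S \<inter> T = {}" using disjoint_comps assms by (auto simp: disjoint_def)
    moreover have "e \<noteq> {}" "e \<subseteq> S" if "e \<in> edges (Restr E S)" for e S
      using that by (auto simp: in_edges_iff)
    ultimately show "edges (Restr E S) \<inter> edges (Restr E T) = {}" by blast
  qed
qed

lemma sum_edges_comps: "(\<Sum>S\<in>comps. card (edges (Restr E S))) = card (edges E)"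
proof -
  have "edges E = (\<Union>S\<in>comps. edges (Restr E S))"
  proof
    show "edges E \<subseteq> (\<Union>S\<in>comps. edges (Restr E S))"
    proof
      fix e assume "e \<in> edges E"
      then obtain u v where uv: "e = {u, v}" "(u, v) \<in> E" unfolding in_edges_iff by blast
      then have "E\<^sup>* `` {u} \<in> comps" using E_subset unfolding comps_def by blast
      moreover have "(u, v) \<in> Restr E (E\<^sup>* `` {u})" using uv by auto
      ultimately show "e \<in> (\<Union>S\<in>comps. edges (Restr E S))" using uv(1) unfolding UN_iff in_edges_iff by blast
    qed
    show "(\<Union>S\<in>comps. edges (Restr E S)) \<subseteq> edges E" by (intro UN_least edges_mono) blast
  qed
  then show ?thesis using sum_edges_Union[of comps] by simp
qed

lemma conn_comp:
  assumes "S \<in> comps"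
  shows "conn E S"
  unfolding conn_def
proof (intro conjI ballI)
  fix u v assume u: "u \<in> S" and "v \<in> S"
  then have "(u, v) \<in> E\<^sup>*" using comp_eq[OF assms u] by blast
  then show "(u, v) \<in> (Restr E S)\<^sup>*"
  proof (induction rule: rtrancl_induct)
    case (step y z)
    then have "(u, z) \<in> E\<^sup>*" by simp
    then have "y \<in> S" "z \<in> S" using comp_eq[OF assms u] step by auto
    then show ?case using step by (auto intro: rtrancl_into_rtrancl)
  qed simp
qed (use assms comps_nonempty in auto)

end

lemma fin_graph_pair_graph: "pair_graph G \<Longrightarrow> fin_graph (pverts G) (parcs G)"
  by (simp add: fin_graph_def pair_graph_iff)

section \<open>Edges, cycles and sizes of components\<close>

lemma rtrancl_crossing:
  assumes "(a, b) \<in> R\<^sup>*" "a \<in> T" "b \<notin> T"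
  shows "\<exists>x y. (x, y) \<in> R \<and> x \<in> T \<and> y \<notin> T"
  using assms by (induction rule: rtrancl_induct) auto

text \<open>A subset of \<open>S\<close> is grown vertex by vertex: connectedness provides an arc
  that leaves it, and this is an edge not counted so far.\<close>

lemma conn_card_le:
  assumes "conn E S" "finite S"
  shows "card S \<le> Suc (card (edges (Restr E S)))"
proof -
  have grow: "\<exists>T\<subseteq>S. card T = Suc t \<and> t \<le> card (edges (Restr E T))" if "Suc t \<le> card S" for t
    using that
  proof (induction t)
    case 0
    obtain x where "x \<in> S" using assms(1) by (auto simp: conn_def)
    then show ?case by (intro exI[of _ "{x}"]) auto
  next
    case (Suc t)
    then obtain T where T: "T \<subseteq> S" "card T = Suc t" "t \<le> card (edges (Restr E T))" by auto
    have finT: "finite T" using T(1) assms(2) by (rule finite_subset)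
    obtain a where a: "a \<in> T" using T(2) by fastforce
    obtain b where b: "b \<in> S" "b \<notin> T" using T Suc.prems assms(2) by (metis Suc_n_not_le_n subsetI subset_antisym)
    have "(a, b) \<in> (Restr E S)\<^sup>*" using assms(1) a b T(1) by (auto simp: conn_def)
    from rtrancl_crossing[OF this a b(2)]
    obtain x y where xy: "(x, y) \<in> Restr E S" "x \<in> T" "y \<notin> T" by blast
    let ?T = "insert y T"
    have "{x, y} \<notin> edges (Restr E T)" using xy(3) by (auto simp: in_edges_iff doubleton_eq_iff)
    then have "Suc (card (edges (Restr E T))) = card (insert {x, y} (edges (Restr E T)))"
      using finite_edges_Restr[OF finT] by simp
    also have "\<dots> \<le> card (edges (Restr E ?T))"
    proof (rule card_mono)
      show "finite (edges (Restr E ?T))" using finT by (intro finite_edges_Restr) simp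
      show "insert {x, y} (edges (Restr E T)) \<subseteq> edges (Restr E ?T)"
      proof (rule insert_subsetI)
        show "{x, y} \<in> edges (Restr E ?T)" using xy unfolding in_edges_iff by blast
        show "edges (Restr E T) \<subseteq> edges (Restr E ?T)" by (intro edges_mono) blast
      qed
    qed
    finally have "Suc t \<le> card (edges (Restr E ?T))" using T(3) by simp
    moreover have "card ?T = Suc (Suc t)" using finT T(2) xy(3) by simp
    moreover have "?T \<subseteq> S" using xy T(1) by auto
    ultimately show ?case by blast
  qed
  have "card S \<noteq> 0" using assms by (auto simp: conn_def)
  then obtain T where "T \<subseteq> S" "card T = Suc (card S - 1)" "card S - 1 \<le> card (edges (Restr E T))"
    using grow[of "card S - 1"] by auto
  moreover from this \<open>card S \<noteq> 0\<close> have "T = S" using assms(2) by (simp add: card_subset_eq)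
  ultimately show ?thesis by simp
qed

definition triangle_model :: "'a rel \<Rightarrow> 'a set \<Rightarrow> (nat \<Rightarrow> 'a set) \<Rightarrow> bool" where
  "triangle_model E S B \<longleftrightarrow> (\<forall>r<3. B r \<subseteq> S \<and> conn E (B r)) \<and>
    (\<forall>r<3. \<forall>s<3. r \<noteq> s \<longrightarrow> B r \<inter> B s = {} \<and> (\<exists>x\<in>B r. \<exists>y\<in>B s. (x, y) \<in> E))"

text \<open>Deleting a vertex of degree at most one loses at most one edge, so there remain as many
  edges as vertices until every degree is at least two. Degree two is phrased as the possibility to
  avoid any given neighbour, as a walk without turning back requires.\<close>

lemma min_degree_two_subset:
  assumes "fin_graph V E" "V \<noteq> {}" "card V \<le> card (edges E)"
  shows "\<exists>W\<subseteq>V. W \<noteq> {} \<and> (\<forall>v\<in>W. \<forall>a. \<exists>c\<in>W. (v, c) \<in> E \<and> c \<noteq> a)"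
  using assms
proof (induction "card V" arbitrary: V E rule: less_induct)
  case less
  interpret fin_graph V E by fact
  show ?case
  proof (cases "\<forall>v\<in>V. \<forall>a. \<exists>c\<in>V. (v, c) \<in> E \<and> c \<noteq> a")
    case True
    then show ?thesis using less.prems(2) by blast
  next
    case False
    then obtain v a where va: "v \<in> V" "\<And>c. c \<in> V \<Longrightarrow> (v, c) \<in> E \<Longrightarrow> c = a" by blast
    let ?V = "V - {v}"
    let ?E = "Restr E ?V"
    have G': "fin_graph ?V ?E"
      using finite_V sym_E irrefl_E by unfold_locales (auto simp: sym_def irrefl_def)
    have nbr: "c = a" if "(v, c) \<in> E \<or> (c, v) \<in> E" for c
      using that va(2) E_subset symD[OF sym_E] by blast
    have "edges E \<subseteq> insert {v, a} (edges ?E)"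
    proof
      fix e assume "e \<in> edges E"
      then obtain x y where xy: "e = {x, y}" "(x, y) \<in> E" unfolding in_edges_iff by blast
      consider "x = v" | "y = v" | "x \<noteq> v" "y \<noteq> v" by blast
      then show "e \<in> insert {v, a} (edges ?E)"
      proof cases
        case 3
        then have "(x, y) \<in> ?E" using xy E_subset by auto
        then show ?thesis using xy(1) unfolding insert_iff in_edges_iff by blast
      qed (use xy nbr in auto)
    qed
    moreover have fin': "finite (edges ?E)" using finite_V by (intro finite_edges_Restr) simp
    ultimately have "card (edges E) \<le> card (insert {v, a} (edges ?E))"
      by (intro card_mono) auto
    also have "\<dots> \<le> Suc (card (edges ?E))" using fin' by (simp add: card_insert_if)
    finally have le: "card ?V \<le> card (edges ?E)"
      using less.prems(3) va(1) finite_V by simp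
    \<comment> \<open>A single vertex carries no edge and would violate the assumed number of
      edges.\<close>
    have "?V \<noteq> {}"
    proof
      assume "?V = {}"
      then have "V = {v}" using va(1) by auto
      then have "E = {}" using E_subset irrefl_E by (auto simp: irrefl_def)
      then show False using less.prems(2,3) finite_V by simp
    qed
    moreover have "card ?V < card V" using va(1) finite_V by (rule card_Diff1_less[rotated])
    ultimately obtain W where "W \<subseteq> ?V" "W \<noteq> {}" "\<forall>v\<in>W. \<forall>a. \<exists>c\<in>W. (v, c) \<in> ?E \<and> c \<noteq> a"
      using less.hyps[OF _ G' _ le] by blast
    then show ?thesis by (intro exI[of _ W]) blast
  qed
qed

context fin_graph
begin

text \<open>In a subset of minimum degree two a walk can go on forever without turning back. Its
  first repetition closes a cycle, which contracts to a triangle.\<close>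

lemma triangle_model_if_many_edges:
  assumes "V \<noteq> {}" "card V \<le> card (edges E)"
  shows "\<exists>B. triangle_model E V B"
proof -
  obtain W where W: "W \<subseteq> V" "W \<noteq> {}" and next2: "\<And>v a. v \<in> W \<Longrightarrow> \<exists>c\<in>W. (v, c) \<in> E \<and> c \<noteq> a"
    using min_degree_two_subset[OF fin_graph_axioms assms] by blast
  \<comment> \<open>The states of the dependent choice are arcs, so that the next vertex can be
    chosen different from the previous one.\<close>
  have "\<exists>q. \<forall>n. (fst (q n) \<in> W \<and> snd (q n) \<in> W \<and> (fst (q n), snd (q n)) \<in> E) \<and>
      (fst (q (Suc n)) = snd (q n) \<and> snd (q (Suc n)) \<noteq> fst (q n))"
  proof (rule dependent_nat_choice)
    obtain v where "v \<in> W" using W(2) by blast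
    moreover from this obtain c where "c \<in> W" "(v, c) \<in> E" using next2[of v v] by blast
    ultimately show "\<exists>q. fst q \<in> W \<and> snd q \<in> W \<and> (fst q, snd q) \<in> E" by (intro exI[of _ "(v, c)"]) simp
  next
    fix q :: "'a \<times> 'a" and n :: nat
    assume q: "fst q \<in> W \<and> snd q \<in> W \<and> (fst q, snd q) \<in> E"
    then obtain c where "c \<in> W" "(snd q, c) \<in> E" "c \<noteq> fst q" using next2 by blast
    then show "\<exists>q'. (fst q' \<in> W \<and> snd q' \<in> W \<and> (fst q', snd q') \<in> E) \<and>
        (fst q' = snd q \<and> snd q' \<noteq> fst q)"
      using q by (intro exI[of _ "(snd q, c)"]) simp
  qed
  then obtain q where q: "\<And>n. fst (q n) \<in> W" "\<And>n. (fst (q n), snd (q n)) \<in> E"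
    "\<And>n. fst (q (Suc n)) = snd (q n)" "\<And>n. snd (q (Suc n)) \<noteq> fst (q n)" by blast
  define p where "p n = fst (q n)" for n
  have step: "(p n, p (Suc n)) \<in> E" for n using q(2,3) by (simp add: p_def)
  have pW: "p n \<in> W" for n using q(1) by (simp add: p_def)
  have turn: "p (Suc (Suc n)) \<noteq> p n" for n using q(3,4) by (simp add: p_def)
  have "\<not> inj p"
    using finite_V W(1) pW by (metis finite_imageD finite_subset image_subsetI infinite_UNIV_nat)
  then obtain i0 j0 where "p i0 = p j0" "i0 < j0"
    unfolding inj_def by (metis linorder_neqE_nat)
  then have ex: "\<exists>j. \<exists>i<j. p i = p j" by blast
  \<comment> \<open>The first index whose vertex occurred before; below \<open>j\<close> the walk is
    injective.\<close>
  define j where "j = (LEAST j. \<exists>i<j. p i = p j)"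
  obtain i where i: "i < j" "p i = p j" using LeastI_ex[OF ex] unfolding j_def by blast
  have inj: "p a \<noteq> p b" if "a < b" "b < j" for a b
    using not_less_Least[of b "\<lambda>j. \<exists>i<j. p i = p j"] that unfolding j_def by blast
  \<comment> \<open>Consecutive vertices differ by irreflexivity, and vertices two steps apart
    because the walk never turns back. So the cycle has at least three vertices.\<close>
  have "j \<noteq> Suc i" using step[of i] i irrefl_E by (auto simp: irrefl_def)
  moreover have "j \<noteq> Suc (Suc i)" using turn[of i] i by auto
  ultimately have j: "Suc (Suc i) < j" using i(1) by linarith
  \<comment> \<open>Two consecutive vertices of the cycle, and the remaining segment contracted to
    the third corner.\<close>
  define B where "B r = (if r = 0 then {p i} else if r = 1 then {p (Suc i)} else p ` {Suc (Suc i)..<j})"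
    for r :: nat
  have sub: "B r \<subseteq> V" for r using pW W(1) by (auto simp: B_def)
  have "conn E (p ` {Suc (Suc i)..<j})" using j step sym_E by (intro conn_image_segment) auto
  then have con: "conn E (B r)" for r by (simp add: B_def)
  have adj: "(p (j - 1), p i) \<in> E" using step[of "j - 1"] i j by simp
  have A01: "\<exists>x\<in>B 0. \<exists>y\<in>B 1. (x, y) \<in> E" using step by (simp add: B_def)
  have A12: "\<exists>x\<in>B 1. \<exists>y\<in>B 2. (x, y) \<in> E"
    using step[of "Suc i"] j by (auto simp: B_def)
  have A20: "\<exists>x\<in>B 2. \<exists>y\<in>B 0. (x, y) \<in> E"
    using adj j by (auto simp: B_def intro!: bexI[of _ "j - 1"])
  have flip: "\<exists>x\<in>S. \<exists>y\<in>T. (x, y) \<in> E" if "\<exists>x\<in>T. \<exists>y\<in>S. (x, y) \<in> E" for S T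
    using that symD[OF sym_E] by blast
  have D01: "B 0 \<inter> B 1 = {}" using inj[of i "Suc i"] j by (simp add: B_def)
  have notin: "p m \<notin> p ` {Suc (Suc i)..<j}" if "m < Suc (Suc i)" for m
  proof
    assume "p m \<in> p ` {Suc (Suc i)..<j}"
    then obtain l where "p m = p l" "l \<in> {Suc (Suc i)..<j}" by (rule imageE)
    then show False using inj[of m l] that by simp
  qed
  have D02: "B 0 \<inter> B 2 = {}" using notin[of i] by (simp add: B_def)
  have D12: "B 1 \<inter> B 2 = {}" using notin[of "Suc i"] by (simp add: B_def)
  have "B r \<inter> B s = {} \<and> (\<exists>x\<in>B r. \<exists>y\<in>B s. (x, y) \<in> E)" if "r < 3" "s < 3" "r \<noteq> s" for r s
  proof -
    have "r = 0 \<or> r = 1 \<or> r = 2" "s = 0 \<or> s = 1 \<or> s = 2" using that by auto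
    then show ?thesis
      using that(3) A01 A12 A20 flip[OF A01] flip[OF A12] flip[OF A20] D01 D02 D12
      by (elim disjE) (simp_all add: Int_commute)
  qed
  then have "triangle_model E V B" using sub con unfolding triangle_model_def by blast
  then show ?thesis by blast
qed

lemma triangle_model_comp:
  assumes S: "S \<in> comps" and "card S \<le> card (edges (Restr E S))"
  shows "\<exists>B. triangle_model E S B"
proof -
  have "fin_graph S (Restr E S)"
    using finite_comp[OF S] sym_E irrefl_E by unfold_locales (auto simp: sym_def irrefl_def)
  from fin_graph.triangle_model_if_many_edges[OF this comps_nonempty[OF S] assms(2)]
  obtain B where B: "triangle_model (Restr E S) S B" by blast
  have "conn E T" if "conn (Restr E S) T" for T
    using that rtrancl_mono[of "Restr (Restr E S) T" "Restr E T"] unfolding conn_def by blast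
  with B have "triangle_model E S B" unfolding triangle_model_def by blast
  then show ?thesis by blast
qed

end

text \<open>Each cyclic component supplies one triangle: \<open>v div 3\<close> selects the
  component and \<open>v mod 3\<close> the branch set in it.\<close>

lemma minor_triangles_if_cyclic_comps:
  assumes G: "pair_graph G"
    and c: "c \<le> card {S \<in> fin_graph.comps (pverts G) (parcs G). card S \<le> card (edges (Restr (parcs G) S))}"
      (is "c \<le> card ?C")
  shows "minor (triangles c) G"
proof -
  let ?E = "parcs G"
  interpret fin_graph "pverts G" ?E using G by (rule fin_graph_pair_graph)
  have "finite ?C" using finite_comps by simp
  then obtain e where e: "e ` {..<c} \<subseteq> ?C" "inj_on e {..<c}"
    using card_le_inj[of "{..<c}" ?C] c by auto
  have "\<forall>j. \<exists>B. j < c \<longrightarrow> triangle_model ?E (e j) B"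
    using e(1) triangle_model_comp by blast
  then have "\<exists>T. \<forall>j. j < c \<longrightarrow> triangle_model ?E (e j) (T j)" by (rule choice)
  then obtain T where T: "\<And>j. j < c \<Longrightarrow> triangle_model ?E (e j) (T j)" by blast
  let ?B = "\<lambda>v. T (v div 3) (v mod 3)"
  have ec: "e j \<in> comps" if "j < c" for j using e(1) that by blast
  have sub: "?B v \<subseteq> e (v div 3)" "conn ?E (?B v)" if "v < 3 * c" for v
  proof -
    have "v div 3 < c" using that by (simp add: less_mult_imp_div_less mult.commute)
    from T[OF this] show "?B v \<subseteq> e (v div 3)" "conn ?E (?B v)" by (simp_all add: triangle_model_def)
  qed
  have "minor_model (triangles c) G ?B"
  proof (rule minor_modelI)
    fix v assume "v \<in> pverts (triangles c)"
    then have v: "v < 3 * c" "v div 3 < c"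
      by (auto simp: triangles_def less_mult_imp_div_less mult.commute)
    show "?B v \<subseteq> pverts G" using sub(1)[OF v(1)] comps_subset[OF ec[OF v(2)]] by blast
    show "conn ?E (?B v)" by (rule sub(2)[OF v(1)])
  next
    fix u v assume "u \<in> pverts (triangles c)" "v \<in> pverts (triangles c)" "u \<noteq> v"
    then have uv: "u < 3 * c" "u div 3 < c" "v < 3 * c" "v div 3 < c" "u \<noteq> v"
      by (auto simp: triangles_def less_mult_imp_div_less mult.commute)
    show "?B u \<inter> ?B v = {}"
    proof (cases "u div 3 = v div 3")
      case True
      then have "u mod 3 \<noteq> v mod 3" using uv(5) by (metis div_mod_decomp)
      then show ?thesis using T[OF uv(2)] True by (simp add: triangle_model_def)
    next
      case False
      then have "e (u div 3) \<noteq> e (v div 3)" using e(2) uv by (auto dest: inj_onD)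
      then have "e (u div 3) \<inter> e (v div 3) = {}"
        using disjoint_comps ec[OF uv(2)] ec[OF uv(4)] by (simp add: disjoint_def)
      then show ?thesis using sub(1)[OF uv(1)] sub(1)[OF uv(3)] by blast
    qed
  next
    fix u v assume "(u, v) \<in> parcs (triangles c)"
    then have uv: "u div 3 < c" "u \<noteq> v" "u div 3 = v div 3"
      by (auto simp: triangles_def less_mult_imp_div_less mult.commute)
    then have "u mod 3 \<noteq> v mod 3" by (metis div_mod_decomp)
    then show "\<exists>x\<in>?B u. \<exists>y\<in>?B v. (x, y) \<in> ?E"
      using T[OF uv(1)] uv(3) by (simp add: triangle_model_def)
  qed
  then show ?thesis using minor_iff_model[OF sym_E] by blast
qed

text \<open>A shortest walk repeats no vertex, since the part between two equal vertices could be
  cut out.\<close>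

lemma minor_path_if_distance:
  assumes G: "pair_graph G" and reach: "(v, x) \<in> parcs G ^^ d" and v: "v \<in> pverts G"
    and least: "\<And>d'. d' < d \<Longrightarrow> (v, x) \<notin> parcs G ^^ d'" and "a \<le> Suc d"
  shows "minor (path_graph a) G"
proof -
  let ?E = "parcs G"
  interpret fin_graph "pverts G" ?E using G by (rule fin_graph_pair_graph)
  obtain p where p: "p 0 = v" "p d = x" "\<And>i. i < d \<Longrightarrow> (p i, p (Suc i)) \<in> ?E"
    using reach unfolding relpow_fun_conv by blast
  have walk: "(p i, p (i + l)) \<in> ?E ^^ l" if "i + l \<le> d" for i l
    using that p(3) by (induction l) auto
  have neq: "p i \<noteq> p j" if "i < j" "j \<le> d" for i j
  proof
    assume eq: "p i = p j"
    have "(v, p i) \<in> ?E ^^ i" using walk[of 0 i] p(1) that by simp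
    moreover have "(p i, x) \<in> ?E ^^ (d - j)" using walk[of j "d - j"] p(2) that eq by simp
    ultimately have "(v, x) \<in> ?E ^^ (i + (d - j))" by (auto simp: relpow_add)
    then show False using least[of "i + (d - j)"] that by linarith
  qed
  show ?thesis
  proof (rule minor_if_embedding[of _ p])
    show "sym ?E" by (rule sym_E)
    show "inj_on p (pverts (path_graph a))"
    proof (rule inj_onI)
      fix i j assume "i \<in> pverts (path_graph a)" "j \<in> pverts (path_graph a)" "p i = p j"
      then show "i = j" using neq[of i j] neq[of j i] \<open>a \<le> Suc d\<close>
        by (cases i j rule: linorder_cases) (auto simp: path_graph_def)
    qed
    have "p i \<in> pverts G" if "i \<le> d" for i
    proof -
      have "(v, p i) \<in> ?E\<^sup>*" using walk[of 0 i] p(1) that by (simp add: relpow_imp_rtrancl)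
      then show ?thesis using v by (rule reach_in_V)
    qed
    then show "p ` pverts (path_graph a) \<subseteq> pverts G" using \<open>a \<le> Suc d\<close> by (auto simp: path_graph_def)
    fix i j assume "(i, j) \<in> parcs (path_graph a)"
    then show "(p i, p j) \<in> ?E" using p(3) symD[OF sym_E p(3)] \<open>a \<le> Suc d\<close>
      by (auto simp: path_graph_def)
  qed
qed

lemma minor_star_if_degree:
  assumes G: "pair_graph G" and v: "v \<in> pverts G" and b: "b \<le> card (parcs G `` {v})"
  shows "minor (star_graph b) G"
proof -
  let ?E = "parcs G"
  interpret fin_graph "pverts G" ?E using G by (rule fin_graph_pair_graph)
  have fin: "finite (?E `` {v})" using finite_E by (rule finite_Image)
  then obtain e where e: "e ` {1..b} \<subseteq> ?E `` {v}" "inj_on e {1..b}"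
    using card_le_inj[of "{1..b}" "?E `` {v}"] b by auto
  define f where "f i = (if i = 0 then v else e i)" for i
  have nb: "(v, f i) \<in> ?E" if "i \<noteq> 0" "i \<le> b" for i using that image_subset_iff[THEN iffD1, OF e(1)] by (simp add: f_def)
  have irr: "(x, x) \<notin> ?E" for x using irrefl_E by (simp add: irrefl_def)
  show ?thesis
  proof (rule minor_if_embedding[of _ f])
    show "sym ?E" by (rule sym_E)
    show "inj_on f (pverts (star_graph b))"
    proof (rule inj_onI)
      fix i j assume ij: "i \<in> pverts (star_graph b)" "j \<in> pverts (star_graph b)" "f i = f j"
      then have le: "i \<le> b" "j \<le> b" by (auto simp: star_graph_def)
      show "i = j"
      proof (cases "i = 0 \<or> j = 0")
        case True
        have "f 0 = v" by (simp add: f_def)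
        then show ?thesis using True nb[of i] nb[of j] irr[of v] ij(3) le by (cases "i = 0"; cases "j = 0") auto
      next
        case False
        then show ?thesis using ij(3) le inj_onD[OF e(2)] by (simp add: f_def)
      qed
    qed
    have "f i \<in> pverts G" if "i \<le> b" for i
      using v nb[OF _ that] E_subset by (cases "i = 0") (auto simp: f_def)
    then show "f ` pverts (star_graph b) \<subseteq> pverts G" by (auto simp: star_graph_def)
    fix i j assume "(i, j) \<in> parcs (star_graph b)"
    then have ij: "i \<le> b" "j \<le> b" "i \<noteq> j" "i = 0 \<or> j = 0" by (auto simp: star_graph_def)
    have "f 0 = v" by (simp add: f_def)
    then show "(f i, f j) \<in> ?E"
      using ij nb[of i] nb[of j] symD[OF sym_E, of v "f i"] by (cases "i = 0") auto
  qed
qed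

text \<open>Every vertex of the component is at distance less than \<open>a\<close>, because a
  shortest walk contains a path. The excluded star bounds all degrees by \<open>b\<close>, so walks
  of length \<open>i\<close> reach at most \<open>b ^ i\<close> vertices.\<close>

lemma card_comp_le:
  assumes G: "pair_graph G" and nopath: "\<not> minor (path_graph a) G" and nostar: "\<not> minor (star_graph b) G"
    and S: "S \<in> fin_graph.comps (pverts G) (parcs G)"
  shows "card S \<le> (\<Sum>i<a. b ^ i)"
proof -
  let ?E = "parcs G"
  interpret fin_graph "pverts G" ?E using G by (rule fin_graph_pair_graph)
  obtain v where v: "v \<in> pverts G" "S = ?E\<^sup>* `` {v}" using S unfolding comps_def by blast
  have deg: "card (?E `` {y}) \<le> b" for y
  proof (cases "y \<in> pverts G")
    case True
    then show ?thesis using minor_star_if_degree[OF G True] nostar by (meson nat_le_linear)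
  next
    case False
    then have "?E `` {y} = {}" using E_subset by auto
    then show ?thesis by simp
  qed
  have finlev: "finite ((?E ^^ i) `` {v})" for i
  proof (rule finite_subset[OF _ finite_V], rule subsetI)
    fix y assume "y \<in> (?E ^^ i) `` {v}"
    then have "(v, y) \<in> ?E\<^sup>*" by (auto dest: relpow_imp_rtrancl)
    then show "y \<in> pverts G" using v(1) by (rule reach_in_V)
  qed
  have "?E\<^sup>* `` {v} \<subseteq> (\<Union>i<a. (?E ^^ i) `` {v})"
  proof
    fix x assume "x \<in> ?E\<^sup>* `` {v}"
    then have ex: "\<exists>d. (v, x) \<in> ?E ^^ d" by (simp add: rtrancl_power)
    define d where "d = (LEAST d. (v, x) \<in> ?E ^^ d)"
    have d: "(v, x) \<in> ?E ^^ d" unfolding d_def using ex by (rule LeastI_ex)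
    have least: "(v, x) \<notin> ?E ^^ d'" if "d' < d" for d' using that unfolding d_def by (rule not_less_Least)
    have "\<not> a \<le> Suc d" using minor_path_if_distance[OF G d v(1) least] nopath by blast
    then show "x \<in> (\<Union>i<a. (?E ^^ i) `` {v})" using d by (intro UN_I[of d]) auto
  qed
  then have "card S \<le> card (\<Union>i<a. (?E ^^ i) `` {v})"
    unfolding v(2) by (intro card_mono finite_UN_I finlev) auto
  also have "\<dots> \<le> (\<Sum>i<a. card ((?E ^^ i) `` {v}))" by (rule card_UN_le) simp
  also have "\<dots> \<le> (\<Sum>i<a. b ^ i)"
  proof (rule sum_mono)
    fix i
    show "card ((?E ^^ i) `` {v}) \<le> b ^ i"
    proof (induction i)
      case (Suc i)
      have "(?E ^^ Suc i) `` {v} = (\<Union>y\<in>(?E ^^ i) `` {v}. ?E `` {y})" by auto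
      then have "card ((?E ^^ Suc i) `` {v}) \<le> (\<Sum>y\<in>(?E ^^ i) `` {v}. card (?E `` {y}))"
        using card_UN_le[OF finlev] by simp
      also have "\<dots> \<le> card ((?E ^^ i) `` {v}) * b" using sum_bounded_above[of _ "\<lambda>y. card (?E `` {y})" b] deg by simp
      also have "\<dots> \<le> b ^ i * b" using Suc.IH by simp
      finally show ?case by (simp add: mult.commute)
    qed simp
  qed
  finally show ?thesis .
qed

section \<open>Limiting density\<close>

text \<open>A minor-closed class contains the edgeless graph on \<open>n\<close> vertices iff it
  contains some graph with at least \<open>n\<close> vertices. These graphs thus detect whether the
  class is infinite up to isomorphism.\<close>

definition edgeless :: "nat \<Rightarrow> graph" where
  "edgeless n = \<lparr>pverts = {..<n}, parcs = {}\<rparr>"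

lemma edgeless_simps [simp]: "pverts (edgeless n) = {..<n}" "parcs (edgeless n) = {}"
  by (simp_all add: edgeless_def)

lemma pair_graph_edgeless [simp]: "pair_graph (edgeless n)"
  by (simp add: pair_graph_iff irrefl_def)

lemma minor_edgeless:
  assumes "pair_graph G" "n \<le> card (pverts G)"
  shows "minor (edgeless n) G"
proof -
  have G: "finite (pverts G)" "sym (parcs G)" using assms(1) by (simp_all add: pair_graph_iff)
  then obtain f where "f ` {..<n} \<subseteq> pverts G" "inj_on f {..<n}"
    using card_le_inj[of "{..<n}" "pverts G"] assms(2) by auto
  then show ?thesis using G(2) by (intro minor_if_embedding[of _ f]) auto
qed

lemma minor_subgraph:
  assumes "pair_graph G" "pverts H \<subseteq> pverts G" "parcs H \<subseteq> parcs G"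
  shows "minor H G"
  using assms by (intro minor_if_embedding[of _ id]) (auto simp: pair_graph_iff)

locale minor_closed =
  fixes K :: "graph set"
  assumes pair_graph: "G \<in> K \<Longrightarrow> pair_graph G"
    and closed: "G \<in> K \<Longrightarrow> pair_graph H \<Longrightarrow> minor H G \<Longrightarrow> H \<in> K"
begin

lemma num_edges_le_square:
  assumes "G \<in> K"
  shows "num_edges G \<le> card (pverts G) * card (pverts G)"
proof -
  have "finite (pverts G)" "parcs G = Restr (parcs G) (pverts G)"
    using pair_graph[OF assms] by (auto simp: pair_graph_iff)
  then show ?thesis using card_edges_le_square[of "pverts G" "parcs G"] by (simp add: num_edges_eq)
qed

text \<open>Finiteness makes \<open>Max\<close> in \<open>ex\<close> meaningful; the set is
  non-empty as soon as \<open>edgeless n\<close> is in the class.\<close>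

lemma finite_num_edges: "finite {num_edges G |G. G \<in> K \<and> card (pverts G) = n}"
proof (rule finite_subset)
  show "{num_edges G |G. G \<in> K \<and> card (pverts G) = n} \<subseteq> {..n * n}"
    using num_edges_le_square by blast
qed simp

lemma num_edges_le_ex:
  assumes "G \<in> K" "card (pverts G) = n"
  shows "num_edges G \<le> ex K n"
  unfolding ex_def using finite_num_edges assms by (intro Max_ge) auto

lemma ex_attained:
  assumes "edgeless n \<in> K"
  shows "\<exists>G\<in>K. card (pverts G) = n \<and> ex K n = num_edges G"
proof -
  have "num_edges (edgeless n) \<in> {num_edges G |G. G \<in> K \<and> card (pverts G) = n}"
    using assms by force
  then have "ex K n \<in> {num_edges G |G. G \<in> K \<and> card (pverts G) = n}"
    unfolding ex_def using finite_num_edges by (intro Max_in) auto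
  then show ?thesis by blast
qed

text \<open>The slack 2 serves all three families: a path or a star lacks one edge, and up to two
  vertices remain beside disjoint triangles.\<close>

lemma limit_ge_one:
  assumes "\<And>n. \<exists>G\<in>K. card (pverts G) = n \<and> n \<le> num_edges G + 2"
    and "(\<lambda>n. ereal (real (ex K n) / real n)) \<longlonglongrightarrow> d"
  shows "1 \<le> d"
proof (rule LIMSEQ_le[OF _ assms(2)])
  have "(\<lambda>n. 1 - 2 / real n) \<longlonglongrightarrow> 1 - 0"
    by (intro tendsto_diff tendsto_const lim_const_over_n)
  then show "(\<lambda>n. ereal (1 - 2 / real n)) \<longlonglongrightarrow> 1" by (simp add: one_ereal_def)
  have "1 - 2 / real n \<le> real (ex K n) / real n" if "n \<ge> 1" for n
  proof -
    obtain G where "G \<in> K" "card (pverts G) = n" "n \<le> num_edges G + 2" using assms(1) by blast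
    then have "n \<le> ex K n + 2" using num_edges_le_ex by fastforce
    then have "(real n - 2) / real n \<le> real (ex K n) / real n" by (intro divide_right_mono) auto
    then show ?thesis using that by (simp add: diff_divide_distrib)
  qed
  then show "\<exists>N. \<forall>n\<ge>N. ereal (1 - 2 / real n) \<le> ereal (real (ex K n) / real n)" by auto
qed

end

lemma comps_edgeless: "fin_graph.comps (pverts (edgeless n)) (parcs (edgeless n)) = (\<lambda>v. {v}) ` {..<n}"
proof -
  interpret fin_graph "pverts (edgeless n)" "parcs (edgeless n)"
    by (rule fin_graph_pair_graph) simp
  show ?thesis unfolding comps_def by simp
qed

locale sparse_minor_closed = minor_closed +
  fixes a b c :: nat
  assumes edgeless: "edgeless n \<in> K"
    and no_path: "path_graph a \<notin> K" and no_star: "star_graph b \<notin> K" and no_triangles: "triangles c \<notin> K"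
begin

definition comps_of :: "graph \<Rightarrow> nat set set" where
  "comps_of G = fin_graph.comps (pverts G) (parcs G)"

definition max_comp :: nat where
  "max_comp = (\<Sum>i<a. b ^ i)"

lemma card_comp_le_max:
  assumes "G \<in> K" "S \<in> comps_of G"
  shows "card S \<le> max_comp"
proof -
  have "\<not> minor (path_graph a) G" "\<not> minor (star_graph b) G"
    using closed[OF assms(1)] no_path no_star by auto
  then show ?thesis
    using card_comp_le[OF pair_graph[OF assms(1)]] assms(2) unfolding max_comp_def comps_of_def by blast
qed

definition unbounded_size :: "nat \<Rightarrow> bool" where
  "unbounded_size s \<longleftrightarrow> (\<forall>N. \<exists>G\<in>K. N \<le> card {S \<in> comps_of G. card S = s})"

lemma unbounded_size_one: "unbounded_size 1"
  unfolding unbounded_size_def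
proof
  fix N
  have "{S \<in> comps_of (edgeless N). card S = 1} = (\<lambda>v. {v}) ` {..<N}"
    unfolding comps_of_def comps_edgeless by auto
  moreover have "card ((\<lambda>v. {v}) ` {..<N}) = N" by (simp add: card_image)
  ultimately show "\<exists>G\<in>K. N \<le> card {S \<in> comps_of G. card S = 1}"
    using edgeless[of N] by (intro bexI[of _ "edgeless N"]) auto
qed

lemma unbounded_size_le:
  assumes "unbounded_size s"
  shows "s \<le> max_comp"
proof (rule ccontr)
  assume s: "\<not> s \<le> max_comp"
  obtain G where G: "G \<in> K" "1 \<le> card {S \<in> comps_of G. card S = s}"
    using assms unfolding unbounded_size_def by blast
  have "{S \<in> comps_of G. card S = s} = {}" using card_comp_le_max[OF G(1)] s by auto
  then have "card {S \<in> comps_of G. card S = s} = 0" by (simp only: card.empty)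
  then show False using G(2) by simp
qed

text \<open>The limiting density is \<open>1 - 1 / period\<close>.\<close>

definition period :: nat where
  "period = Max {s. unbounded_size s}"

lemma finite_unbounded_size: "finite {s. unbounded_size s}"
proof (rule finite_subset)
  show "{s. unbounded_size s} \<subseteq> {..max_comp}" using unbounded_size_le by blast
qed simp

lemma unbounded_size_period: "unbounded_size period"
proof -
  have "{s. unbounded_size s} \<noteq> {}" using unbounded_size_one by blast
  then show ?thesis using Max_in[OF finite_unbounded_size] unfolding period_def by simp
qed

lemma period_ge_one: "1 \<le> period"
  unfolding period_def using finite_unbounded_size unbounded_size_one by (intro Max_ge) auto

text \<open>Each size above \<open>period\<close> occurs a bounded number of times, and only the
  finitely many sizes up to \<open>max_comp\<close> occur at all; the bounds are summed over
  these.\<close>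

lemma few_large_comps: "\<exists>M. \<forall>G\<in>K. card {S \<in> comps_of G. period < card S} \<le> M"
proof -
  have "\<forall>s. \<exists>M. period < s \<longrightarrow> (\<forall>G\<in>K. card {S \<in> comps_of G. card S = s} \<le> M)"
  proof
    fix s
    show "\<exists>M. period < s \<longrightarrow> (\<forall>G\<in>K. card {S \<in> comps_of G. card S = s} \<le> M)"
    proof (cases "unbounded_size s")
      case True
      then have "s \<le> period" unfolding period_def using finite_unbounded_size by (intro Max_ge) auto
      then show ?thesis by simp
    next
      case False
      then obtain N where "\<And>G. G \<in> K \<Longrightarrow> card {S \<in> comps_of G. card S = s} < N"
        unfolding unbounded_size_def not_le[symmetric] by blast
      then show ?thesis by (intro exI[of _ N]) (simp add: less_imp_le)
    qed
  qed
  then have "\<exists>M. \<forall>s. period < s \<longrightarrow> (\<forall>G\<in>K. card {S \<in> comps_of G. card S = s} \<le> M s)"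
    by (rule choice)
  then obtain M where M: "\<And>s G. period < s \<Longrightarrow> G \<in> K \<Longrightarrow> card {S \<in> comps_of G. card S = s} \<le> M s"
    by blast
  have "card {S \<in> comps_of G. period < card S} \<le> (\<Sum>s\<in>{period<..max_comp}. M s)" if G: "G \<in> K" for G
  proof -
    interpret fin_graph "pverts G" "parcs G" using pair_graph[OF G] by (rule fin_graph_pair_graph)
    have fin: "finite (comps_of G)" unfolding comps_of_def by (rule finite_comps)
    have "{S \<in> comps_of G. period < card S} \<subseteq> (\<Union>s\<in>{period<..max_comp}. {S \<in> comps_of G. card S = s})"
      using card_comp_le_max[OF G] by auto
    then have "card {S \<in> comps_of G. period < card S}
        \<le> card (\<Union>s\<in>{period<..max_comp}. {S \<in> comps_of G. card S = s})"
      using fin by (intro card_mono) auto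
    also have "\<dots> \<le> (\<Sum>s\<in>{period<..max_comp}. card {S \<in> comps_of G. card S = s})"
      by (rule card_UN_le) simp
    also have "\<dots> \<le> (\<Sum>s\<in>{period<..max_comp}. M s)"
      using M[OF _ G] by (intro sum_mono) auto
    finally show ?thesis .
  qed
  then show ?thesis by blast
qed

text \<open>Let a graph have n vertices and k components. Acyclic components have one edge less than
  vertices and the others are few, so k plus the number of edges is at most n + O(1). Large
  components are few too, so n is at most \<open>period\<close> times k, plus O(1). Eliminating k
  gives the bound, multiplied by \<open>period\<close> to stay within the natural numbers.\<close>

lemma num_edges_upper:
  "\<exists>D. \<forall>G\<in>K. period * num_edges G + card (pverts G) \<le> period * card (pverts G) + D"
proof -
  obtain M where M: "\<And>G. G \<in> K \<Longrightarrow> card {S \<in> comps_of G. period < card S} \<le> M"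
    using few_large_comps by blast
  \<comment> \<open>Exceeds the number of edges of any component, so that a cyclic component is paid
    for as a whole.\<close>
  let ?X = "Suc (max_comp * max_comp)"
  have "period * num_edges G + card (pverts G) \<le> period * card (pverts G) + (period * (c * ?X) + M * max_comp)"
    if G: "G \<in> K" for G
  proof -
    interpret fin_graph "pverts G" "parcs G" using pair_graph[OF G] by (rule fin_graph_pair_graph)
    define e where "e S = card (edges (Restr (parcs G) S))" for S
    have co: "comps_of G = comps" by (simp add: comps_of_def)
    have "\<not> minor (triangles c) G" using closed[OF G] no_triangles by auto
    then have cyc: "card {S \<in> comps. card S \<le> e S} \<le> c"
      using minor_triangles_if_cyclic_comps[OF pair_graph[OF G]] nat_le_linear unfolding e_def by blast
    have "Suc (e S) \<le> card S + (if card S \<le> e S then ?X else 0)" if S: "S \<in> comps" for S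
    proof -
      have "e S \<le> card S * card S" unfolding e_def using finite_comp[OF S] by (rule card_edges_le_square)
      also have "\<dots> \<le> max_comp * max_comp" using card_comp_le_max[OF G] S co by (simp add: mult_le_mono)
      finally show ?thesis by auto
    qed
    then have "(\<Sum>S\<in>comps. Suc (e S)) \<le> (\<Sum>S\<in>comps. card S + (if card S \<le> e S then ?X else 0))"
      by (rule sum_mono)
    also have "\<dots> = card (pverts G) + card {S \<in> comps. card S \<le> e S} * ?X"
      using finite_comps sum_card_comps by (simp add: sum.distrib sum.If_cases Int_def)
    also have "\<dots> \<le> card (pverts G) + c * ?X" using cyc by (intro add_left_mono mult_right_mono) auto
    finally have "(\<Sum>S\<in>comps. Suc (e S)) \<le> card (pverts G) + c * ?X" .
    moreover have "(\<Sum>S\<in>comps. Suc (e S)) = card comps + num_edges G"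
      using sum_edges_comps unfolding e_def num_edges_eq by (simp add: sum_Suc)
    ultimately have A: "card comps + num_edges G \<le> card (pverts G) + c * ?X" by simp
    have "card S \<le> period + (if period < card S then max_comp else 0)" if S: "S \<in> comps" for S
      using card_comp_le_max[OF G] S co by (simp add: trans_le_add2)
    then have "(\<Sum>S\<in>comps. card S) \<le> (\<Sum>S\<in>comps. period + (if period < card S then max_comp else 0))"
      by (rule sum_mono)
    also have "\<dots> = card comps * period + card {S \<in> comps. period < card S} * max_comp"
      using finite_comps by (simp add: sum.distrib sum.If_cases Int_def)
    also have "\<dots> \<le> card comps * period + M * max_comp"
      using M[OF G] co by (intro add_left_mono mult_right_mono) auto
    finally have B: "card (pverts G) \<le> card comps * period + M * max_comp"
      using sum_card_comps by simp
    have "period * (card comps + num_edges G) \<le> period * (card (pverts G) + c * ?X)"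
      using A by (rule mult_le_mono2)
    then have "card comps * period + period * num_edges G \<le> period * card (pverts G) + period * (c * ?X)"
      by (simp add: distrib_left mult.commute)
    then show ?thesis using B by linarith
  qed
  then show ?thesis by blast
qed

text \<open>About n / \<open>period\<close> components of size \<open>period\<close> are kept, each
  with at least \<open>period - 1\<close> edges, and arbitrary further vertices of \<open>G\<close>
  fill the order up to exactly \<open>n\<close>.\<close>

lemma num_edges_lower:
  "\<exists>H\<in>K. card (pverts H) = n \<and> (period - 1) * (n div period) \<le> num_edges H"
proof -
  let ?q = "n div period"
  \<comment> \<open>One component more than is kept ensures that \<open>G\<close> has at least
    \<open>n\<close> vertices to choose from.\<close>
  obtain G where G: "G \<in> K" "Suc ?q \<le> card {S \<in> comps_of G. card S = period}"
    using unbounded_size_period unfolding unbounded_size_def by blast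
  interpret fin_graph "pverts G" "parcs G" using pair_graph[OF G(1)] by (rule fin_graph_pair_graph)
  have "{S \<in> comps_of G. card S = period} \<subseteq> comps" by (auto simp: comps_of_def)
  then have fin: "finite {S \<in> comps_of G. card S = period}" using finite_comps by (rule finite_subset)
  obtain R where R: "R \<subseteq> {S \<in> comps_of G. card S = period}" "card R = Suc ?q" "finite R"
    using obtain_subset_with_card_n[OF G(2)] by metis
  obtain Q where Q: "Q \<subseteq> R" "card Q = ?q" "finite Q"
    using obtain_subset_with_card_n[of ?q R] R(2) by (metis le_SucI order_refl)
  have RC: "R \<subseteq> comps" "\<And>S. S \<in> R \<Longrightarrow> card S = period" using R(1) by (auto simp: comps_of_def)
  have QC: "Q \<subseteq> comps" using Q(1) RC(1) by simp
  have cardU: "card (\<Union>P) = card P * period" if "P \<subseteq> R" for P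
  proof -
    have "card (\<Union>P) = (\<Sum>S\<in>P. card S)"
    proof (rule card_Union_disjoint)
      show "pairwise disjnt P"
        using that RC(1) disjoint_comps unfolding disjoint_def pairwise_def disjnt_def by blast
    qed (use that RC(1) finite_comp in blast)
    also have "\<dots> = (\<Sum>S\<in>P. period)" using that RC(2) by (intro sum.cong) auto
    finally show ?thesis by simp
  qed
  have subV: "\<Union>P \<subseteq> pverts G" if "P \<subseteq> comps" for P using that comps_subset by blast
  have "card (\<Union>R) \<le> card (pverts G)" using subV[OF RC(1)] finite_V by (rule card_mono[rotated])
  moreover have "n < Suc ?q * period" using period_ge_one dividend_less_div_times[of period n] by simp
  ultimately have "n \<le> card (pverts G)" using cardU[of R] R(2) by simp
  moreover have "card (\<Union>Q) \<le> n" using cardU[OF Q(1)] Q(2) by simp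
  ultimately obtain W where W: "\<Union>Q \<subseteq> W" "W \<subseteq> pverts G" "card W = n"
    using exists_subset_between[of "\<Union>Q" n "pverts G"] subV[OF QC] finite_V by blast
  define H where "H = \<lparr>pverts = W, parcs = Restr (parcs G) W\<rparr>"
  have "finite W" using W(2) finite_V by (rule finite_subset)
  then have "pair_graph H" using sym_E irrefl_E by (auto simp: H_def pair_graph_iff sym_def irrefl_def)
  moreover have "minor H G" using pair_graph[OF G(1)] W(2) by (intro minor_subgraph) (auto simp: H_def)
  ultimately have "H \<in> K" by (rule closed[OF G(1)])
  moreover have "(period - 1) * ?q \<le> num_edges H"
  proof -
    have "(period - 1) * ?q = (\<Sum>S\<in>Q. period - 1)" using Q(2) by simp
    also have "\<dots> \<le> (\<Sum>S\<in>Q. card (edges (Restr (parcs G) S)))"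
    proof (rule sum_mono)
      fix S assume "S \<in> Q"
      then have S: "S \<in> comps" "card S = period" using Q(1) RC by auto
      show "period - 1 \<le> card (edges (Restr (parcs G) S))"
        using conn_card_le[OF conn_comp[OF S(1)] finite_comp[OF S(1)]] S(2) by simp
    qed
    also have "\<dots> = card (\<Union>S\<in>Q. edges (Restr (parcs G) S))" by (rule sum_edges_Union[OF QC])
    also have "\<dots> \<le> card (edges (Restr (parcs G) W))"
    proof (rule card_mono)
      show "finite (edges (Restr (parcs G) W))" using \<open>finite W\<close> by (rule finite_edges_Restr)
      show "(\<Union>S\<in>Q. edges (Restr (parcs G) S)) \<subseteq> edges (Restr (parcs G) W)"
        using W(1) by (intro UN_least edges_mono) auto
    qed
    finally show ?thesis by (simp add: num_edges_eq H_def)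
  qed
  ultimately show ?thesis using W(3) by (intro bexI[of _ H]) (simp_all add: H_def)
qed

text \<open>Both edge bounds equal \<open>1 - 1 / period\<close> after division by \<open>n\<close>,
  up to an error of order 1 / n.\<close>

lemma limit_exists: "\<exists>d<1. (\<lambda>n. real (ex K n) / real n) \<longlonglongrightarrow> d"
proof -
  obtain D where D: "\<And>G. G \<in> K \<Longrightarrow> period * num_edges G + card (pverts G) \<le> period * card (pverts G) + D"
    using num_edges_upper by blast
  let ?i = "real period"
  have i: "?i \<ge> 1" using period_ge_one by simp
  have upper: "real (ex K n) / real n \<le> (1 - 1 / ?i) + (real D / ?i) / real n" if "n \<ge> 1" for n
  proof -
    obtain G where G: "G \<in> K" "card (pverts G) = n" "ex K n = num_edges G"
      using ex_attained[OF edgeless] by blast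
    have "period * ex K n + n \<le> period * n + D" using D[OF G(1)] G(2,3) by simp
    then have "?i * real (ex K n) + real n \<le> ?i * real n + real D"
      by (metis of_nat_add of_nat_le_iff of_nat_mult)
    then show ?thesis using i that by (simp add: field_simps)
  qed
  have lower: "(1 - 1 / ?i) - ?i / real n \<le> real (ex K n) / real n" if "n \<ge> 1" for n
  proof -
    obtain H where H: "H \<in> K" "card (pverts H) = n" "(period - 1) * (n div period) \<le> num_edges H"
      using num_edges_lower by blast
    have "(period - 1) * (n div period) \<le> ex K n" using num_edges_le_ex[OF H(1,2)] H(3) by simp
    then have "real ((period - 1) * (n div period)) \<le> real (ex K n)" by (rule of_nat_mono)
    then have 1: "(?i - 1) * real (n div period) \<le> real (ex K n)"
      using period_ge_one by (simp add: of_nat_diff)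
    have "n < period + n div period * period"
      using period_ge_one by (intro dividend_less_div_times) simp
    then have "real n < ?i + real (n div period) * ?i"
      by (metis of_nat_add of_nat_less_iff of_nat_mult)
    then have "real n / ?i \<le> 1 + real (n div period)" using i by (simp add: field_simps)
    then have "real n / ?i - 1 \<le> real (n div period)" by simp
    then have "(?i - 1) * (real n / ?i - 1) \<le> (?i - 1) * real (n div period)"
      using i by (intro mult_left_mono) auto
    with 1 have "(?i - 1) * (real n / ?i - 1) \<le> real (ex K n)" by simp
    moreover have "real n * (1 - 1 / ?i) - ?i \<le> (?i - 1) * (real n / ?i - 1)"
      using i by (simp add: field_simps)
    ultimately have "(real n * (1 - 1 / ?i) - ?i) / real n \<le> real (ex K n) / real n"
      by (intro divide_right_mono) auto
    then show ?thesis using that by (simp add: diff_divide_distrib)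
  qed
  have "(\<lambda>n. real (ex K n) / real n) \<longlonglongrightarrow> 1 - 1 / ?i"
  proof (rule tendsto_sandwich)
    show "\<forall>\<^sub>F n in sequentially. (1 - 1 / ?i) - ?i / real n \<le> real (ex K n) / real n"
      using lower by (auto simp: eventually_sequentially)
    show "\<forall>\<^sub>F n in sequentially. real (ex K n) / real n \<le> (1 - 1 / ?i) + (real D / ?i) / real n"
      using upper by (auto simp: eventually_sequentially)
    have "(\<lambda>n. (1 - 1 / ?i) - ?i / real n) \<longlonglongrightarrow> (1 - 1 / ?i) - 0"
      by (intro tendsto_diff tendsto_const lim_const_over_n)
    then show "(\<lambda>n. (1 - 1 / ?i) - ?i / real n) \<longlonglongrightarrow> 1 - 1 / ?i" by simp
    have "(\<lambda>n. (1 - 1 / ?i) + (real D / ?i) / real n) \<longlonglongrightarrow> (1 - 1 / ?i) + 0"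
      by (intro tendsto_add tendsto_const lim_const_over_n)
    then show "(\<lambda>n. (1 - 1 / ?i) + (real D / ?i) / real n) \<longlonglongrightarrow> 1 - 1 / ?i" by simp
  qed
  moreover have "1 - 1 / ?i < 1" using i by simp
  ultimately show ?thesis by blast
qed

end

section \<open>Minor-closed classes up to isomorphism\<close>

lemma isomorphic_trans:
  assumes "isomorphic F G" "isomorphic G H"
  shows "isomorphic F H"
proof -
  from assms(1) obtain f where f: "bij_betw f (pverts F) (pverts G)" "parcs G = map_prod f f ` parcs F"
    "parcs F \<subseteq> pverts F \<times> pverts F" by (rule isomorphic_obtain)
  from assms(2) obtain g where g: "bij_betw g (pverts G) (pverts H)" "parcs H = map_prod g g ` parcs G"
    by (rule isomorphic_obtain)
  show ?thesis
  proof (rule isomorphicI)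
    show "bij_betw (g \<circ> f) (pverts F) (pverts H)" using f(1) g(1) by (rule bij_betw_trans)
    show "parcs H = map_prod (g \<circ> f) (g \<circ> f) ` parcs F"
      unfolding g(2) f(2) image_image by (intro image_cong) auto
  qed fact
qed

context minor_closed
begin

abbreviation iso_rel :: "(graph \<times> graph) set" where
  "iso_rel \<equiv> {(G, H). pair_graph G \<and> pair_graph H \<and> isomorphic G H}"

text \<open>All graphs of the class have fewer than \<open>m\<close> vertices, so each can be
  relabelled to live on \<open>{..<m}\<close>, where there are finitely many graphs.\<close>

lemma finite_up_to_iso_if_bounded:
  assumes "edgeless m \<notin> K"
  shows "finite_up_to_iso K"
proof -
  let ?T = "(\<lambda>(V, E). \<lparr>pverts = V, parcs = E\<rparr>) ` (Pow {..<m} \<times> Pow ({..<m} \<times> {..<m})) :: graph set"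
  have "K // iso_rel \<subseteq> (\<lambda>G. iso_rel `` {G}) ` ?T"
  proof
    fix X assume "X \<in> K // iso_rel"
    then obtain G where G: "G \<in> K" "X = iso_rel `` {G}" by (rule quotientE)
    have pg: "pair_graph G" using pair_graph[OF G(1)] .
    then have V: "finite (pverts G)" "parcs G \<subseteq> pverts G \<times> pverts G" by (auto simp: pair_graph_iff)
    have "\<not> m \<le> card (pverts G)"
      using minor_edgeless[OF pg] closed[OF G(1)] assms by auto
    then have le: "{..<card (pverts G)} \<subseteq> {..<m}" by auto
    obtain f where f: "bij_betw f (pverts G) {..<card (pverts G)}"
      using finite_same_card_bij[of "pverts G" "{..<card (pverts G)}"] V(1) by auto
    define H where "H = \<lparr>pverts = {..<card (pverts G)}, parcs = map_prod f f ` parcs G\<rparr>"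
    have GH: "isomorphic G H" using f V(2) by (intro isomorphicI[of f]) (simp_all add: H_def)
    have pH: "pair_graph H" using pair_graph_isomorphic[OF isomorphic_sym[OF GH] pg] .
    then have "parcs H \<subseteq> {..<m} \<times> {..<m}" using le by (auto simp: pair_graph_iff H_def)
    then have "H \<in> ?T" using le by (intro image_eqI[of _ _ "(pverts H, parcs H)"]) (auto simp: H_def)
    moreover have "X = iso_rel `` {H}"
      unfolding G(2) using GH isomorphic_sym[OF GH] pg pH isomorphic_trans by blast
    ultimately show "X \<in> (\<lambda>G. iso_rel `` {G}) ` ?T" by blast
  qed
  then show ?thesis unfolding finite_up_to_iso_def by (rule finite_subset) simp
qed

lemma infinite_up_to_iso:
  assumes "\<And>n. edgeless n \<in> K"
  shows "\<not> finite_up_to_iso K"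
proof
  assume "finite_up_to_iso K"
  then have fin: "finite (K // iso_rel)" by (simp add: finite_up_to_iso_def)
  have "inj (\<lambda>n. iso_rel `` {edgeless n})"
  proof (rule injI)
    fix m n assume eq: "iso_rel `` {edgeless m} = iso_rel `` {edgeless n}"
    have "isomorphic (edgeless n) (edgeless n)" by (rule isomorphicI[of id]) auto
    then have "edgeless n \<in> iso_rel `` {edgeless m}" unfolding eq by simp
    then have "isomorphic (edgeless m) (edgeless n)" by simp
    then obtain f where "bij_betw f {..<m} {..<n}" by (rule isomorphic_obtain) simp
    then show "m = n" by (auto dest: bij_betw_same_card)
  qed
  moreover have "range (\<lambda>n. iso_rel `` {edgeless n}) \<subseteq> K // iso_rel"
    by (intro image_subsetI quotientI assms)
  ultimately show False using fin by (meson finite_subset finite_imageD infinite_UNIV_nat)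
qed

text \<open>Dense graphs of every order make the class infinite up to isomorphism, which rules out
  the conventional value of negative infinity.\<close>

lemma limiting_density_ge_one:
  assumes dense: "\<And>n. \<exists>G\<in>K. card (pverts G) = n \<and> n \<le> num_edges G + 2"
    and "has_limiting_density K d"
  shows "1 \<le> d"
proof -
  have "edgeless n \<in> K" for n
  proof -
    obtain G where "G \<in> K" "card (pverts G) = n" using dense by blast
    then show ?thesis using closed minor_edgeless[OF pair_graph] by simp
  qed
  then have "\<not> finite_up_to_iso K" by (rule infinite_up_to_iso)
  then show ?thesis
    using assms(2) limit_ge_one[OF dense] unfolding has_limiting_density_def by simp
qed

end

section \<open>The criterion for limiting density below 1\<close>

lemma minor_closed_excl:
  assumes "\<And>Z. Z \<in> \<Z> \<Longrightarrow> pair_graph Z"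
  shows "minor_closed (excl \<Z>)"
proof (rule minor_closed.intro)
  fix G H assume G: "G \<in> excl \<Z>" and H: "pair_graph H" "minor H G"
  have "pair_graph G" using G by (simp add: excl_def)
  then have "minor Z G" if "Z \<in> \<Z>" "minor Z H" for Z
    using minor_trans[OF that(2) H(2)] H(1) assms[OF that(1)] by (simp add: pair_graph_iff)
  then show "H \<in> excl \<Z>" using G H(1) by (auto simp: excl_def)
qed (simp add: excl_def)

lemma num_edges_ge_if_inj:
  assumes "inj_on f A" "finite (parcs G)" "f ` A \<subseteq> edges (parcs G)"
  shows "card A \<le> num_edges G"
  unfolding num_edges_eq using assms by (intro card_inj_on_le[of f]) (auto intro: finite_edges)

lemma finite_parcs: "pair_graph G \<Longrightarrow> finite (parcs G)"
  using fin_graph.finite_E[OF fin_graph_pair_graph] .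

lemma num_edges_path_graph: "n \<le> num_edges (path_graph n) + 2"
proof -
  have "card {..<n - 1} \<le> num_edges (path_graph n)"
  proof (rule num_edges_ge_if_inj)
    show "inj_on (\<lambda>i. {i, Suc i}) {..<n - 1}" by (auto simp: inj_on_def doubleton_eq_iff)
    show "(\<lambda>i. {i, Suc i}) ` {..<n - 1} \<subseteq> edges (parcs (path_graph n))"
      by (force simp: in_edges_iff path_graph_def)
  qed (simp add: finite_parcs)
  then show ?thesis by simp
qed

lemma num_edges_star_graph: "n \<le> num_edges (star_graph n)"
proof -
  have "card {1..n} \<le> num_edges (star_graph n)"
  proof (rule num_edges_ge_if_inj)
    show "inj_on (\<lambda>i. {0, i}) {1..n}" by (auto simp: inj_on_def doubleton_eq_iff)
    show "(\<lambda>i. {0, i}) ` {1..n} \<subseteq> edges (parcs (star_graph n))"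
      by (force simp: in_edges_iff star_graph_def)
  qed (simp add: finite_parcs)
  then show ?thesis by simp
qed

text \<open>Sending each vertex to the opposite edge of its triangle is injective.\<close>

lemma num_edges_triangles: "3 * n \<le> num_edges (triangles n)"
proof -
  define f where "f v = {w. w div 3 = v div 3 \<and> w \<noteq> v}" for v :: nat
  have "card {..<3 * n} \<le> num_edges (triangles n)"
  proof (rule num_edges_ge_if_inj)
    have f: "\<exists>x y. f v = {x, y} \<and> x \<noteq> y \<and> x div 3 = v div 3 \<and> y div 3 = v div 3" for v
    proof -
      define q where "q = v div 3"
      have *: "w div 3 = q \<longleftrightarrow> w = 3 * q \<or> w = 3 * q + 1 \<or> w = 3 * q + 2" for w by auto
      consider "v = 3 * q" | "v = 3 * q + 1" | "v = 3 * q + 2" using * q_def by blast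
      then show ?thesis
      proof cases
        case 1
        then have eq: "f v = {3 * q + 1, 3 * q + 2}" unfolding f_def q_def[symmetric] * by auto
        show ?thesis unfolding q_def[symmetric] eq by (rule exI[of _ "3 * q + 1"], rule exI[of _ "3 * q + 2"]) (simp add: *)
      next
        case 2
        then have eq: "f v = {3 * q, 3 * q + 2}" unfolding f_def q_def[symmetric] * by auto
        show ?thesis unfolding q_def[symmetric] eq by (rule exI[of _ "3 * q"], rule exI[of _ "3 * q + 2"]) (simp add: *)
      next
        case 3
        then have eq: "f v = {3 * q, 3 * q + 1}" unfolding f_def q_def[symmetric] * by auto
        show ?thesis unfolding q_def[symmetric] eq by (rule exI[of _ "3 * q"], rule exI[of _ "3 * q + 1"]) (simp add: *)
      qed
    qed
    show "inj_on f {..<3 * n}"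
    proof (rule inj_onI)
      fix u v assume eq: "f u = f v"
      obtain x where "x \<in> f u" using f[of u] by blast
      moreover from this have "x \<in> f v" by (simp only: eq)
      ultimately have same: "u div 3 = v div 3" unfolding f_def mem_Collect_eq by (elim conjE) (rule trans[OF sym])
      have "u \<notin> f u" unfolding f_def by blast
      then have "u \<notin> f v" by (simp only: eq not_False_eq_True)
      then show "u = v" using same unfolding f_def mem_Collect_eq by blast
    qed
    show "f ` {..<3 * n} \<subseteq> edges (parcs (triangles n))"
    proof (rule image_subsetI)
      fix v assume "v \<in> {..<3 * n}"
      then have v: "v div 3 < n" by (auto simp: less_mult_imp_div_less mult.commute)
      obtain x y where xy: "f v = {x, y}" "x \<noteq> y" "x div 3 = v div 3" "y div 3 = v div 3" using f by blast
      then have "x < 3 * n" "y < 3 * n" using v by linarith+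
      then have "(x, y) \<in> parcs (triangles n)" using xy by (simp add: triangles_def)
      then show "f v \<in> edges (parcs (triangles n))" unfolding in_edges_iff using xy(1) by blast
    qed
  qed (simp add: finite_parcs)
  then show ?thesis by simp
qed

text \<open>Left to right only refutes a given limit below 1, by a family inside
  \<open>excl \<Z>\<close>. Right to left has to produce the limit: negative infinity if the class
  is finite up to isomorphism, and the value from \<open>limit_exists\<close> otherwise.\<close>

theorem limiting_density_less_one_iff:
  assumes Z: "\<And>Z. Z \<in> \<Z> \<Longrightarrow> pair_graph Z"
  shows "(\<exists>d. has_limiting_density (excl \<Z>) d \<and> d < 1) \<longleftrightarrow>
    (\<exists>Z\<in>\<Z>. \<exists>n. minor Z (path_graph n)) \<and> (\<exists>Z\<in>\<Z>. \<exists>n. minor Z (star_graph n)) \<and>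
    (\<exists>Z\<in>\<Z>. \<exists>n. minor Z (triangles n))" (is "?L \<longleftrightarrow> ?P \<and> ?S \<and> ?T")
proof
  interpret minor_closed "excl \<Z>" using Z by (rule minor_closed_excl)
  assume ?L
  then have sparse: "\<not> (\<forall>n. \<exists>G\<in>excl \<Z>. card (pverts G) = n \<and> n \<le> num_edges G + 2)"
    using limiting_density_ge_one by (meson not_less)
  show "?P \<and> ?S \<and> ?T"
  proof (intro conjI; rule ccontr)
    assume "\<not> ?P"
    then have "path_graph n \<in> excl \<Z>" for n by (simp add: excl_def)
    moreover have "card (pverts (path_graph n)) = n" for n by (simp add: path_graph_def)
    ultimately show False using sparse num_edges_path_graph by blast
  next
    assume "\<not> ?S"
    then have mem: "star_graph n \<in> excl \<Z>" for n by (simp add: excl_def)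
    have "\<exists>G\<in>excl \<Z>. card (pverts G) = n \<and> n \<le> num_edges G + 2" for n
    \<comment> \<open>A star with \<open>k\<close> leaves has \<open>k + 1\<close> vertices, so
      order 0 is served by an edgeless graph.\<close>
    proof (cases n)
      case 0
      have "edgeless 0 \<in> excl \<Z>" using mem[of 0] by (rule closed) (simp_all add: minor_edgeless)
      then show ?thesis using 0 by force
    next
      case (Suc k)
      moreover have "card (pverts (star_graph k)) = Suc k" by (simp add: star_graph_def)
      ultimately show ?thesis using mem[of k] num_edges_star_graph[of k] by (intro bexI[of _ "star_graph k"]) auto
    qed
    then show False using sparse by blast
  next
    assume "\<not> ?T"
    then have mem: "triangles n \<in> excl \<Z>" for n by (simp add: excl_def)
    have "\<exists>G\<in>excl \<Z>. card (pverts G) = n \<and> n \<le> num_edges G + 2" for n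
    proof -
      define q where "q = n div 3"
      have q: "3 * q \<le> n" "n \<le> 3 * q + 2" by (auto simp: q_def)
      \<comment> \<open>Up to two isolated vertices adjust the order to \<open>n\<close>; they
        belong to the last triangle of \<open>triangles (Suc q)\<close>.\<close>
      define H where "H = \<lparr>pverts = {..<n}, parcs = parcs (triangles q)\<rparr>"
      have "pair_graph H" using pair_graph_triangles[of q] q(1)
        by (auto simp: pair_graph_iff H_def triangles_def)
      moreover have "minor H (triangles (Suc q))"
        using q by (intro minor_subgraph pair_graph_triangles) (auto simp: H_def triangles_def)
      ultimately have "H \<in> excl \<Z>" by (rule closed[OF mem])
      moreover have "num_edges H = num_edges (triangles q)" by (simp add: num_edges_eq H_def)
      ultimately show ?thesis using num_edges_triangles[of q] q(2) by (intro bexI[of _ H]) (auto simp: H_def)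
    qed
    then show False using sparse by blast
  qed
next
  interpret minor_closed "excl \<Z>" using Z by (rule minor_closed_excl)
  assume "?P \<and> ?S \<and> ?T"
  then obtain a b c where abc: "path_graph a \<notin> excl \<Z>" "star_graph b \<notin> excl \<Z>" "triangles c \<notin> excl \<Z>"
    unfolding excl_def by blast
  show ?L
  proof (cases "finite_up_to_iso (excl \<Z>)")
    case True
    then show ?thesis by (intro exI[of _ "-\<infinity>"]) (simp add: has_limiting_density_def)
  next
    case False
    then have "edgeless n \<in> excl \<Z>" for n using finite_up_to_iso_if_bounded by blast
    then interpret sparse_minor_closed "excl \<Z>" a b c using abc by unfold_locales
    obtain d where "d < 1" "(\<lambda>n. real (ex (excl \<Z>) n) / real n) \<longlonglongrightarrow> d" using limit_exists by blast
    then have "has_limiting_density (excl \<Z>) (ereal d)" "ereal d < 1"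
      using False by (simp_all add: has_limiting_density_def one_ereal_def)
    then show ?thesis by blast
  qed
qed

section \<open>Joining paths edge by edge\<close>

fun links :: "'a list \<Rightarrow> 'a rel" where
  "links (x # y # zs) = {(x, y), (y, x)} \<union> links (y # zs)"
| "links _ = {}"

lemma links_subset: "(x, y) \<in> links p \<Longrightarrow> x \<in> set p \<and> y \<in> set p"
  by (induction p rule: links.induct) auto

lemma links_append:
  "p \<noteq> [] \<Longrightarrow> q \<noteq> [] \<Longrightarrow> links (p @ q) = links p \<union> links q \<union> {(last p, hd q), (hd q, last p)}"
proof (induction p rule: links.induct)
  case ("2_2" x)
  then show ?case by (cases q) auto
qed auto

text \<open>Allows a path to be turned round whenever a prescribed vertex has to come last.\<close>

lemma links_rev [simp]: "links (rev p) = links p"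
proof (induction p rule: links.induct)
  case (1 x y zs)
  have "links (rev (x # y # zs)) = links (rev (y # zs) @ [x])" by simp
  also have "\<dots> = links (rev (y # zs)) \<union> {(y, x), (x, y)}"
    by (subst links_append) (auto simp: last_rev)
  finally show ?case using 1 by auto
qed auto

lemma links_nth:
  "(x, y) \<in> links p \<Longrightarrow> \<exists>i. Suc i < length p \<and> (x = p ! i \<and> y = p ! Suc i \<or> y = p ! i \<and> x = p ! Suc i)"
proof (induction p rule: links.induct)
  case (1 a b zs)
  show ?case
  proof (cases "(x, y) \<in> links (b # zs)")
    case True
    then obtain i where "Suc i < length (b # zs)"
      "x = (b # zs) ! i \<and> y = (b # zs) ! Suc i \<or> y = (b # zs) ! i \<and> x = (b # zs) ! Suc i"
      using 1 by blast
    then show ?thesis by (intro exI[of _ "Suc i"]) simp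
  next
    case False
    then show ?thesis using 1(2) by (intro exI[of _ 0]) auto
  qed
qed auto

text \<open>Membership in \<open>S\<close> spreads along the list in both directions. This is how a
  path that meets a union of components is shown to lie in it.\<close>

lemma links_closed:
  assumes "links p \<subseteq> F" "\<And>x y. (x, y) \<in> F \<Longrightarrow> x \<in> S \<Longrightarrow> y \<in> S" "set p \<inter> S \<noteq> {}"
  shows "set p \<subseteq> S"
  using assms(1,3)
proof (induction p rule: links.induct)
  case (1 x y zs)
  then have F: "(x, y) \<in> F" "(y, x) \<in> F" "links (y # zs) \<subseteq> F" by auto
  have "set (y # zs) \<inter> S \<noteq> {}"
    using 1(3) assms(2)[OF F(1)] by auto
  then have "set (y # zs) \<subseteq> S" using 1(1) F(3) by blast
  then show ?case using assms(2)[OF F(2)] by auto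
qed auto

text \<open>An interior vertex already has two neighbours on the path, which exhausts a maximum
  degree of two.\<close>

lemma links_interior:
  assumes "distinct p" "v \<in> set p" "v \<noteq> hd p" "v \<noteq> last p"
  shows "\<exists>x y. x \<noteq> y \<and> (v, x) \<in> links p \<and> (v, y) \<in> links p"
proof -
  obtain xs ys where p: "p = xs @ v # ys" using assms(2) by (meson split_list)
  have ne: "xs \<noteq> []" "ys \<noteq> []" using assms(3,4) p by auto
  have "(v, last xs) \<in> links p" using ne by (simp add: p links_append)
  moreover have "(v, hd ys) \<in> links p" using ne by (cases ys) (simp_all add: p links_append)
  moreover have "last xs \<in> set xs" "hd ys \<in> set ys" using ne by simp_all
  then have "last xs \<noteq> hd ys" using assms(1) p by auto
  ultimately show ?thesis by blast
qed

text \<open>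
  Components are kept as unordered paths without an explicit partition: \<open>oth\<close> only records, at
  either end of a path, the opposite end, and may be arbitrary at interior vertices.
\<close>

definition path_comp :: "'a set \<Rightarrow> 'a rel \<Rightarrow> ('a \<Rightarrow> 'a) \<Rightarrow> 'a list \<Rightarrow> bool" where
  "path_comp V F oth p \<longleftrightarrow> p \<noteq> [] \<and> distinct p \<and> set p \<subseteq> V \<and> links p \<subseteq> F \<and>
    (\<forall>x y. (x, y) \<in> F \<longrightarrow> x \<in> set p \<or> y \<in> set p \<longrightarrow> (x, y) \<in> links p) \<and>
    oth (hd p) = last p \<and> oth (last p) = hd p"

definition path_comps :: "'a set \<Rightarrow> 'a rel \<Rightarrow> ('a \<Rightarrow> 'a) \<Rightarrow> bool" where
  "path_comps V F oth \<longleftrightarrow> (\<forall>x\<in>V. \<exists>p. path_comp V F oth p \<and> x \<in> set p)"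

lemma path_compD:
  assumes "path_comp V F oth p"
  shows "p \<noteq> []" "distinct p" "set p \<subseteq> V" "links p \<subseteq> F"
    "\<And>x y. (x, y) \<in> F \<Longrightarrow> x \<in> set p \<Longrightarrow> (x, y) \<in> links p"
    "\<And>x y. (x, y) \<in> F \<Longrightarrow> y \<in> set p \<Longrightarrow> (x, y) \<in> links p"
    "oth (hd p) = last p" "oth (last p) = hd p"
  using assms by (auto simp: path_comp_def)

lemma path_comp_rev:
  assumes "path_comp V F oth p"
  shows "path_comp V F oth (rev p)"
proof -
  have "p \<noteq> []" using assms by (rule path_compD)
  then show ?thesis using assms unfolding path_comp_def by (simp add: hd_rev last_rev)
qed

text \<open>The vertices of \<open>p\<close> are closed under \<open>F\<close>, so a path that meets
  them cannot also leave them.\<close>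

lemma path_comp_disjoint:
  assumes "path_comp V F oth p" "links q \<subseteq> F" "x \<in> set q" "x \<notin> set p"
  shows "set q \<inter> set p = {}"
proof (rule ccontr)
  assume inter: "set q \<inter> set p \<noteq> {}"
  have closed: "y \<in> set p" if "(x, y) \<in> F" "x \<in> set p" for x y
    using links_subset[OF path_compD(5)[OF assms(1) that]] by simp
  have "set q \<subseteq> set p" by (rule links_closed[OF assms(2) _ inter]) (rule closed)
  then show False using assms(3,4) by blast
qed

lemma path_comps_empty:
  assumes "\<And>x. x \<in> V \<Longrightarrow> oth x = x"
  shows "path_comps V {} oth"
  unfolding path_comps_def
proof
  fix x assume "x \<in> V"
  then show "\<exists>p. path_comp V {} oth p \<and> x \<in> set p"
    using assms by (intro exI[of _ "[x]"]) (simp add: path_comp_def)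
qed

text \<open>An interior vertex with an unscanned edge would have degree three. Hence every new edge
  meets paths at their ends only, where \<open>oth\<close> is reliable.\<close>

lemma path_comp_end:
  assumes p: "path_comp V F oth p" "v \<in> set p" and E: "F \<subseteq> E" "(v, u) \<in> E" "(v, u) \<notin> F"
    and fin: "finite (E `` {v})" "card (E `` {v}) \<le> 2"
  shows "v = hd p \<or> v = last p"
proof (rule ccontr)
  assume "\<not> (v = hd p \<or> v = last p)"
  then obtain x y where xy: "x \<noteq> y" "(v, x) \<in> F" "(v, y) \<in> F"
    using links_interior[OF path_compD(2)[OF p(1)] p(2)] path_compD(4)[OF p(1)] by blast
  then have "x \<noteq> u" "y \<noteq> u" using E(3) by auto
  then have "card {x, y, u} = 3" using xy(1) by simp
  moreover have "card {x, y, u} \<le> card (E `` {v})" using fin(1) xy E by (intro card_mono) auto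
  ultimately show False using fin(2) by simp
qed

lemma path_comp_oriented:
  assumes "path_comps V F oth" "v \<in> V" and E: "F \<subseteq> E" "(v, u) \<in> E" "(v, u) \<notin> F"
    and fin: "finite (E `` {v})" "card (E `` {v}) \<le> 2"
  obtains p where "path_comp V F oth p" "last p = v"
proof -
  obtain p where p: "path_comp V F oth p" "v \<in> set p" using assms(1,2) unfolding path_comps_def by blast
  from path_comp_end[OF this E fin] show ?thesis
  proof
    assume "v = hd p"
    then have "last (rev p) = v" using path_compD(1)[OF p(1)] by (simp add: last_rev)
    then show ?thesis using that path_comp_rev[OF p(1)] by blast
  next
    assume "v = last p"
    then show ?thesis using that p(1) by simp
  qed
qed

text \<open>With \<open>p\<close> ending in \<open>v\<close> and \<open>q\<close> starting with
  \<open>u\<close>, the path \<open>p @ q\<close> has the ends \<open>oth v\<close> and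
  \<open>oth u\<close>, and exactly their entries change. Single vertices fit in, as they are their
  own opposite ends.\<close>

lemma path_comps_join:
  assumes comps: "path_comps V F oth" and V: "u \<in> V" "v \<in> V" "u \<noteq> v"
    and E: "F \<subseteq> E" "(v, u) \<in> E" "(v, u) \<notin> F" "(u, v) \<in> E" "(u, v) \<notin> F"
    and fin: "\<And>x. finite (E `` {x})" "\<And>x. card (E `` {x}) \<le> 2"
    and neq: "oth v \<noteq> u"
  shows "path_comps V (F \<union> {(v, u), (u, v)}) (oth(oth v := oth u, oth u := oth v))"
proof -
  obtain p where p: "path_comp V F oth p" "last p = v"
    using path_comp_oriented[OF comps V(2) E(1-3) fin] by blast
  obtain q0 where q0: "path_comp V F oth q0" "last q0 = u"
    using path_comp_oriented[OF comps V(1) E(1,4,5) fin] by blast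
  define q where "q = rev q0"
  have q: "path_comp V F oth q" "hd q = u"
    using path_comp_rev[OF q0(1)] q0 path_compD(1)[OF q0(1)] by (simp_all add: q_def hd_rev)
  note pD = path_compD[OF p(1)] and qD = path_compD[OF q(1)]
  have ends: "oth v = hd p" "oth u = last q" using pD(8) p(2) qD(7) q(2) by auto
  \<comment> \<open>On \<open>p\<close>, the vertex \<open>u\<close> would be an end; it is not
    \<open>last p = v\<close>, so it would be \<open>hd p = oth v\<close>, contrary to
    \<open>neq\<close>.\<close>
  have "u \<notin> set p"
  proof
    assume "u \<in> set p"
    from path_comp_end[OF p(1) this E(1,4,5) fin] show False using p(2) ends V(3) neq by auto
  qed
  moreover have "u \<in> set q" using q(2) qD(1) by auto
  ultimately have pq: "set q \<inter> set p = {}" using path_comp_disjoint[OF p(1) qD(4)] by blast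
  have vp: "v \<in> set p" using p(2) pD(1) by auto
  let ?F = "F \<union> {(v, u), (u, v)}" and ?oth = "oth(oth v := oth u, oth u := oth v)"
  have hl: "hd p \<in> set p" "last q \<in> set q" using pD(1) qD(1) by auto
  have joined: "path_comp V ?F ?oth (p @ q)"
    unfolding path_comp_def
  proof (intro conjI allI impI)
    have L: "links (p @ q) = links p \<union> links q \<union> {(v, u), (u, v)}"
      using links_append[OF pD(1) qD(1)] p(2) q(2) by simp
    show "links (p @ q) \<subseteq> ?F" using L pD(4) qD(4) by auto
    fix x y assume "(x, y) \<in> ?F" "x \<in> set (p @ q) \<or> y \<in> set (p @ q)"
    then show "(x, y) \<in> links (p @ q)" unfolding L using pD(5,6) qD(5,6) by auto
  next
    \<comment> \<open>The second update does not overwrite the first, because the ends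
      \<open>hd p\<close> and \<open>last q\<close> lie on disjoint paths.\<close>
    show "?oth (hd (p @ q)) = last (p @ q)" using ends pD(1) qD(1) hl pq by auto
    show "?oth (last (p @ q)) = hd (p @ q)" using ends pD(1) qD(1) by auto
  qed (use pD(1-3) qD(1-3) pq in auto)
  show ?thesis
    unfolding path_comps_def
  proof
    fix x assume x: "x \<in> V"
    show "\<exists>r. path_comp V ?F ?oth r \<and> x \<in> set r"
    proof (cases "x \<in> set (p @ q)")
      case True
      then show ?thesis using joined by blast
    next
      case False
      obtain r where r: "path_comp V F oth r" "x \<in> set r"
        using comps x unfolding path_comps_def by blast
      note rD = path_compD[OF r(1)]
      have disj: "set r \<inter> set p = {}" "set r \<inter> set q = {}"
        using path_comp_disjoint[OF p(1) rD(4) r(2)] path_comp_disjoint[OF q(1) rD(4) r(2)] False by auto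
      then have "v \<notin> set r" "u \<notin> set r" using vp \<open>u \<in> set q\<close> by auto
      \<comment> \<open>Both changed entries belong to ends of the joined path, so
        \<open>oth\<close> is unchanged at the ends of \<open>r\<close>.\<close>
      moreover have "hd r \<notin> {hd p, last q}" "last r \<notin> {hd p, last q}"
        using hl disj hd_in_set[OF rD(1)] last_in_set[OF rD(1)] by (metis disjoint_iff insertE singletonD)+
      ultimately have "path_comp V ?F ?oth r"
        using rD ends unfolding path_comp_def by auto
      then show ?thesis using r(2) by blast
    qed
  qed
qed

text \<open>The vertex after an ascending edge \<open>xy\<close> can lie neither between
  \<open>x\<close> and \<open>y\<close> nor below \<open>x\<close>, where \<open>x\<close> would
  separate it from \<open>y\<close>; so the ascent continues. Integer values allow a descending
  layout to be negated.\<close>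

lemma path_layout_monotone:
  fixes f :: "'a \<Rightarrow> int"
  assumes "inj_on f V" and between: "\<And>u v w. (u, v) \<in> E \<Longrightarrow> w \<in> V \<Longrightarrow> \<not> (f u < f w \<and> f w < f v)"
    and "distinct p" "set p \<subseteq> V" "links p \<subseteq> E" "1 < length p" "f (p ! 0) < f (p ! 1)"
  shows "sorted_wrt (<) (map f p)"
  using assms(3-)
proof (induction p rule: links.induct)
  case (1 x y zs)
  show ?case
  proof (cases zs)
    case Nil
    then show ?thesis using "1.prems" by simp
  next
    case (Cons z zs')
    have V: "x \<in> V" "y \<in> V" "z \<in> V" and neq: "x \<noteq> z" "y \<noteq> z" using "1.prems" Cons by auto
    have arcs: "(x, y) \<in> E" "(z, y) \<in> E" using "1.prems" Cons by auto
    have "f x < f y" using "1.prems" by simp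
    moreover have "f x \<noteq> f z" "f y \<noteq> f z" using assms(1) V neq by (auto dest: inj_onD)
    ultimately have "f y < f z" using between[OF arcs(1) V(3)] between[OF arcs(2) V(1)] by linarith
    then have "sorted_wrt (<) (map f (y # zs))" using 1 Cons by auto
    then show ?thesis using \<open>f x < f y\<close> by (auto simp: Cons)
  qed
qed auto

text \<open>A layout is monotone along \<open>p\<close>, so the second vertex separates the adjacent
  vertices \<open>hd p\<close> and \<open>last p\<close>.\<close>

lemma no_path_layout_if_cycle:
  assumes "sym E" "distinct p" "set p \<subseteq> V" "links p \<subseteq> E" "2 < length p" "(hd p, last p) \<in> E"
  shows "\<not> path_layout V E"
proof
  assume "path_layout V E"
  then obtain f :: "'a \<Rightarrow> nat" where f: "inj_on f V"
    "\<And>u v w. (u, v) \<in> E \<Longrightarrow> w \<in> V \<Longrightarrow> \<not> (f u < f w \<and> f w < f v)"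
    unfolding path_layout_def by fast
  have no: False if g: "inj_on g V" "\<And>u v w. (u, v) \<in> E \<Longrightarrow> w \<in> V \<Longrightarrow> \<not> (g u < g w \<and> g w < g v)"
    and lt: "g (p ! 0) < g (p ! 1)" for g :: "'a \<Rightarrow> int"
  proof -
    have sorted: "sorted_wrt (<) (map g p)"
      using g assms(2-5) lt by (intro path_layout_monotone[of g V E]) auto
    have "p \<noteq> []" using assms(5) by auto
    then have hl: "hd p = p ! 0" "last p = p ! (length p - 1)" by (simp_all add: hd_conv_nth last_conv_nth)
    have "g (p ! 1) < g (p ! (length p - 1))"
      using sorted_wrt_nth_less[OF sorted, of 1 "length p - 1"] assms(5) by simp
    moreover have "p ! 1 \<in> V" using assms(3,5) by (meson nth_mem subsetD less_trans one_less_numeral_iff semiring_norm(76))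
    ultimately show False using g(2)[OF assms(6), of "p ! 1"] lt hl by simp
  qed
  have "p ! 0 \<in> V" "p ! 1 \<in> V" "p ! 0 \<noteq> p ! 1"
  proof -
    have len: "0 < length p" "1 < length p" using assms(5) by linarith+
    show "p ! 0 \<in> V" "p ! 1 \<in> V" using nth_mem[OF len(1)] nth_mem[OF len(2)] assms(3) by auto
    show "p ! 0 \<noteq> p ! 1" using nth_eq_iff_index_eq[OF assms(2) len] by simp
  qed
  then have "f (p ! 0) \<noteq> f (p ! 1)" using f(1) by (auto dest: inj_onD)
  then consider "int (f (p ! 0)) < int (f (p ! 1))" | "- int (f (p ! 0)) < - int (f (p ! 1))" by linarith
  then show False
  proof cases
    case 1
    show False
    proof (rule no[OF _ _ 1])
      show "inj_on (\<lambda>x. int (f x)) V" using f(1) by (auto simp: inj_on_def)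
      fix u v w assume "(u, v) \<in> E" "w \<in> V"
      then show "\<not> (int (f u) < int (f w) \<and> int (f w) < int (f v))" using f(2) by fastforce
    qed
  next
    case 2
    show False
    proof (rule no[OF _ _ 2])
      show "inj_on (\<lambda>x. - int (f x)) V" using f(1) by (auto simp: inj_on_def)
      fix u v w assume "(u, v) \<in> E" "w \<in> V"
      then show "\<not> (- int (f u) < - int (f w) \<and> - int (f w) < - int (f v))"
        using f(2) symD[OF assms(1)] by fastforce
    qed
  qed
qed

text \<open>The edge joins the two ends of one path. This path has at least three vertices, since
  otherwise the edge would already be in \<open>F\<close>.\<close>

lemma no_path_layout_if_closing:
  assumes comps: "path_comps V F oth" and "v \<in> V" "u \<noteq> v" "sym E"
    and E: "F \<subseteq> E" "(v, u) \<in> E" "(v, u) \<notin> F"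
    and fin: "finite (E `` {v})" "card (E `` {v}) \<le> 2"
    and "oth v = u"
  shows "\<not> path_layout V E"
proof -
  obtain p where p: "path_comp V F oth p" "last p = v"
    using path_comp_oriented[OF comps \<open>v \<in> V\<close> E fin] by blast
  note pD = path_compD[OF p(1)]
  have hd: "hd p = u" using pD(8) p(2) assms by simp
  have "2 < length p"
  proof (rule ccontr)
    assume "\<not> 2 < length p"
    moreover have "0 < length p" using pD(1) by simp
    ultimately have "length p = 1 \<or> length p = 2" by linarith
    then have "p = [u, v]"
      using p(2) hd \<open>u \<noteq> v\<close> by (auto simp: length_Suc_conv numeral_2_eq_2)
    then show False using pD(4) E(3) by auto
  qed
  moreover have "(hd p, last p) \<in> E" using p(2) hd symD[OF \<open>sym E\<close> E(2)] by simp
  ultimately show ?thesis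
    using no_path_layout_if_cycle[of E p V] \<open>sym E\<close> pD E(1) by blast
qed

lemma minor_path_if_path_comps:
  assumes G: "pair_graph G" and V: "pverts G = {..<k}" and comps: "path_comps {..<k} (parcs G) oth"
  shows "\<exists>n. minor G (path_graph n)"
proof -
  let ?E = "parcs G"
  have "\<exists>ys. distinct ys \<and> set ys \<subseteq> {..<k} \<and> {..<n} \<subseteq> set ys \<and>
      (\<forall>x y. (x, y) \<in> ?E \<longrightarrow> x \<in> set ys \<or> y \<in> set ys \<longrightarrow> (x, y) \<in> links ys)" if "n \<le> k" for n
    using that
  proof (induction n)
    case 0
    then show ?case by (intro exI[of _ "[]"]) simp
  next
    case (Suc n)
    then have "n \<le> k" by simp
    from Suc.IH[OF this] obtain ys where ys: "distinct ys" "set ys \<subseteq> {..<k}" "{..<n} \<subseteq> set ys"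
      "\<And>x y. (x, y) \<in> ?E \<Longrightarrow> x \<in> set ys \<or> y \<in> set ys \<Longrightarrow> (x, y) \<in> links ys" by blast
    show ?case
    proof (cases "n \<in> set ys")
      case True
      then show ?thesis using ys by (intro exI[of _ ys]) (auto simp: less_Suc_eq)
    next
      case False
      obtain p where p: "path_comp {..<k} ?E oth p" "n \<in> set p"
        using bspec[OF comps[unfolded path_comps_def], of n] Suc.prems by auto
      note pD = path_compD[OF p(1)]
      have disj: "set p \<inter> set ys = {}"
      proof (rule ccontr)
        assume inter: "set p \<inter> set ys \<noteq> {}"
        have closed: "y \<in> set ys" if "(x, y) \<in> ?E" "x \<in> set ys" for x y
          using links_subset[OF ys(4)[OF that(1)]] that(2) by simp
        have "set p \<subseteq> set ys" by (rule links_closed[OF pD(4) _ inter]) (rule closed)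
        then show False using p(2) False by blast
      qed
      have "links ys \<union> links p \<subseteq> links (ys @ p)"
        using links_append[of ys p] pD(1) by (cases "ys = []") auto
      then have "(x, y) \<in> links (ys @ p)" if "(x, y) \<in> ?E" "x \<in> set (ys @ p) \<or> y \<in> set (ys @ p)" for x y
        using that ys(4) pD(5,6) by auto
      then show ?thesis
        using ys(1-3) pD(2,3) disj p(2) by (intro exI[of _ "ys @ p"]) (auto simp: less_Suc_eq)
    qed
  qed
  from this[of k] obtain ys where ys: "distinct ys" "set ys = {..<k}"
    "\<And>x y. (x, y) \<in> ?E \<Longrightarrow> x \<in> set ys \<Longrightarrow> (x, y) \<in> links ys" by auto
  let ?f = "the_inv_into {..<length ys} ((!) ys)"
  have inj: "inj_on ((!) ys) {..<length ys}" using ys(1) by (simp add: inj_on_nth)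
  have f: "?f (ys ! i) = i" if "i < length ys" for i
    using the_inv_into_f_f[OF inj] that by simp
  have img: "(!) ys ` {..<length ys} = {..<k}" using ys(2) by (auto simp: set_conv_nth)
  have "minor G (path_graph (length ys))"
  proof (rule minor_if_embedding[of _ ?f])
    show "sym (parcs (path_graph (length ys)))" using pair_graph_path_graph by (simp only: pair_graph_iff)
    show "inj_on ?f (pverts G)" using inj_on_the_inv_into[OF inj] img V by simp
    show "?f ` pverts G \<subseteq> pverts (path_graph (length ys))"
      using f by (auto simp: V img[symmetric] path_graph_def)
    fix x y assume xy: "(x, y) \<in> ?E"
    then have "x \<in> set ys" using G ys(2) V by (auto simp: pair_graph_iff)
    from links_nth[OF ys(3)[OF xy this]] show "(?f x, ?f y) \<in> parcs (path_graph (length ys))"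
      by (auto simp: path_graph_def f)
  qed
  then show ?thesis by blast
qed

section \<open>Local tests on adjacency lists\<close>

abbreviation arcs_of :: "nat list list \<Rightarrow> nat rel" where
  "arcs_of g \<equiv> parcs (graph_of g)"

definition adjacency :: "nat list list \<Rightarrow> bool" where
  "adjacency g \<longleftrightarrow> pair_graph (graph_of g) \<and> (\<forall>ns\<in>set g. distinct ns)"

lemma graph_of_simps: "pverts (graph_of g) = {..<length g}"
  "(u, v) \<in> arcs_of g \<longleftrightarrow> u < length g \<and> v \<in> set (g ! u)"
  by (simp_all add: graph_of_def)

context
  fixes g :: "nat list list"
  assumes g: "adjacency g"
begin

lemma adjacency_pair_graph: "pair_graph (graph_of g)"
  using g by (simp add: adjacency_def)

lemma sym_arcs_of: "sym (arcs_of g)"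
  using adjacency_pair_graph by (simp add: pair_graph_iff)

lemma arcs_of_irrefl: "(u, u) \<notin> arcs_of g"
  using adjacency_pair_graph by (simp add: pair_graph_iff irrefl_def)

lemma arcs_of_less: "(u, v) \<in> arcs_of g \<Longrightarrow> u < length g \<and> v < length g"
  using adjacency_pair_graph by (auto simp: pair_graph_iff graph_of_simps(1))

lemma neighbours: "u < length g \<Longrightarrow> arcs_of g `` {u} = set (g ! u)"
  by (auto simp: graph_of_simps)

lemma neighbours_empty: "\<not> u < length g \<Longrightarrow> arcs_of g `` {u} = {}"
  by (auto simp: graph_of_simps)

lemma distinct_adjacency: "u < length g \<Longrightarrow> distinct (g ! u)"
  using g by (simp add: adjacency_def)

lemma card_neighbours: "u < length g \<Longrightarrow> card (arcs_of g `` {u}) = length (g ! u)"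
  using neighbours distinct_adjacency by (simp add: distinct_card)

lemma finite_neighbours: "finite (arcs_of g `` {u})"
  using neighbours neighbours_empty by (cases "u < length g") auto

lemma neighbour_less: "u < length g \<Longrightarrow> i < length (g ! u) \<Longrightarrow> g ! u ! i < length g"
  using arcs_of_less[of u "g ! u ! i"] by (simp add: graph_of_simps)

lemma arc_nth: "u < length g \<Longrightarrow> i < length (g ! u) \<Longrightarrow> (u, g ! u ! i) \<in> arcs_of g"
  by (simp add: graph_of_simps)

end

text \<open>Recursion on the number of scanned vertices gives the value held by register 8 after
  each round of the degree loop.\<close>

primrec max_degree :: "nat list list \<Rightarrow> nat \<Rightarrow> nat" where
  "max_degree g 0 = 0"
| "max_degree g (Suc v) = max (max_degree g v) (length (g ! v))"

lemma max_degree_ge: "u < v \<Longrightarrow> length (g ! u) \<le> max_degree g v"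
  by (induction v) (auto simp: less_Suc_eq)

lemma max_degree_le_iff: "max_degree g v \<le> d \<longleftrightarrow> (\<forall>u<v. length (g ! u) \<le> d)"
  by (induction v) (auto simp: less_Suc_eq)

lemma max_degree_attained: "max_degree g v = 0 \<or> (\<exists>u<v. max_degree g v = length (g ! u))"
  by (induction v) (auto simp: less_Suc_eq max_def)

lemma card_arcs_of:
  assumes "adjacency g"
  shows "card (arcs_of g) = (\<Sum>u<length g. length (g ! u))"
proof -
  have "arcs_of g = (SIGMA u:{..<length g}. set (g ! u))" by (auto simp: graph_of_simps)
  then show ?thesis
    using distinct_adjacency[OF assms] by (simp add: distinct_card)
qed

text \<open>The sum of degrees counts all arcs, and twice the degree of \<open>c\<close> counts
  those at \<open>c\<close>. The two agree iff every edge contains \<open>c\<close>, and such a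
  \<open>c\<close> with an edge has maximum degree, all other degrees being at most one.\<close>

lemma minor_star_iff_sum_degrees:
  assumes g: "adjacency g"
  shows "(\<exists>n. minor (graph_of g) (star_graph n)) \<longleftrightarrow>
    (\<Sum>u<length g. length (g ! u)) = max_degree g (length g) + max_degree g (length g)"
proof -
  let ?E = "arcs_of g" and ?m = "max_degree g (length g)"
  note pg = adjacency_pair_graph[OF g]
  have finE: "finite ?E" using pg by (rule finite_parcs)
  have card_at: "card ({c} \<times> ?E `` {c} \<union> ?E `` {c} \<times> {c}) = length (g ! c) + length (g ! c)"
    if c: "c < length g" for c
  proof -
    have fin: "finite (?E `` {c})" by (rule finite_neighbours[OF g])
    have "({c} \<times> ?E `` {c}) \<inter> (?E `` {c} \<times> {c}) = {}" using arcs_of_irrefl[OF g] by auto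
    then show ?thesis
      using fin card_neighbours[OF g c] by (simp add: card_Un_disjoint card_cartesian_product)
  qed
  have sub: "{c} \<times> ?E `` {c} \<union> ?E `` {c} \<times> {c} \<subseteq> ?E" for c
    using symD[OF sym_arcs_of[OF g]] by auto
  show ?thesis
  proof
    assume "\<exists>n. minor (graph_of g) (star_graph n)"
    then obtain n where "minor (graph_of g) (star_graph n)" ..
    moreover have "?E \<subseteq> pverts (graph_of g) \<times> pverts (graph_of g)" using pg by (simp only: pair_graph_iff)
    ultimately have "\<exists>c. \<forall>(u, v) \<in> ?E. c = u \<or> c = v" by (rule incident_if_minor_star)
    then obtain c where "\<forall>(u, v) \<in> ?E. c = u \<or> c = v" ..
    then have c: "c = u \<or> c = v" if "(u, v) \<in> ?E" for u v using \<open>\<forall>(u, v) \<in> ?E. c = u \<or> c = v\<close> that by (auto dest: bspec)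
    have E: "?E = {c} \<times> ?E `` {c} \<union> ?E `` {c} \<times> {c}"
      using c sub symD[OF sym_arcs_of[OF g]] by fast
    show "(\<Sum>u<length g. length (g ! u)) = ?m + ?m"
    \<comment> \<open>The common end may be no vertex at all, or an isolated one; then there are no
      edges and both sides are 0.\<close>
    proof (cases "c < length g \<and> g ! c \<noteq> []")
      case True
      then have cl: "c < length g" "1 \<le> length (g ! c)" by (auto simp: Suc_le_eq)
      have "length (g ! u) \<le> length (g ! c)" if u: "u < length g" for u
      proof (cases "u = c")
        case False
        then have "?E `` {u} \<subseteq> {c}" using c by auto
        then have "card (?E `` {u}) \<le> 1" using card_mono[of "{c}"] by fastforce
        then show ?thesis using card_neighbours[OF g u] cl(2) by simp
      qed simp
      then have "?m = length (g ! c)"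
        using max_degree_ge[OF cl(1), of g] by (intro antisym) (simp_all add: max_degree_le_iff)
      moreover have "card ?E = length (g ! c) + length (g ! c)"
        using arg_cong[OF E, of card] card_at[OF cl(1)] by simp
      ultimately show ?thesis using card_arcs_of[OF g] by simp
    next
      case False
      then have "?E `` {c} = {}" using neighbours[OF g] neighbours_empty[OF g] by (cases "c < length g") auto
      then have "?E = {}" using E by simp
      then have "(\<Sum>u<length g. length (g ! u)) = 0" using card_arcs_of[OF g] by simp
      moreover from this have "?m \<le> 0" unfolding max_degree_le_iff by simp
      ultimately show ?thesis by simp
    qed
  next
    assume eq: "(\<Sum>u<length g. length (g ! u)) = ?m + ?m"
    have "\<exists>c. \<forall>(u, v) \<in> ?E. c = u \<or> c = v"
    proof (cases "?m = 0")
      case True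
      then have "?E = {}" using eq card_arcs_of[OF g] finE by simp
      then show ?thesis by simp
    next
      case False
      then have "\<exists>c<length g. ?m = length (g ! c)" using max_degree_attained[of g "length g"] by (elim disjE) simp_all
      then obtain c where c: "c < length g" "?m = length (g ! c)" by (elim exE conjE)
      then have E: "{c} \<times> ?E `` {c} \<union> ?E `` {c} \<times> {c} = ?E"
        using eq card_arcs_of[OF g] card_at[OF c(1)] by (intro card_subset_eq finE sub) simp
      have inc: "c = u \<or> c = v" if "(u, v) \<in> ?E" for u v
      proof -
        have "(u, v) \<in> {c} \<times> ?E `` {c} \<union> ?E `` {c} \<times> {c}" using that by (simp only: E)
        then show ?thesis by auto
      qed
      show ?thesis
      proof (rule exI[of _ c], rule ballI)
        fix e assume "e \<in> ?E"
        then show "case e of (u, v) \<Rightarrow> c = u \<or> c = v" using inc[of "fst e" "snd e"] by (cases e) simp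
      qed
    qed
    then show "\<exists>n. minor (graph_of g) (star_graph n)"
      by (elim exE) (rule minor_star_if_incident[OF pg])
  qed
qed

text \<open>
  In a graph of maximum degree two, \<open>v\<close> and its neighbours \<open>x\<close> and \<open>y\<close> form a component
  unless \<open>x\<close> or \<open>y\<close> has a neighbour outside \<open>{v, x, y}\<close>. As \<open>v\<close> is itself a
  neighbour of \<open>x\<close>, comparing sums identifies the other neighbour of \<open>x\<close>.
\<close>

definition small_at :: "nat list list \<Rightarrow> nat \<Rightarrow> bool" where
  "small_at g v \<longleftrightarrow> (length (g ! v) = 2 \<longrightarrow>
    (length (g ! (g ! v ! 0)) = 2 \<longrightarrow> g ! (g ! v ! 0) ! 0 + g ! (g ! v ! 0) ! 1 = v + g ! v ! 1) \<and>
    (length (g ! (g ! v ! 1)) = 2 \<longrightarrow> g ! (g ! v ! 1) ! 0 + g ! (g ! v ! 1) ! 1 = v + g ! v ! 0))"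

lemma set_two: "length xs = 2 \<Longrightarrow> set xs = {xs ! 0, xs ! 1}"
  by (auto simp: numeral_2_eq_2 length_Suc_conv)

text \<open>\<open>small_at\<close> is vacuous at degree below two, so \<open>S\<close> is built
  around a vertex of degree two that is \<open>v\<close> or a neighbour of \<open>v\<close>. Without
  such a vertex, the component is a single vertex or edge.\<close>

lemma card_reachable_le_three:
  assumes g: "adjacency g" and deg: "max_degree g (length g) \<le> 2"
    and small: "\<forall>v<length g. small_at g v" and v: "v < length g"
  shows "\<exists>S. finite S \<and> card S \<le> 3 \<and> v \<in> S \<and> (\<forall>x y. (x, y) \<in> arcs_of g \<longrightarrow> x \<in> S \<longrightarrow> y \<in> S)"
proof -
  have deg2: "length (g ! u) \<le> 2" if "u < length g" for u using deg that by (simp add: max_degree_le_iff)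
  have backarc: "v \<in> set (g ! u)" if "(v, u) \<in> arcs_of g" for u v
    using symD[OF sym_arcs_of[OF g] that] by (simp add: graph_of_simps)
  \<comment> \<open>One of the at most two neighbours of \<open>x\<close> is \<open>w\<close>, so
    the sum forces the other to be \<open>y\<close>.\<close>
  have closed: "set (g ! x) \<subseteq> {w, y}"
    if x: "x < length g" and w: "w \<in> set (g ! x)"
      and sum: "length (g ! x) = 2 \<longrightarrow> g ! x ! 0 + g ! x ! 1 = w + y" for x w y
  proof -
    have "0 < length (g ! x)" using w by auto
    then consider "length (g ! x) = 1" | "length (g ! x) = 2" using deg2[OF x] by linarith
    then show ?thesis
    proof cases
      case 1
      then show ?thesis using w by (auto simp: length_Suc_conv)
    next
      case 2
      then have "set (g ! x) = {g ! x ! 0, g ! x ! 1}" by (rule set_two)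
      then show ?thesis using w sum 2 by auto
    qed
  qed
  have two: "\<exists>S. finite S \<and> card S \<le> 3 \<and> insert w (set (g ! w)) \<subseteq> S \<and> (\<forall>x y. (x, y) \<in> arcs_of g \<longrightarrow> x \<in> S \<longrightarrow> y \<in> S)"
    if w: "w < length g" "length (g ! w) = 2" for w
  proof -
    let ?x = "g ! w ! 0" and ?y = "g ! w ! 1"
    have x: "?x < length g" "w \<in> set (g ! ?x)"
      using neighbour_less[OF g w(1), of 0] backarc[OF arc_nth[OF g w(1), of 0]] w(2) by auto
    have y: "?y < length g" "w \<in> set (g ! ?y)"
      using neighbour_less[OF g w(1), of 1] backarc[OF arc_nth[OF g w(1), of 1]] w(2) by auto
    have sm: "small_at g w" using small w(1) by blast
    have "set (g ! ?x) \<subseteq> {w, ?y}" using closed[OF x] sm w(2) by (simp add: small_at_def)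
    moreover have "set (g ! ?y) \<subseteq> {w, ?x}" using closed[OF y] sm w(2) by (simp add: small_at_def)
    moreover have "set (g ! w) = {?x, ?y}" using w(2) by (rule set_two)
    ultimately have "\<forall>a b. (a, b) \<in> arcs_of g \<longrightarrow> a \<in> {w, ?x, ?y} \<longrightarrow> b \<in> {w, ?x, ?y}"
      by (auto simp: graph_of_simps)
    moreover have "card {w, ?x, ?y} \<le> 3" by (simp add: card_insert_if)
    ultimately show ?thesis using \<open>set (g ! w) = {?x, ?y}\<close> by (intro exI[of _ "{w, ?x, ?y}"]) auto
  qed
  show ?thesis
  proof (cases "\<exists>w<length g. length (g ! w) = 2 \<and> v \<in> insert w (set (g ! w))")
    case True
    then obtain w where w: "w < length g" "length (g ! w) = 2" "v \<in> insert w (set (g ! w))" by blast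
    from two[OF w(1,2)] obtain S where S: "finite S" "card S \<le> 3" "insert w (set (g ! w)) \<subseteq> S"
      "\<forall>x y. (x, y) \<in> arcs_of g \<longrightarrow> x \<in> S \<longrightarrow> y \<in> S" by (elim exE conjE)
    have "v \<in> S" using w(3) S(3) by (rule rev_subsetD)
    then show ?thesis using S(1,2,4) by (intro exI[of _ S] conjI)
  next
    case False
    let ?S = "insert v (set (g ! v))"
    have "length (g ! v) \<noteq> 2" using False v by blast
    then have lv: "length (g ! v) \<le> 1" using deg2[OF v] by linarith
    have nb: "set (g ! u) \<subseteq> {v}" if u: "u \<in> set (g ! v)" for u
    proof -
      have arc: "(v, u) \<in> arcs_of g" using v u by (simp add: graph_of_simps)
      have "v \<in> set (g ! u)" using backarc[OF arc] .
      moreover have "u < length g" using arcs_of_less[OF g arc] by simp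
      ultimately have "length (g ! u) \<le> 1" using False deg2[of u] by fastforce
      then show ?thesis using \<open>v \<in> set (g ! u)\<close> by (cases "g ! u") auto
    qed
    have "card (set (g ! v)) \<le> 1" using card_length[of "g ! v"] lv by simp
    then have "card ?S \<le> 3" using card_insert_le_m1[of 3 "set (g ! v)" v] by (simp add: card_insert_if)
    then show ?thesis using nb by (intro exI[of _ ?S]) (auto simp: graph_of_simps)
  qed
qed

text \<open>A third neighbour of a vertex, or a neighbour of \<open>x\<close> outside
  \<open>{v, x, y}\<close>, would be a fourth vertex in one block.\<close>

lemma minor_triangles_iff_small:
  assumes g: "adjacency g"
  shows "(\<exists>n. minor (graph_of g) (triangles n)) \<longleftrightarrow>
    max_degree g (length g) \<le> 2 \<and> (\<forall>v<length g. small_at g v)"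
proof
  let ?E = "arcs_of g"
  note pg = adjacency_pair_graph[OF g]
  assume "\<exists>n. minor (graph_of g) (triangles n)"
  then obtain n where n: "minor (graph_of g) (triangles n)" ..
  have fp: "finite (pverts (graph_of g))" "?E \<subseteq> pverts (graph_of g) \<times> pverts (graph_of g)"
    using pg by (simp_all add: pair_graph_iff)
  obtain h :: "nat \<Rightarrow> nat" where h: "\<And>u v. (u, v) \<in> ?E \<Longrightarrow> h u = h v"
    "\<And>j. card {v \<in> pverts (graph_of g). h v = j} \<le> 3"
    using small_blocks_if_minor_triangles[OF n fp] by fast
  have three: "card S \<le> 3" if "S \<subseteq> {..<length g}" "\<And>x. x \<in> S \<Longrightarrow> h x = j" for S j
  proof -
    have "card S \<le> card {v \<in> pverts (graph_of g). h v = j}"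
      using that by (intro card_mono) (auto simp: graph_of_simps)
    then show ?thesis using h(2)[of j] by simp
  qed
  have nbh: "h y = h x" if "y \<in> set (g ! x)" "x < length g" for x y
    using h(1)[of x y] that by (simp add: graph_of_simps)
  have less: "y < length g" if "y \<in> set (g ! x)" "x < length g" for x y
    using arcs_of_less[OF g, of x y] that by (simp add: graph_of_simps)
  have "length (g ! u) \<le> 2" if u: "u < length g" for u
  proof -
    have "card (insert u (set (g ! u))) \<le> 3"
      using u nbh less by (intro three[of _ "h u"]) auto
    moreover have "u \<notin> set (g ! u)" using arcs_of_irrefl[OF g, of u] u by (simp add: graph_of_simps)
    ultimately show ?thesis using distinct_card[OF distinct_adjacency[OF g u]] by simp
  qed
  moreover have "small_at g v" if v: "v < length g" for v
  proof -
    have other: "g ! x ! 0 + g ! x ! 1 = v + y"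
      if lv: "length (g ! v) = 2" and gv: "set (g ! v) = {x, y}" and lx: "length (g ! x) = 2" for x y
    proof -
      have xv: "x \<in> set (g ! v)" "y \<in> set (g ! v)" using gv by auto
      have x: "x < length g" using less[OF xv(1) v] .
      have vx: "v \<in> set (g ! x)"
        using symD[OF sym_arcs_of[OF g], of v x] v xv by (simp add: graph_of_simps)
      have neq: "x \<noteq> y" using distinct_card[OF distinct_adjacency[OF g v]] lv gv by auto
      have irr: "x \<noteq> v" "y \<noteq> v" "x \<notin> set (g ! x)"
        using arcs_of_irrefl[OF g, of v] arcs_of_irrefl[OF g, of x] v x xv by (auto simp: graph_of_simps)
      have gx: "set (g ! x) = {g ! x ! 0, g ! x ! 1}" using lx by (rule set_two)
      have dx: "g ! x ! 0 \<noteq> g ! x ! 1"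
        using distinct_adjacency[OF g x] lx by (simp add: nth_eq_iff_index_eq)
      have "v = g ! x ! 0 \<or> v = g ! x ! 1" using vx unfolding gx by blast
      then obtain z where gz: "set (g ! x) = {v, z}" "g ! x ! 0 + g ! x ! 1 = v + z" and "z \<noteq> v"
      proof
        assume "v = g ! x ! 0"
        then show thesis using that[of "g ! x ! 1"] gx dx by simp
      next
        assume "v = g ! x ! 1"
        then show thesis using that[of "g ! x ! 0"] gx dx by (simp add: insert_commute)
      qed
      then have z: "z \<in> set (g ! x)" "z \<noteq> v" by simp_all
      have "z = y"
      proof (rule ccontr)
        assume "z \<noteq> y"
        have "card {v, x, y, z} \<le> 3"
        proof (rule three[of _ "h v"])
          show "{v, x, y, z} \<subseteq> {..<length g}" using v x less[OF xv(2) v] less[OF z(1) x] by auto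
          show "h w = h v" if "w \<in> {v, x, y, z}" for w
            using that nbh[OF xv(1) v] nbh[OF xv(2) v] nbh[OF z(1) x] by auto
        qed
        moreover have "z \<noteq> x" using z(1) irr(3) by blast
        ultimately show False using \<open>z \<noteq> y\<close> z(2) irr neq by simp
      qed
      then show ?thesis using gz(2) by simp
    qed
    show ?thesis
      unfolding small_at_def
    proof (intro impI conjI)
      assume lv: "length (g ! v) = 2"
      have gv: "set (g ! v) = {g ! v ! 0, g ! v ! 1}" using lv by (rule set_two)
      then have gv': "set (g ! v) = {g ! v ! 1, g ! v ! 0}" by auto
      show "length (g ! (g ! v ! 0)) = 2 \<Longrightarrow> g ! (g ! v ! 0) ! 0 + g ! (g ! v ! 0) ! 1 = v + g ! v ! 1"
        by (rule other[OF lv gv])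
      show "length (g ! (g ! v ! 1)) = 2 \<Longrightarrow> g ! (g ! v ! 1) ! 0 + g ! (g ! v ! 1) ! 1 = v + g ! v ! 0"
        by (rule other[OF lv gv'])
    qed
  qed
  ultimately show "max_degree g (length g) \<le> 2 \<and> (\<forall>v<length g. small_at g v)"
    by (simp add: max_degree_le_iff)
next
  let ?E = "arcs_of g"
  assume small: "max_degree g (length g) \<le> 2 \<and> (\<forall>v<length g. small_at g v)"
  \<comment> \<open>The least reachable vertex names the component, so the blocks are exactly the
    components.\<close>
  define h where "h v = (LEAST w. (v, w) \<in> ?E\<^sup>*)" for v
  have h_reach: "(v, h v) \<in> ?E\<^sup>*" for v unfolding h_def by (rule LeastI[of _ v]) simp
  have symR: "sym (?E\<^sup>*)" using sym_arcs_of[OF g] by (rule sym_rtrancl)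
  have "h u = h v" if uv: "(u, v) \<in> ?E" for u v
  proof -
    have "(u, w) \<in> ?E\<^sup>* \<longleftrightarrow> (v, w) \<in> ?E\<^sup>*" for w
      using uv symD[OF sym_arcs_of[OF g] uv] by (meson converse_rtrancl_into_rtrancl)
    then show ?thesis by (simp add: h_def)
  qed
  moreover have "card {v \<in> pverts (graph_of g). h v = j} \<le> 3" for j
  proof (cases "{v \<in> pverts (graph_of g). h v = j} = {}")
    case False
    then obtain v where v: "v < length g" "h v = j" by (auto simp: graph_of_simps)
    obtain S where S: "finite S" "card S \<le> 3" "v \<in> S" "\<And>x y. (x, y) \<in> ?E \<Longrightarrow> x \<in> S \<Longrightarrow> y \<in> S"
      using card_reachable_le_three[OF g _ _ v(1)] small by blast
    have reach_S: "y \<in> S" if "(v, y) \<in> ?E\<^sup>*" for y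
      using that by (induction rule: rtrancl_induct) (use S in auto)
    have "{v \<in> pverts (graph_of g). h v = j} \<subseteq> S"
    proof
      fix w assume "w \<in> {v \<in> pverts (graph_of g). h v = j}"
      then have "(w, j) \<in> ?E\<^sup>*" using h_reach[of w] by auto
      moreover have "(v, j) \<in> ?E\<^sup>*" using h_reach[of v] v(2) by simp
      ultimately have "(v, w) \<in> ?E\<^sup>*" using symD[OF symR] by (meson rtrancl_trans)
      then show "w \<in> S" by (rule reach_S)
    qed
    then have "card {v \<in> pverts (graph_of g). h v = j} \<le> card S" using S(1) by (intro card_mono)
    then show ?thesis using S(2) by simp
  next
    case True
    then show ?thesis by (simp only: card.empty)
  qed
  ultimately show "\<exists>n. minor (graph_of g) (triangles n)"
    by (intro minor_triangles_if_small_blocks[OF adjacency_pair_graph[OF g], of h]) auto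
qed

text \<open>Of three neighbours, two are placed on the same side of \<open>u\<close>, and the nearer
  one separates \<open>u\<close> from the other.\<close>

lemma max_degree_le_two_if_path_layout:
  assumes g: "adjacency g" and lin: "path_layout {..<length g} (arcs_of g)"
  shows "max_degree g (length g) \<le> 2"
  unfolding max_degree_le_iff
proof (intro allI impI, rule ccontr)
  fix u assume u: "u < length g" and "\<not> length (g ! u) \<le> 2"
  then have len: "2 < length (g ! u)" by simp
  from lin obtain f :: "nat \<Rightarrow> nat" where f: "inj_on f {..<length g}"
    "\<And>x y w. (x, y) \<in> arcs_of g \<Longrightarrow> w < length g \<Longrightarrow> \<not> (f x < f w \<and> f w < f y)"
    unfolding path_layout_def by fast
  let ?n = "\<lambda>i. g ! u ! i"
  have arc: "(u, ?n i) \<in> arcs_of g" "(?n i, u) \<in> arcs_of g" "?n i < length g" if "i < 3" for i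
    using arc_nth[OF g u, of i] symD[OF sym_arcs_of[OF g]] neighbour_less[OF g u, of i] len that by auto
  have neq: "f (?n i) \<noteq> f (?n j)" if "i < 3" "j < 3" "i \<noteq> j" for i j
  proof
    assume "f (?n i) = f (?n j)"
    then have "?n i = ?n j" using inj_onD[OF f(1)] arc(3) that by simp
    then show False using distinct_adjacency[OF g u] len that by (simp add: nth_eq_iff_index_eq)
  qed
  have nu: "f (?n i) \<noteq> f u" if "i < 3" for i
  proof
    assume "f (?n i) = f u"
    then have "?n i = u" using inj_onD[OF f(1)] arc(3)[OF that] u by simp
    then show False using arc(1)[OF that] arcs_of_irrefl[OF g] by simp
  qed
  have no: "\<not> (f u < f (?n i) \<and> f u < f (?n j))" "\<not> (f (?n i) < f u \<and> f (?n j) < f u)"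
    if ij: "i < 3" "j < 3" "i \<noteq> j" for i j
    using f(2)[OF arc(1)[OF ij(1)] arc(3)[OF ij(2)]] f(2)[OF arc(1)[OF ij(2)] arc(3)[OF ij(1)]]
      f(2)[OF arc(2)[OF ij(1)] arc(3)[OF ij(2)]] f(2)[OF arc(2)[OF ij(2)] arc(3)[OF ij(1)]]
      neq[OF ij] by linarith+
  have "0 < (3 :: nat)" "1 < (3 :: nat)" "2 < (3 :: nat)" by simp_all
  then show False
    using no[of 0 1] no[of 0 2] no[of 1 2] nu[of 0] nu[of 1] nu[of 2] by linarith
qed

section \<open>The invariant of the edge scan\<close>

text \<open>An edge counts as scanned once it has been met at its smaller end.\<close>

definition scanned :: "nat list list \<Rightarrow> nat \<Rightarrow> nat \<Rightarrow> nat rel" where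
  "scanned g v i = {(x, y). (x, y) \<in> arcs_of g \<and>
    (min x y < v \<or> min x y = v \<and> max x y \<in> set (take i (g ! v)))}"

text \<open>After a closing edge only the refutation is kept: the program scans on and updates
  \<open>oth\<close>, but its entries need no longer describe paths.\<close>

definition linear_inv :: "nat list list \<Rightarrow> nat \<Rightarrow> nat \<Rightarrow> nat \<Rightarrow> (nat \<Rightarrow> nat) \<Rightarrow> bool" where
  "linear_inv g v i ok oth \<longleftrightarrow> (\<forall>x<length g. oth x < length g) \<and>
    (ok = 1 \<longrightarrow> path_comps {..<length g} (scanned g v i) oth) \<and>
    (ok \<noteq> 1 \<longrightarrow> \<not> path_layout {..<length g} (arcs_of g))"

lemma linear_inv_init:
  assumes "\<And>x. x < length g \<Longrightarrow> oth x = x"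
  shows "linear_inv g 0 0 1 oth"
proof -
  have "scanned g 0 0 = {}" by (auto simp: scanned_def)
  then show ?thesis using assms path_comps_empty[of "{..<length g}" oth] by (simp add: linear_inv_def)
qed

text \<open>By symmetry, the list of \<open>v\<close> contains the larger end of every edge whose
  smaller end is \<open>v\<close>.\<close>

lemma linear_inv_next:
  assumes g: "adjacency g" and v: "v < length g" and "linear_inv g v (length (g ! v)) ok oth"
  shows "linear_inv g (Suc v) 0 ok oth"
proof -
  have "max x y \<in> set (g ! v)" if "(x, y) \<in> arcs_of g" "min x y = v" for x y
    using that symD[OF sym_arcs_of[OF g] that(1)] by (auto simp: graph_of_simps min_def max_def split: if_splits)
  then have "scanned g v (length (g ! v)) = scanned g (Suc v) 0"
    by (auto simp: scanned_def less_Suc_eq)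
  then show ?thesis using assms(3) by (simp add: linear_inv_def)
qed

lemma linear_inv_final:
  assumes g: "adjacency g" and inv: "linear_inv g (length g) 0 ok oth"
  shows "(\<exists>n. minor (graph_of g) (path_graph n)) \<longleftrightarrow> ok = 1"
proof -
  note pg = adjacency_pair_graph[OF g]
  have "scanned g (length g) 0 = arcs_of g"
    using arcs_of_less[OF g] by (auto simp: scanned_def min_less_iff_disj)
  then have comps: "path_comps {..<length g} (arcs_of g) oth" if "ok = 1"
    using inv that by (simp add: linear_inv_def)
  have "path_layout {..<length g} (arcs_of g)" if "minor (graph_of g) (path_graph n)" for n
    using path_layout_if_minor_path[OF that] pg by (simp add: pair_graph_iff graph_of_simps)
  then show ?thesis
    using minor_path_if_path_comps[OF pg graph_of_simps(1) comps] inv by (auto simp: linear_inv_def)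
qed

context
  fixes g :: "nat list list" and v i u :: nat
  assumes g: "adjacency g" and deg: "max_degree g (length g) \<le> 2"
    and v: "v < length g" and i: "i < length (g ! v)" and u: "u = g ! v ! i"
begin

lemma scanned_Suc:
  "scanned g v (Suc i) = (if v < u then scanned g v i \<union> {(v, u), (u, v)} else scanned g v i)"
proof -
  have arc: "(v, u) \<in> arcs_of g" "(u, v) \<in> arcs_of g"
    using arc_nth[OF g v i] symD[OF sym_arcs_of[OF g]] u by auto
  then have "u \<noteq> v" using arcs_of_irrefl[OF g] by blast
  have T: "set (take (Suc i) (g ! v)) = insert u (set (take i (g ! v)))"
    using i u by (simp add: take_Suc_conv_app_nth)
  show ?thesis
  proof (cases "v < u")
    case True
    then have "min x y = v \<and> max x y = u \<longleftrightarrow> (x = v \<and> y = u) \<or> (x = u \<and> y = v)" for x y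
      by (auto simp: min_def max_def)
    then have "scanned g v (Suc i) = scanned g v i \<union> {(v, u), (u, v)}"
      unfolding scanned_def T using arc by blast
    then show ?thesis using True by simp
  next
    case False
    then have "\<not> (min x y = v \<and> max x y = u)" for x y
      using \<open>u \<noteq> v\<close> by (auto simp: min_def max_def split: if_splits)
    then have "scanned g v (Suc i) = scanned g v i" unfolding scanned_def T by blast
    then show ?thesis using False by simp
  qed
qed

lemma linear_inv_skip:
  assumes "linear_inv g v i ok oth" "\<not> v < u"
  shows "linear_inv g v (Suc i) ok oth"
  using assms scanned_Suc by (simp add: linear_inv_def)

lemma linear_inv_edge:
  assumes inv: "linear_inv g v i ok oth" and "v < u"
  shows "oth v = u \<Longrightarrow> linear_inv g v (Suc i) 0 oth"
    and "oth v \<noteq> u \<Longrightarrow> linear_inv g v (Suc i) ok (oth(oth v := oth u, oth u := oth v))"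
proof -
  let ?E = "arcs_of g"
  have arc: "(v, u) \<in> ?E" "(u, v) \<in> ?E"
    using arc_nth[OF g v i] symD[OF sym_arcs_of[OF g]] u by auto
  have less: "u < length g" using arcs_of_less[OF g arc(1)] by simp
  \<comment> \<open>A repeated entry could look like an edge that closes a cycle; distinctness of
    the adjacency list excludes this.\<close>
  have fresh: "u \<notin> set (take i (g ! v))"
    using distinct_adjacency[OF g v] i unfolding u
    by (auto simp: in_set_conv_nth nth_eq_iff_index_eq)
  have new: "(v, u) \<notin> scanned g v i" "(u, v) \<notin> scanned g v i"
    using fresh \<open>v < u\<close> by (auto simp: scanned_def min_def max_def)
  have sub: "scanned g v i \<subseteq> ?E" by (auto simp: scanned_def)
  have fin: "finite (?E `` {x})" for x by (rule finite_neighbours[OF g])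
  have card2: "card (?E `` {x}) \<le> 2" for x
  proof (cases "x < length g")
    case True
    then show ?thesis using card_neighbours[OF g True] deg by (simp add: max_degree_le_iff)
  next
    case False
    then show ?thesis using neighbours_empty[OF g] by simp
  qed
  show "linear_inv g v (Suc i) 0 oth" if "oth v = u"
  proof (cases "ok = 1")
    case True
    then have "path_comps {..<length g} (scanned g v i) oth" using inv by (simp add: linear_inv_def)
    then have "\<not> path_layout {..<length g} ?E"
      by (rule no_path_layout_if_closing[where u = u])
        (use v \<open>v < u\<close> sym_arcs_of[OF g] sub arc(1) new(1) fin card2 that in simp_all)
    then show ?thesis using inv by (simp add: linear_inv_def)
  next
    case False
    then show ?thesis using inv by (simp add: linear_inv_def)
  qed
  show "linear_inv g v (Suc i) ok (oth(oth v := oth u, oth u := oth v))" if "oth v \<noteq> u"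
    unfolding linear_inv_def
  proof (intro conjI impI)
    show "\<forall>x<length g. (oth(oth v := oth u, oth u := oth v)) x < length g"
      using inv v less by (simp add: linear_inv_def)
    assume "ok = 1"
    then have "path_comps {..<length g} (scanned g v i) oth" using inv by (simp add: linear_inv_def)
    then have "path_comps {..<length g} (scanned g v i \<union> {(v, u), (u, v)}) (oth(oth v := oth u, oth u := oth v))"
      by (rule path_comps_join) (use v \<open>v < u\<close> less sub arc new fin card2 that in simp_all)
    then show "path_comps {..<length g} (scanned g v (Suc i)) (oth(oth v := oth u, oth u := oth v))"
      using scanned_Suc \<open>v < u\<close> by simp
  qed (use inv in \<open>simp add: linear_inv_def\<close>)
qed

end

section \<open>Timed weakest preconditions\<close>

definition wp :: "program \<Rightarrow> (nat \<Rightarrow> state \<Rightarrow> bool) \<Rightarrow> state \<Rightarrow> bool" where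
  "wp P Q s \<longleftrightarrow> (\<exists>t s'. exec P s t s' \<and> Q t s')"

lemma wp_mono: "wp P Q s \<Longrightarrow> (\<And>t s'. Q t s' \<Longrightarrow> Q' t s') \<Longrightarrow> wp P Q' s"
  unfolding wp_def by blast

text \<open>Determinism turns the precondition of a primitive instruction into an equivalence, so
  that the simplifier can execute straight-line code symbolically.\<close>

lemma wp_iff_exec: "exec P s t s' \<Longrightarrow> wp P Q s \<longleftrightarrow> Q t s'"
  unfolding wp_def by (metis exec_deterministic)

lemma wp_Skip [simp]: "wp Skip Q s \<longleftrightarrow> Q 1 s"
  by (rule wp_iff_exec) (rule exec.Skip)

lemma wp_Move [simp]: "wp (Move i a) Q (r, m) \<longleftrightarrow> Q 1 (r(i := val a r), m)"
  by (rule wp_iff_exec) (rule exec.Move)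

lemma wp_Add [simp]: "wp (Add i a b) Q (r, m) \<longleftrightarrow> Q 1 (r(i := val a r + val b r), m)"
  by (rule wp_iff_exec) (rule exec.Add)

lemma wp_Load [simp]: "wp (Load i a) Q (r, m) \<longleftrightarrow> Q 1 (r(i := m (val a r)), m)"
  by (rule wp_iff_exec) (rule exec.Load)

lemma wp_Store [simp]: "wp (Store a b) Q (r, m) \<longleftrightarrow> Q 1 (r, m(val a r := val b r))"
  by (rule wp_iff_exec) (rule exec.Store)

lemma wp_Seq [simp]: "wp (Seq P P') Q s \<longleftrightarrow> wp P (\<lambda>t. wp P' (\<lambda>t'. Q (t + t'))) s"
proof
  assume "wp (Seq P P') Q s"
  then show "wp P (\<lambda>t. wp P' (\<lambda>t'. Q (t + t'))) s"
    unfolding wp_def by (elim exE conjE exec_SeqE) blast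
qed (unfold wp_def, blast intro: exec.Seq)

lemma wp_Cond [simp]:
  "wp (Cond c P P') Q s \<longleftrightarrow>
    (if holds c (fst s) then wp P (\<lambda>t. Q (t + 1)) s else wp P' (\<lambda>t. Q (t + 1)) s)"
proof
  assume "wp (Cond c P P') Q s"
  then show "if holds c (fst s) then wp P (\<lambda>t. Q (t + 1)) s else wp P' (\<lambda>t. Q (t + 1)) s"
    unfolding wp_def by (elim exE conjE exec_CondE) auto
next
  assume "if holds c (fst s) then wp P (\<lambda>t. Q (t + 1)) s else wp P' (\<lambda>t. Q (t + 1)) s"
  then show "wp (Cond c P P') Q s"
    unfolding wp_def by (metis exec.Cond_True exec.Cond_False)
qed

text \<open>The number of rounds is known beforehand. Bounds that depend on the round let the loop
  over the graphs cost the sum of their sizes; each round pays 1 for its test, and the exit pays 1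
  more.\<close>

lemma wp_Loop:
  assumes init: "I 0 s"
    and step: "\<And>j s. j < n \<Longrightarrow> I j s \<Longrightarrow> holds c (fst s) \<and> wp P (\<lambda>t s'. t \<le> T j \<and> I (Suc j) s') s"
    and exit: "\<And>s. I n s \<Longrightarrow> \<not> holds c (fst s)"
  shows "wp (Loop c P) (\<lambda>t s'. t \<le> (\<Sum>j<n. T j + 1) + 1 \<and> I n s') s"
proof -
  have "wp (Loop c P) (\<lambda>t s'. t \<le> (\<Sum>i=j..<n. T i + 1) + 1 \<and> I n s') s" if "j \<le> n" "I j s" for j s
    using that
  proof (induction j arbitrary: s rule: inc_induct)
    case base
    then have "exec (Loop c P) s 1 s" by (intro exec.Loop_False exit)
    then show ?case using base unfolding wp_def by (intro exI[of _ 1] exI[of _ s]) simp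
  next
    case (step j)
    from assms(2)[OF step.hyps(2) step.prems] obtain t s' where
      1: "holds c (fst s)" "exec P s t s'" "t \<le> T j" "I (Suc j) s'" unfolding wp_def by blast
    from step.IH[OF 1(4)] obtain t' s'' where
      2: "exec (Loop c P) s' t' s''" "t' \<le> (\<Sum>i=Suc j..<n. T i + 1) + 1" "I n s''" unfolding wp_def by blast
    have "exec (Loop c P) s (t + t' + 1) s''" using 1(1,2) 2(1) by (rule exec.Loop_True)
    moreover have "(\<Sum>i=j..<n. T i + 1) = T j + 1 + (\<Sum>i=Suc j..<n. T i + 1)"
      using step.hyps(2) by (rule sum.atLeast_Suc_lessThan)
    then have "t + t' + 1 \<le> (\<Sum>i=j..<n. T i + 1) + 1" using 1(3) 2(2) by simp
    ultimately show ?case using 2(3) unfolding wp_def by blast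
  qed
  from this[of 0 s] init show ?thesis by (simp add: atLeast0LessThan)
qed

section \<open>Reading the input\<close>

definition offset :: "nat list list \<Rightarrow> nat \<Rightarrow> nat" where
  "offset bs i = 1 + length bs + length (concat (take i bs))"

lemma length_encode_seq: "length (encode_seq bs) = 1 + length bs + length (concat bs)"
  by (simp add: encode_seq_def)

lemma encode_seq_0: "encode_seq bs ! 0 = length bs"
  by (simp add: encode_seq_def)

lemma encode_seq_offset: "i < length bs \<Longrightarrow> encode_seq bs ! Suc i = offset bs i"
  by (simp add: encode_seq_def nth_append offset_def)

lemma concat_split_nth:
  assumes "i < length bs"
  shows "concat bs = concat (take i bs) @ bs ! i @ concat (drop (Suc i) bs)"
  using arg_cong[OF id_take_nth_drop[OF assms], of concat] by simp

lemma encode_seq_block: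
  assumes "i < length bs" "x < length (bs ! i)"
  shows "encode_seq bs ! (offset bs i + x) = bs ! i ! x"
proof -
  have "encode_seq bs = (length bs # map (offset bs) [0..<length bs]) @ concat bs"
    by (simp add: encode_seq_def offset_def)
  then have "encode_seq bs ! (offset bs i + x) = concat bs ! (length (concat (take i bs)) + x)"
    by (simp add: nth_append offset_def)
  also have "\<dots> = bs ! i ! x"
    unfolding concat_split_nth[OF assms(1)] using assms(2) by (simp add: nth_append)
  finally show ?thesis .
qed

lemma offset_bound:
  assumes "i < length bs"
  shows "offset bs i + length (bs ! i) \<le> length (encode_seq bs)"
  using arg_cong[OF concat_split_nth[OF assms], of length] by (simp add: length_encode_seq offset_def)

text \<open>The last block ends where the sequence ends; applied twice, this locates the end of the
  input.\<close>

lemma offset_last: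
  assumes "Suc i = length bs"
  shows "offset bs i + length (bs ! i) = length (encode_seq bs)"
proof -
  have "i < length bs" using assms by simp
  from arg_cong[OF concat_split_nth[OF this], of length] show ?thesis
    using assms by (simp add: length_encode_seq offset_def)
qed

text \<open>Stored offsets are relative to the start \<open>b\<close> of the graph, while
  \<open>pt v\<close> is absolute. All cells involved lie below \<open>L\<close>, so writing at
  \<open>L\<close> and beyond preserves the graph.\<close>

definition graph_at :: "nat \<Rightarrow> nat \<Rightarrow> nat list list \<Rightarrow> (nat \<Rightarrow> nat) \<Rightarrow> (nat \<Rightarrow> nat) \<Rightarrow> bool" where
  "graph_at L b g pt m \<longleftrightarrow> b < L \<and> m b = length g \<and>
    (\<forall>v<length g. Suc (b + v) < L \<and> m (Suc (b + v)) + b = pt v \<and> pt v + length (g ! v) < L \<and>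
      m (pt v) = length (g ! v) \<and> (\<forall>i<length (g ! v). m (Suc (pt v + i)) = g ! v ! i))"

lemma graph_at_agree:
  assumes "graph_at L b g pt m" "\<And>a. a < L \<Longrightarrow> m' a = m a"
  shows "graph_at L b g pt m'"
proof -
  have "Suc (pt v + i) < L" if "v < length g" "i < length (g ! v)" for v i
    using assms(1) that unfolding graph_at_def by fastforce
  moreover have "pt v < L" if "v < length g" for v
    using assms(1) that unfolding graph_at_def by fastforce
  ultimately show ?thesis using assms unfolding graph_at_def by simp
qed

lemma graph_at_encode_graph:
  assumes m: "\<And>x. x < length (encode_graph g) \<Longrightarrow> m (b + x) = encode_graph g ! x"
    and L: "b + length (encode_graph g) \<le> L"
  shows "graph_at L b g (\<lambda>v. b + offset (map encode_list g) v) m"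
proof -
  let ?bs = "map encode_list g"
  have eg: "encode_graph g = encode_seq ?bs" by (simp add: encode_graph_def)
  have len: "1 + length g \<le> length (encode_graph g)" by (simp add: eg length_encode_seq)
  have "0 < length (encode_graph g)" using len by linarith
  from m[OF this] have "m b = length g" by (simp add: eg encode_seq_0)
  moreover have "m (Suc (b + v)) + b = b + offset ?bs v" if "v < length g" for v
    using m[of "Suc v"] that len by (simp add: eg encode_seq_offset)
  moreover have "b + offset ?bs v + length (g ! v) < L" if "v < length g" for v
    using offset_bound[of v ?bs] that L by (simp add: eg encode_list_def)
  moreover have block: "m (b + offset ?bs v + x) = encode_list (g ! v) ! x"
    if "v < length g" "x \<le> length (g ! v)" for v x
  proof -
    have v: "v < length ?bs" "x < length (?bs ! v)" using that by (simp_all add: encode_list_def)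
    have "offset ?bs v + x < length (encode_graph g)"
      using offset_bound[OF v(1)] v(2) unfolding eg by linarith
    then show ?thesis
      using m[of "offset ?bs v + x"] encode_seq_block[OF v] that(1) by (simp add: eg add.assoc)
  qed
  moreover have "m (b + offset ?bs v) = length (g ! v)" if "v < length g" for v
    using block[OF that, of 0] by (simp add: encode_list_def)
  moreover have "m (Suc (b + offset ?bs v + i)) = g ! v ! i" if "v < length g" "i < length (g ! v)" for v i
    using block[OF that(1), of "Suc i"] that(2) by (simp add: encode_list_def)
  ultimately show ?thesis unfolding graph_at_def using len L by simp
qed

definition pointer :: "nat list list list \<Rightarrow> nat \<Rightarrow> nat \<Rightarrow> nat" where
  "pointer gs j v = offset (map encode_graph gs) j + offset (map encode_list (gs ! j)) v"

lemma graph_at_encode_graphs: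
  fixes gs :: "nat list list list"
  defines "m \<equiv> snd (initial (encode_graphs gs))"
  assumes j: "j < length gs"
  shows "m (Suc j) = offset (map encode_graph gs) j"
    "Suc j < length (encode_graphs gs)"
    "graph_at (length (encode_graphs gs)) (m (Suc j)) (gs ! j) (pointer gs j) m"
proof -
  let ?bs = "map encode_graph gs"
  have es: "encode_graphs gs = encode_seq ?bs" by (simp add: encode_graphs_def)
  have j': "j < length ?bs" using j by simp
  show lt: "Suc j < length (encode_graphs gs)" using j by (simp add: es length_encode_seq)
  then show off: "m (Suc j) = offset ?bs j"
    using encode_seq_offset[OF j'] by (simp add: m_def initial_def es)
  show "graph_at (length (encode_graphs gs)) (m (Suc j)) (gs ! j) (pointer gs j) m"
    unfolding off pointer_def
  proof (rule graph_at_encode_graph)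
    have bound: "offset ?bs j + length (encode_graph (gs ! j)) \<le> length (encode_graphs gs)"
      using offset_bound[OF j'] j by (simp add: es)
    then show "offset ?bs j + length (encode_graph (gs ! j)) \<le> length (encode_graphs gs)" .
    fix x assume "x < length (encode_graph (gs ! j))"
    then show "m (offset ?bs j + x) = encode_graph (gs ! j) ! x"
      using encode_seq_block[OF j', of x] bound j by (simp add: m_def initial_def es)
  qed
qed

section \<open>The program\<close>

text \<open>
  Register \<open>22\<close> is the index of the current graph, \<open>2\<close> the number of graphs, \<open>3\<close> the first
  address behind the input, \<open>4\<close> the address of the current graph, \<open>5\<close> its number of vertices
  and \<open>6\<close> the current vertex, whose adjacency list has address \<open>14\<close> and length \<open>15\<close>. Registers
  \<open>7\<close> and \<open>8\<close> collect the sum and the maximum of the degrees. Registers \<open>11\<close>, \<open>12\<close> and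
  \<open>13\<close> record whether a linear forest, a star or a union of small components was found.
\<close>

definition seq :: "program list \<Rightarrow> program" where
  "seq Ps = foldr Seq Ps Skip"

lemma wp_seq_Nil [simp]: "wp (seq []) Q s \<longleftrightarrow> Q 1 s"
  by (simp add: seq_def)

lemma wp_seq_Cons [simp]: "wp (seq (P # Ps)) Q s \<longleftrightarrow> wp P (\<lambda>t. wp (seq Ps) (\<lambda>t'. Q (t + t'))) s"
  by (simp add: seq_def)

definition locate :: program where
  "locate = seq [Add 14 (Reg 4) (Reg 6), Add 14 (Reg 14) (Imm 1), Load 14 (Reg 14),
    Add 14 (Reg 14) (Reg 4), Load 15 (Reg 14)]"

text \<open>Besides collecting degrees, this makes every vertex its own opposite end and so
  overwrites the entries left by the previous graph.\<close>

definition degree_step :: program where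
  "degree_step = seq [locate, Add 7 (Reg 7) (Reg 15),
    Cond (Less (Reg 8) (Reg 15)) (Move 8 (Reg 15)) Skip,
    Add 18 (Reg 3) (Reg 6), Store (Reg 18) (Reg 6), Add 6 (Reg 6) (Imm 1)]"

text \<open>The cell at \<open>x\<close> plus register 3 holds the opposite end stored for
  \<open>x\<close>. Register 9 is the flag \<open>ok\<close> of \<open>linear_inv\<close>, cleared
  by an edge that closes a cycle.\<close>

definition edge_step :: program where
  "edge_step = seq [Add 18 (Reg 14) (Reg 16), Add 18 (Reg 18) (Imm 1), Load 17 (Reg 18),
    Cond (Less (Reg 6) (Reg 17))
      (seq [Add 18 (Reg 3) (Reg 6), Load 18 (Reg 18), Add 19 (Reg 3) (Reg 17), Load 19 (Reg 19),
        Cond (Equal (Reg 18) (Reg 17)) (Move 9 (Imm 0))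
          (seq [Add 20 (Reg 3) (Reg 18), Store (Reg 20) (Reg 19),
            Add 20 (Reg 3) (Reg 19), Store (Reg 20) (Reg 18)])])
      Skip,
    Add 16 (Reg 16) (Imm 1)]"

text \<open>Comparing sums takes a single test, whichever position the current vertex has in the
  list of its neighbour. Register 10 is cleared when the component is too large.\<close>

definition check_neighbour :: "nat \<Rightarrow> nat \<Rightarrow> program" where
  "check_neighbour x y = seq [Add 20 (Reg 4) (Reg x), Add 20 (Reg 20) (Imm 1), Load 20 (Reg 20),
    Add 20 (Reg 20) (Reg 4), Load 21 (Reg 20),
    Cond (Equal (Reg 21) (Imm 2))
      (seq [Add 21 (Reg 20) (Imm 1), Load 21 (Reg 21), Add 20 (Reg 20) (Imm 2), Load 20 (Reg 20),
        Add 21 (Reg 21) (Reg 20), Add 20 (Reg 6) (Reg y),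
        Cond (Equal (Reg 21) (Reg 20)) Skip (Move 10 (Imm 0))])
      Skip]"

definition check_vertex :: program where
  "check_vertex = Cond (Equal (Reg 15) (Imm 2))
    (seq [Add 18 (Reg 14) (Imm 1), Load 18 (Reg 18), Add 19 (Reg 14) (Imm 2), Load 19 (Reg 19),
      check_neighbour 18 19, check_neighbour 19 18])
    Skip"

definition vertex_step :: program where
  "vertex_step = seq [locate, Move 16 (Imm 0), Loop (Less (Reg 16) (Reg 15)) edge_step,
    check_vertex, Add 6 (Reg 6) (Imm 1)]"

definition classify :: program where
  "classify = seq [Move 9 (Imm 1), Move 10 (Imm 1), Move 6 (Imm 0),
    Loop (Less (Reg 6) (Reg 5)) vertex_step,
    Cond (Equal (Reg 9) (Imm 1)) (Move 11 (Imm 1)) Skip,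
    Cond (Equal (Reg 10) (Imm 1)) (Move 13 (Imm 1)) Skip]"

text \<open>Only the star condition can hold if the maximum degree exceeds two. Skipping
  \<open>classify\<close> then keeps the entries read in its edge loops to at most two per
  vertex.\<close>

definition graph_step :: program where
  "graph_step = seq [Add 22 (Reg 22) (Imm 1), Load 4 (Reg 22), Load 5 (Reg 4),
    Move 6 (Imm 0), Move 7 (Imm 0), Move 8 (Imm 0),
    Loop (Less (Reg 6) (Reg 5)) degree_step,
    Add 18 (Reg 8) (Reg 8), Cond (Equal (Reg 7) (Reg 18)) (Move 12 (Imm 1)) Skip,
    Cond (Less (Imm 2) (Reg 8)) Skip classify]"

text \<open>The length of the input is not given. Cell \<open>n\<close> holds the offset of the last
  of \<open>n\<close> graphs, and the last adjacency list is found likewise from the number of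
  vertices; its end is the end of the input. A last graph without vertices occupies one
  cell.\<close>

definition prologue :: program where
  "prologue = seq [Load 2 (Imm 0), Load 4 (Reg 2), Load 5 (Reg 4),
    Cond (Equal (Reg 5) (Imm 0)) (Add 3 (Reg 4) (Imm 1))
      (seq [Add 14 (Reg 4) (Reg 5), Load 14 (Reg 14), Add 14 (Reg 14) (Reg 4), Load 15 (Reg 14),
        Add 3 (Reg 14) (Reg 15), Add 3 (Reg 3) (Imm 1)])]"

definition epilogue :: program where
  "epilogue = Cond (Equal (Reg 11) (Imm 1)) (Cond (Equal (Reg 12) (Imm 1))
    (Cond (Equal (Reg 13) (Imm 1)) (Move 0 (Imm 1)) Skip) Skip) Skip"

definition density_program :: program where
  "density_program = seq [prologue, Loop (Less (Reg 22) (Reg 2)) graph_step, epilogue]"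

definition flag :: "bool \<Rightarrow> nat" where
  "flag b = (if b then 1 else 0)"

lemma flag_simps [simp]: "flag True = 1" "flag False = 0" "flag b = Suc 0 \<longleftrightarrow> b"
  by (simp_all add: flag_def)

abbreviation "path_minor g \<equiv> \<exists>n. minor (graph_of g) (path_graph n)"
abbreviation "star_minor g \<equiv> \<exists>n. minor (graph_of g) (star_graph n)"
abbreviation "triangles_minor g \<equiv> \<exists>n. minor (graph_of g) (triangles n)"

section \<open>Correctness of the passes over one graph\<close>

locale graph_run =
  fixes L b :: nat and g :: "nat list list" and pt m0 :: "nat \<Rightarrow> nat" and rest :: "(nat \<Rightarrow> nat) \<Rightarrow> bool"
  assumes adj: "adjacency g" and at0: "graph_at L b g pt m0"
    and rest: "\<And>r i x. i < 22 \<Longrightarrow> i \<notin> {0, 2, 11, 12, 13} \<Longrightarrow> rest (r(i := x)) = rest r"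
begin

text \<open>\<open>rest\<close> is an arbitrary property of the registers that the passes over \<open>g\<close> do not change.\<close>

definition frame :: "nat \<Rightarrow> state \<Rightarrow> bool" where
  "frame v s \<longleftrightarrow> fst s 3 = L \<and> fst s 4 = b \<and> fst s 5 = length g \<and> fst s 6 = v \<and>
    (\<forall>a<L. snd s a = m0 a) \<and> rest (fst s)"

lemma frame_graph_at: "frame v (r, m) \<Longrightarrow> graph_at L b g pt m"
  using graph_at_agree[OF at0] by (simp add: frame_def)

lemma graph_atD:
  assumes "graph_at L b g pt m" "v < length g"
  shows "m (Suc (b + v)) + b = pt v" "m (pt v) = length (g ! v)"
    "\<And>i. i < length (g ! v) \<Longrightarrow> m (Suc (pt v + i)) = g ! v ! i"
  using assms by (simp_all add: graph_at_def)

definition degree_inv :: "nat \<Rightarrow> state \<Rightarrow> bool" where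
  "degree_inv v s \<longleftrightarrow> frame v s \<and> fst s 7 = (\<Sum>u<v. length (g ! u)) \<and> fst s 8 = max_degree g v \<and>
    (\<forall>x<v. snd s (L + x) = x)"

text \<open>Symbolic execution by the rules for \<open>wp\<close>; this step bound and most of the
  later ones are rounded up.\<close>

lemma degree_step_correct:
  assumes v: "v < length g" and inv: "degree_inv v s"
  shows "wp degree_step (\<lambda>t s'. t \<le> 15 \<and> degree_inv (Suc v) s') s"
proof -
  obtain r m where s: "s = (r, m)" by (cases s)
  have fr: "frame v (r, m)" using inv by (simp add: degree_inv_def s)
  note at = graph_atD[OF frame_graph_at[OF fr] v]
  show ?thesis
    using inv at unfolding s degree_inv_def frame_def
    by (simp add: degree_step_def locate_def rest max_def less_Suc_eq)
qed

definition vertex_inv :: "nat \<Rightarrow> state \<Rightarrow> bool" where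
  "vertex_inv v s \<longleftrightarrow> frame v s \<and> linear_inv g v 0 (fst s 9) (\<lambda>x. snd s (L + x)) \<and>
    fst s 10 = flag (\<forall>u<v. small_at g u)"

definition edge_inv :: "nat \<Rightarrow> nat \<Rightarrow> state \<Rightarrow> bool" where
  "edge_inv v i s \<longleftrightarrow> frame v s \<and> linear_inv g v i (fst s 9) (\<lambda>x. snd s (L + x)) \<and>
    fst s 10 = flag (\<forall>u<v. small_at g u) \<and>
    fst s 14 = pt v \<and> fst s 15 = length (g ! v) \<and> fst s 16 = i"

context
  assumes deg: "max_degree g (length g) \<le> 2"
begin

lemma edge_step_correct:
  assumes v: "v < length g" and i: "i < length (g ! v)" and inv: "edge_inv v i s"
  shows "wp edge_step (\<lambda>t s'. t \<le> 20 \<and> edge_inv v (Suc i) s') s"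
proof -
  obtain r m where s: "s = (r, m)" by (cases s)
  have fr: "frame v (r, m)" using inv by (simp add: edge_inv_def s)
  note at = graph_atD[OF frame_graph_at[OF fr] v]
  define u where "u = g ! v ! i"
  have mu: "m (Suc (pt v + i)) = u" using at(3)[OF i] by (simp add: u_def)
  let ?oth = "\<lambda>x. m (L + x)"
  have lin: "linear_inv g v i (r 9) ?oth" using inv by (simp add: edge_inv_def s)
  note step = linear_inv_skip[OF adj deg v i u_def lin] linear_inv_edge[OF adj deg v i u_def lin]
  \<comment> \<open>The two stores, seen as updates of the table that starts at
    \<open>L\<close>.\<close>
  have swap: "(\<lambda>x. (m(L + m (L + v) := m (L + u), L + m (L + u) := m (L + v))) (L + x)) =
      ?oth(?oth v := ?oth u, ?oth u := ?oth v)"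
    by (auto simp: fun_eq_iff)
  consider "\<not> v < u" | "v < u" "m (L + v) = u" | "v < u" "m (L + v) \<noteq> u" by blast
  then show ?thesis
  proof cases
    case 1
    then show ?thesis
      using inv mu step(1) unfolding s edge_inv_def frame_def
      by (simp add: edge_step_def rest)
  next
    case 2
    then show ?thesis
      using inv mu step(2) unfolding s edge_inv_def frame_def
      by (simp add: edge_step_def rest)
  next
    case 3
    then show ?thesis
      using inv mu step(3) unfolding s edge_inv_def frame_def swap[symmetric]
      by (simp add: edge_step_def rest)
  qed
qed

lemma check_vertex_correct:
  assumes v: "v < length g" and inv: "edge_inv v (length (g ! v)) s"
  shows "wp check_vertex (\<lambda>t s'. t \<le> 40 \<and> frame v s' \<and>
    linear_inv g (Suc v) 0 (fst s' 9) (\<lambda>x. snd s' (L + x)) \<and>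
    fst s' 10 = flag (\<forall>u<Suc v. small_at g u)) s"
proof -
  obtain r m where s: "s = (r, m)" by (cases s)
  have fr: "frame v (r, m)" using inv by (simp add: edge_inv_def s)
  note at = graph_atD[OF frame_graph_at[OF fr]]
  have lin: "linear_inv g (Suc v) 0 (r 9) (\<lambda>x. m (L + x))"
    using inv linear_inv_next[OF adj v] by (simp add: edge_inv_def s)
  have all: "(\<forall>u<Suc v. small_at g u) \<longleftrightarrow> (\<forall>u<v. small_at g u) \<and> small_at g v"
    by (auto simp: less_Suc_eq)
  show ?thesis
  proof (cases "length (g ! v) = 2")
    case False
    then have "small_at g v" by (simp add: small_at_def)
    then show ?thesis
      using False inv lin unfolding s edge_inv_def all by (simp add: check_vertex_def)
  next
    case True
    define x y where "x = g ! v ! 0" and "y = g ! v ! 1"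
    have xy: "x < length g" "y < length g"
      using neighbour_less[OF adj v] True by (simp_all add: x_def y_def)
    have mxy: "m (Suc (pt v)) = x" "m (Suc (Suc (pt v))) = y"
      using at(3)[OF v, of 0] at(3)[OF v, of 1] True by (simp_all add: x_def y_def)
    have gx: "m (Suc (pt x)) = g ! x ! 0" "m (Suc (Suc (pt x))) = g ! x ! 1" if "length (g ! x) = 2"
      using at(3)[OF xy(1), of 0] at(3)[OF xy(1), of 1] that by simp_all
    have gy: "m (Suc (pt y)) = g ! y ! 0" "m (Suc (Suc (pt y))) = g ! y ! 1" if "length (g ! y) = 2"
      using at(3)[OF xy(2), of 0] at(3)[OF xy(2), of 1] that by simp_all
    have small: "small_at g v \<longleftrightarrow> (length (g ! x) = 2 \<longrightarrow> g ! x ! 0 + g ! x ! 1 = v + y) \<and>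
        (length (g ! y) = 2 \<longrightarrow> g ! y ! 0 + g ! y ! 1 = v + x)"
      using True by (simp add: small_at_def x_def y_def)
    show ?thesis
      using True inv lin mxy gx gy at(1,2)[OF xy(1)] at(1,2)[OF xy(2)]
      unfolding s edge_inv_def frame_def all small
      by (simp add: check_vertex_def check_neighbour_def rest flag_def)
  qed
qed

lemma vertex_step_correct:
  assumes v: "v < length g" and inv: "vertex_inv v s"
  shows "wp vertex_step (\<lambda>t s'. t \<le> 100 \<and> vertex_inv (Suc v) s') s"
proof -
  obtain r m where s: "s = (r, m)" by (cases s)
  have fr: "frame v (r, m)" using inv by (simp add: vertex_inv_def s)
  note at = graph_atD[OF frame_graph_at[OF fr] v]
  have d2: "length (g ! v) \<le> 2" using deg v by (simp add: max_degree_le_iff)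
  let ?s = "(r(14 := pt v, 15 := length (g ! v), 16 := 0), m)"
  have "edge_inv v 0 ?s"
    using inv unfolding s vertex_inv_def edge_inv_def frame_def by (simp add: rest)
  then have "wp (Loop (Less (Reg 16) (Reg 15)) edge_step)
      (\<lambda>t s'. t \<le> (\<Sum>i<length (g ! v). 20 + 1) + 1 \<and> edge_inv v (length (g ! v)) s') ?s"
  proof (rule wp_Loop)
    fix i s' assume i: "i < length (g ! v)" and inv: "edge_inv v i s'"
    then have "fst s' 16 = i" "fst s' 15 = length (g ! v)" by (simp_all add: edge_inv_def)
    then show "holds (Less (Reg 16) (Reg 15)) (fst s') \<and>
        wp edge_step (\<lambda>t s'. t \<le> 20 \<and> edge_inv v (Suc i) s') s'"
      using edge_step_correct[OF v i inv] i by simp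
  qed (simp add: edge_inv_def)
  \<comment> \<open>At most two entries, each costing 20 steps and a test, and the final test: 2 *
    21 + 1 = 43.\<close>
  then have loop: "wp (Loop (Less (Reg 16) (Reg 15)) edge_step)
      (\<lambda>t s'. t \<le> 43 \<and> edge_inv v (length (g ! v)) s') ?s"
    by (rule wp_mono) (use d2 in simp)
  have r: "r 4 = b" "r 6 = v" using fr by (simp_all add: frame_def)
  show ?thesis
    unfolding s
    apply (simp add: vertex_step_def locate_def r at(1,2))
    apply (rule wp_mono[OF loop])
    subgoal premises prems for t s'
    proof -
      have "edge_inv v (length (g ! v)) s'" using prems by simp
      from check_vertex_correct[OF v this] show ?thesis
        apply simp
        apply (erule wp_mono)
        subgoal for u s1
          using prems by (cases s1) (simp add: vertex_inv_def frame_def rest)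
        done
    qed
    done
qed

lemma vertex_pass:
  assumes "vertex_inv 0 s"
  shows "wp (Loop (Less (Reg 6) (Reg 5)) vertex_step)
    (\<lambda>t s'. t \<le> 101 * length g + 1 \<and> vertex_inv (length g) s') s"
proof -
  have "wp (Loop (Less (Reg 6) (Reg 5)) vertex_step)
    (\<lambda>t s'. t \<le> (\<Sum>v<length g. 100 + 1) + 1 \<and> vertex_inv (length g) s') s"
  proof (rule wp_Loop)
    fix v s' assume v: "v < length g" and inv: "vertex_inv v s'"
    then have "fst s' 6 = v" "fst s' 5 = length g" by (simp_all add: vertex_inv_def frame_def)
    then show "holds (Less (Reg 6) (Reg 5)) (fst s') \<and>
        wp vertex_step (\<lambda>t s'. t \<le> 100 \<and> vertex_inv (Suc v) s') s'"
      using vertex_step_correct[OF v inv] v by simp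
  qed (use assms in \<open>simp_all add: vertex_inv_def frame_def\<close>)
  then show ?thesis by (simp add: mult.commute)
qed

end

lemma degree_pass:
  assumes "degree_inv 0 s"
  shows "wp (Loop (Less (Reg 6) (Reg 5)) degree_step)
    (\<lambda>t s'. t \<le> 16 * length g + 1 \<and> degree_inv (length g) s') s"
proof -
  have "wp (Loop (Less (Reg 6) (Reg 5)) degree_step)
    (\<lambda>t s'. t \<le> (\<Sum>v<length g. 15 + 1) + 1 \<and> degree_inv (length g) s') s"
  proof (rule wp_Loop)
    fix v s' assume v: "v < length g" and inv: "degree_inv v s'"
    then have "fst s' 6 = v" "fst s' 5 = length g" by (simp_all add: degree_inv_def frame_def)
    then show "holds (Less (Reg 6) (Reg 5)) (fst s') \<and>
        wp degree_step (\<lambda>t s'. t \<le> 15 \<and> degree_inv (Suc v) s') s'"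
      using degree_step_correct[OF v inv] v by simp
  qed (use assms in \<open>simp_all add: degree_inv_def frame_def\<close>)
  then show ?thesis by (simp add: mult.commute)
qed

end

definition outer_regs :: "nat \<Rightarrow> nat \<Rightarrow> nat \<Rightarrow> nat \<Rightarrow> nat \<Rightarrow> (nat \<Rightarrow> nat) \<Rightarrow> bool" where
  "outer_regs j n p q t r \<longleftrightarrow>
    r 0 = 0 \<and> r 22 = j \<and> r 2 = n \<and> r 11 = p \<and> r 12 = q \<and> r 13 = t"

lemma graph_run_outer_regs:
  assumes "adjacency g" "graph_at L b g pt m"
  shows "graph_run L b g pt m (outer_regs j n p q t)"
  using assms by unfold_locales (auto simp: outer_regs_def)

lemma classify_correct:
  assumes g: "adjacency g" and at: "graph_at L b g pt m0" and deg: "max_degree g (length g) \<le> 2"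
    and r: "r 3 = L" "r 4 = b" "r 5 = length g" "outer_regs j n p q t r"
    and m: "\<forall>a<L. m a = m0 a" "\<forall>x<length g. m (L + x) = x"
    and p': "p' = (if path_minor g then 1 else p)" and t': "t' = (if triangles_minor g then 1 else t)"
  shows "wp classify (\<lambda>u s'. u \<le> 101 * length g + 20 \<and> fst s' 3 = L \<and> (\<forall>a<L. snd s' a = m0 a) \<and>
    outer_regs j n p' q t' (fst s')) (r, m)"
proof -
  interpret graph_run L b g pt m0 "outer_regs j n p q t"
    using g at by (rule graph_run_outer_regs)
  have lin: "linear_inv g 0 0 1 (\<lambda>x. m (L + x))" using m(2) by (intro linear_inv_init) simp
  have "vertex_inv 0 (r(9 := 1, 10 := 1, 6 := 0), m)"
    using r m(1) lin unfolding vertex_inv_def frame_def by (simp add: outer_regs_def)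
  note pass = vertex_pass[OF deg this]
  show ?thesis
    unfolding classify_def
    apply simp
    apply (rule wp_mono[OF pass[simplified]])
    subgoal premises prems for u s'
    proof -
      obtain r' m' where s': "s' = (r', m')" by (cases s')
      have inv: "vertex_inv (length g) (r', m')" using prems s' by simp
      then have fr: "frame (length g) (r', m')" by (simp add: vertex_inv_def)
      from inv have "linear_inv g (length g) 0 (r' 9) (\<lambda>x. m' (L + x))" by (simp add: vertex_inv_def)
      then have "path_minor g \<longleftrightarrow> r' 9 = 1" by (rule linear_inv_final[OF g])
      moreover have "r' 10 = flag (triangles_minor g)"
        using inv minor_triangles_iff_small[OF g] deg by (simp add: vertex_inv_def)
      ultimately show ?thesis
        using fr prems(1) unfolding s' frame_def outer_regs_def p' t' by simp
    qed
    done
qed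

text \<open>Justifies leaving registers 11 and 13 unchanged when \<open>classify\<close> is
  skipped.\<close>

lemma not_minor_if_large_degree:
  assumes g: "adjacency g" and "2 < max_degree g (length g)"
  shows "\<not> path_minor g" "\<not> triangles_minor g"
proof -
  have "\<not> path_layout {..<length g} (arcs_of g)"
    using max_degree_le_two_if_path_layout[OF g] assms(2) by linarith
  then show "\<not> path_minor g"
    using path_layout_if_minor_path[of "graph_of g"] adjacency_pair_graph[OF g]
    by (auto simp: pair_graph_iff graph_of_simps(1))
  show "\<not> triangles_minor g"
    using minor_triangles_iff_small[OF g] assms(2) by simp
qed

lemma flag_Ex_Suc: "flag (\<exists>i<Suc j. P i) = (if P j then 1 else flag (\<exists>i<j. P i))"
  by (auto simp: flag_def less_Suc_eq)

section \<open>The loop over all graphs\<close>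

locale program_run =
  fixes gs :: "nat list list list"
  assumes nonempty: "gs \<noteq> []" and adj: "\<And>g. g \<in> set gs \<Longrightarrow> adjacency g"
begin

definition input :: "nat \<Rightarrow> nat" where
  "input = snd (initial (encode_graphs gs))"

definition scratch :: nat where
  "scratch = length (encode_graphs gs)"

definition outer_inv :: "nat \<Rightarrow> state \<Rightarrow> bool" where
  "outer_inv j s \<longleftrightarrow> fst s 3 = scratch \<and> (\<forall>a<scratch. snd s a = input a) \<and>
    outer_regs j (length gs) (flag (\<exists>i<j. path_minor (gs ! i))) (flag (\<exists>i<j. star_minor (gs ! i)))
      (flag (\<exists>i<j. triangles_minor (gs ! i))) (fst s)"

text \<open>Per vertex, the degree pass costs 16 steps and \<open>classify\<close> costs 101, within
  the 120 allowed.\<close>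

lemma graph_step_correct:
  assumes j: "j < length gs" and inv: "outer_inv j s"
  shows "wp graph_step (\<lambda>t s'. t \<le> 120 * length (gs ! j) + 60 \<and> outer_inv (Suc j) s') s"
proof -
  obtain r m where s: "s = (r, m)" by (cases s)
  define g where "g = gs ! j"
  define b where "b = input (Suc j)"
  let ?p = "flag (\<exists>i<j. path_minor (gs ! i))" and ?q = "flag (\<exists>i<j. star_minor (gs ! i))"
    and ?t = "flag (\<exists>i<j. triangles_minor (gs ! i))"
  have g: "adjacency g" using adj j by (simp add: g_def)
  have at: "graph_at scratch b g (pointer gs j) input" and jlt: "Suc j < scratch"
    using graph_at_encode_graphs(2,3)[OF j] by (simp_all add: b_def g_def input_def scratch_def)
  interpret A: graph_run scratch b g "pointer gs j" input "outer_regs (Suc j) (length gs) ?p ?q ?t"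
    using g at by (rule graph_run_outer_regs)
  have b: "b < scratch" "input b = length g" using at by (simp_all add: graph_at_def)
  have mj: "m (Suc j) = b" using inv jlt by (simp add: s outer_inv_def b_def)
  have mb: "m b = length g" using inv b by (simp add: s outer_inv_def)
  have rj: "r 22 = j" using inv by (simp add: s outer_inv_def outer_regs_def)
  let ?s1 = "(r(22 := Suc j, 4 := b, 5 := length g, 6 := 0, 7 := 0, 8 := 0), m)"
  have "A.degree_inv 0 ?s1"
    using inv unfolding s outer_inv_def A.degree_inv_def A.frame_def outer_regs_def by simp
  note pass = A.degree_pass[OF this]
  show ?thesis
    unfolding s graph_step_def
    apply (simp add: rj mj mb)
    apply (rule wp_mono[OF pass])
    subgoal premises prems for u s'
    proof -
      obtain r' m' where s': "s' = (r', m')" by (cases s')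
      have inv: "A.degree_inv (length g) (r', m')" using prems s' by simp
      then have star: "star_minor g \<longleftrightarrow> r' 7 = r' 8 + r' 8"
        using minor_star_iff_sum_degrees[OF g] by (simp add: A.degree_inv_def)
      have u: "u \<le> 16 * length g + 1" using prems by simp
      define q' where "q' = (if star_minor g then 1 else ?q)"
      define r'' where "r'' = (if star_minor g then r'(18 := r' 8 + r' 8, 12 := 1) else r'(18 := r' 8 + r' 8))"
      have regs: "outer_regs (Suc j) (length gs) ?p q' ?t r''" "r'' 3 = scratch" "r'' 4 = b" "r'' 5 = length g"
        using inv unfolding r''_def q'_def A.degree_inv_def A.frame_def outer_regs_def by simp_all
      have mem: "\<forall>a<scratch. m' a = input a" "\<forall>x<length g. m' (scratch + x) = x"
        using inv by (simp_all add: A.degree_inv_def A.frame_def)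
      show ?thesis
      proof (cases "2 < max_degree g (length g)")
        case True
        then have "2 < r' 8" using inv by (simp add: A.degree_inv_def)
        then show ?thesis
          using star u regs mem not_minor_if_large_degree[OF g True]
          unfolding s' outer_inv_def flag_Ex_Suc r''_def q'_def g_def[symmetric]
          by (cases "star_minor g") (simp_all add: flag_Ex_Suc)
      next
        case False
        then have "\<not> 2 < r' 8" using inv by (simp add: A.degree_inv_def)
        moreover have "wp classify (\<lambda>v s'. u + v \<le> 117 * length g + 30 \<and> outer_inv (Suc j) s') (r'', m')"
          by (rule wp_mono[OF classify_correct[OF g at _ regs(2-4,1) mem refl refl]])
            (use False u in \<open>simp_all add: outer_inv_def flag_Ex_Suc g_def[symmetric] q'_def\<close>)
        ultimately show ?thesis
          using star unfolding s' r''_def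
          by (cases "star_minor g") (auto elim!: wp_mono simp: g_def[symmetric])
      qed
    qed
    done
qed

text \<open>The value that \<open>prologue\<close> computes. An adjacency list takes one cell more
  than its entries, and an empty graph only the cell with its number of vertices.\<close>

lemma scratch_eq:
  assumes "g = last gs"
  shows "scratch = offset (map encode_graph gs) (length gs - 1) +
    (if g = [] then 1 else offset (map encode_list g) (length g - 1) + 1 + length (last g))"
proof -
  have lt: "length gs - 1 < length gs" using nonempty by simp
  have "scratch = offset (map encode_graph gs) (length gs - 1) + length (encode_graph g)"
    using offset_last[of "length gs - 1" "map encode_graph gs"] nonempty lt assms
    by (simp add: scratch_def encode_graphs_def last_conv_nth)
  moreover have "length (encode_graph g) = offset (map encode_list g) (length g - 1) + 1 + length (last g)"
    if "g \<noteq> []"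
  proof -
    have "length g - 1 < length g" using that by simp
    then show ?thesis
      using offset_last[of "length g - 1" "map encode_list g"] that
      by (simp add: encode_graph_def last_conv_nth encode_list_def)
  qed
  moreover have "length (encode_graph []) = 1" by (simp add: encode_graph_def encode_seq_def)
  ultimately show ?thesis by auto
qed

lemma prologue_correct:
  "wp prologue (\<lambda>t s'. t \<le> 20 \<and> outer_inv 0 s') (initial (encode_graphs gs))"
proof -
  define g where "g = last gs"
  define j where "j = length gs - 1"
  define b where "b = input (Suc j)"
  have j: "j < length gs" "Suc j = length gs" and gj: "gs ! j = g"
    using nonempty by (simp_all add: j_def g_def last_conv_nth)
  have at: "graph_at scratch b g (pointer gs j) input" and boff: "b = offset (map encode_graph gs) j"
    using graph_at_encode_graphs[OF j(1)] gj by (simp_all add: b_def input_def scratch_def)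
  have i0: "input 0 = length gs"
    by (simp add: input_def initial_def encode_graphs_def encode_seq_0 length_encode_seq)
  have ib: "input (length gs) = b" using j(2) by (simp add: b_def)
  have ig: "input b = length g" using at by (simp add: graph_at_def)
  have s: "initial (encode_graphs gs) = (\<lambda>_. 0, input)" by (simp add: input_def initial_def)
  show ?thesis
  proof (cases g rule: rev_cases)
    case Nil
    then have "scratch = Suc b" using scratch_eq[OF g_def] boff j_def by simp
    then show ?thesis
      using Nil i0 ib ig unfolding s by (simp add: prologue_def outer_inv_def outer_regs_def)
  next
    case (snoc g' ns)
    let ?v = "length g'"
    have v: "?v < length g" "g ! ?v = ns" "length g = Suc ?v" using snoc by simp_all
    have ptr_at: "input (Suc (b + ?v)) + b = pointer gs j ?v" "input (pointer gs j ?v) = length ns"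
      using at v(1,2) by (simp_all add: graph_at_def)
    have ptr: "pointer gs j ?v = b + offset (map encode_list g) ?v" by (simp add: pointer_def gj boff)
    with ptr_at(2) have "input (offset (map encode_list g) ?v + b) = length ns"
      by (simp add: add.commute)
    moreover have "g \<noteq> []" "length g - 1 = ?v" "last g = ns" using snoc by simp_all
    then have "scratch = b + offset (map encode_list g) ?v + 1 + length ns"
      using scratch_eq[OF g_def] boff j_def by simp
    ultimately show ?thesis
      using ptr ptr_at v(3) i0 ib ig unfolding s by (simp add: prologue_def outer_inv_def outer_regs_def)
  qed
qed

lemma density_program_correct:
  "wp density_program (\<lambda>t s'. t \<le> 120 * (\<Sum>j<length gs. length (gs ! j)) + 61 * length gs + 50 \<and>
    answer s' = flag ((\<exists>g\<in>set gs. path_minor g) \<and> (\<exists>g\<in>set gs. star_minor g) \<and>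
      (\<exists>g\<in>set gs. triangles_minor g))) (initial (encode_graphs gs))"
proof -
  have Ex: "(\<exists>g\<in>set gs. P g) \<longleftrightarrow> (\<exists>i<length gs. P (gs ! i))" for P
    by (auto simp: set_conv_nth)
  let ?n = "length gs" and ?loop = "Loop (Less (Reg 22) (Reg 2)) graph_step"
  have loop: "wp ?loop (\<lambda>t s'. t \<le> 120 * (\<Sum>j<?n. length (gs ! j)) + 61 * ?n + 1 \<and> outer_inv ?n s') s"
    if "outer_inv 0 s" for s
  proof -
    have "wp ?loop (\<lambda>t s'. t \<le> (\<Sum>j<?n. 120 * length (gs ! j) + 60 + 1) + 1 \<and> outer_inv ?n s') s"
    proof (rule wp_Loop)
      fix j s' assume j: "j < ?n" and inv: "outer_inv j s'"
      then have "fst s' 22 = j" "fst s' 2 = ?n" by (simp_all add: outer_inv_def outer_regs_def)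
      then show "holds (Less (Reg 22) (Reg 2)) (fst s') \<and>
          wp graph_step (\<lambda>t s'. t \<le> 120 * length (gs ! j) + 60 \<and> outer_inv (Suc j) s') s'"
        using graph_step_correct[OF j inv] j by simp
    qed (use that in \<open>simp_all add: outer_inv_def outer_regs_def\<close>)
    moreover have "(\<Sum>j<?n. 120 * length (gs ! j) + 60 + 1) = 120 * (\<Sum>j<?n. length (gs ! j)) + 61 * ?n"
      by (simp add: sum.distrib sum_distrib_left)
    ultimately show ?thesis by simp
  qed
  show ?thesis
    unfolding density_program_def wp_seq_Cons
  proof (rule wp_mono[OF prologue_correct], elim conjE)
    fix t :: nat and s assume t: "t \<le> 20" and inv: "outer_inv 0 s"
    show "wp ?loop (\<lambda>t'. wp epilogue (\<lambda>t''. wp (seq []) (\<lambda>w s'.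
        t + (t' + (t'' + w)) \<le> 120 * (\<Sum>j<?n. length (gs ! j)) + 61 * ?n + 50 \<and>
        answer s' = flag ((\<exists>g\<in>set gs. path_minor g) \<and> (\<exists>g\<in>set gs. star_minor g) \<and>
          (\<exists>g\<in>set gs. triangles_minor g))))) s"
    proof (rule wp_mono[OF loop[OF inv]], elim conjE)
      fix t' :: nat and s' assume t': "t' \<le> 120 * (\<Sum>j<?n. length (gs ! j)) + 61 * ?n + 1"
        and inv': "outer_inv ?n s'"
      obtain r m where s': "s' = (r, m)" by (cases s')
      define p q u where "p = (\<exists>i<?n. path_minor (gs ! i))" and "q = (\<exists>i<?n. star_minor (gs ! i))"
        and "u = (\<exists>i<?n. triangles_minor (gs ! i))"
      have regs: "r 0 = 0" "r 11 = flag p" "r 12 = flag q" "r 13 = flag u"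
        using inv' by (simp_all add: s' outer_inv_def outer_regs_def p_def q_def u_def)
      show "wp epilogue (\<lambda>t''. wp (seq []) (\<lambda>w s'.
          t + (t' + (t'' + w)) \<le> 120 * (\<Sum>j<?n. length (gs ! j)) + 61 * ?n + 50 \<and>
          answer s' = flag ((\<exists>g\<in>set gs. path_minor g) \<and> (\<exists>g\<in>set gs. star_minor g) \<and>
            (\<exists>g\<in>set gs. triangles_minor g)))) s'"
        unfolding Ex p_def[symmetric] q_def[symmetric] u_def[symmetric] s'
        using regs t t' by (simp add: epilogue_def answer_def flag_def)
    qed
  qed
qed

end

section \<open>Linear time\<close>

text \<open>The loop overhead is paid once per graph, so the number of graphs must be bounded as
  well. A graph without vertices is a minor of every graph and so forms an anti-chain only by
  itself; this case is the reason for the 1.\<close>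

lemma card_le_total_order:
  assumes "minor_antichain \<Z>"
  shows "card \<Z> \<le> total_order \<Z> + 1"
proof (cases "\<exists>Z\<in>\<Z>. pverts Z = {}")
  case True
  then obtain Z where Z: "Z \<in> \<Z>" "pverts Z = {}" by blast
  have "pair_graph Z" using assms Z(1) by (simp add: minor_antichain_def)
  then have "parcs Z = {}" using Z(2) by (auto simp: pair_graph_iff)
  then have "minor Z Y" for Y unfolding minor_def using Z(2) by simp
  then have "Y = Z" if "Y \<in> \<Z>" for Y
    using assms Z(1) that unfolding minor_antichain_def pairwise_def by metis
  then have "\<Z> = {Z}" using Z(1) by blast
  then show ?thesis by simp
next
  case False
  have "1 \<le> card (pverts Z)" if "Z \<in> \<Z>" for Z
  proof -
    have "finite (pverts Z)" using assms that by (auto simp: minor_antichain_def pair_graph_iff)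
    then show ?thesis using False that by (simp add: Suc_le_eq card_gt_0_iff)
  qed
  then have "(\<Sum>Z\<in>\<Z>. 1) \<le> (\<Sum>Z\<in>\<Z>. card (pverts Z))" by (rule sum_mono)
  then show ?thesis by (simp add: total_order_def)
qed

lemma representsE:
  assumes "minor_antichain \<Z>" "represents gs \<Z>"
  shows "length gs = card \<Z>" and "total_order \<Z> = (\<Sum>j<length gs. length (gs ! j))"
    and "\<And>g. g \<in> set gs \<Longrightarrow> adjacency g"
    and "\<And>X. pair_graph X \<Longrightarrow> (\<exists>Z\<in>\<Z>. minor Z X) \<longleftrightarrow> (\<exists>g\<in>set gs. minor (graph_of g) X)"
proof -
  from assms(2) obtain Zs where Zs: "distinct Zs" "set Zs = \<Z>"
    and all2: "list_all2 (\<lambda>g Z. (\<forall>ns \<in> set g. distinct ns) \<and> isomorphic (graph_of g) Z) gs Zs"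
    unfolding represents_def by blast
  have len: "length gs = length Zs" using all2 by (rule list_all2_lengthD)
  then show "length gs = card \<Z>" using Zs by (simp add: distinct_card[symmetric])
  have iso: "isomorphic (graph_of (gs ! j)) (Zs ! j)" "\<forall>ns \<in> set (gs ! j). distinct ns"
    and pg: "pair_graph (Zs ! j)" if "j < length gs" for j
  proof -
    show "isomorphic (graph_of (gs ! j)) (Zs ! j)" "\<forall>ns \<in> set (gs ! j). distinct ns"
      using list_all2_nthD[OF all2 that] by simp_all
    have "Zs ! j \<in> \<Z>" using that len Zs(2) nth_mem[of j Zs] by simp
    then show "pair_graph (Zs ! j)" using assms(1) by (simp add: minor_antichain_def)
  qed
  have "card (pverts (Zs ! j)) = length (gs ! j)" if j: "j < length gs" for j
  proof -
    obtain f where "bij_betw f (pverts (graph_of (gs ! j))) (pverts (Zs ! j))"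
      using iso(1)[OF j] by (rule isomorphic_obtain)
    then show ?thesis by (auto dest: bij_betw_same_card simp: graph_of_simps(1))
  qed
  then have "(\<Sum>j<length gs. length (gs ! j)) = (\<Sum>j<length Zs. card (pverts (Zs ! j)))"
    using len by (intro sum.cong) auto
  also have "\<dots> = total_order \<Z>"
    unfolding total_order_def Zs(2)[symmetric]
    by (rule sum.reindex_bij_betw[OF bij_betw_nth[OF Zs(1) refl refl]])
  finally show "total_order \<Z> = (\<Sum>j<length gs. length (gs ! j))" by simp
  show "adjacency g" if "g \<in> set gs" for g
    using that iso pg pair_graph_isomorphic unfolding adjacency_def in_set_conv_nth by blast
  fix X :: graph assume "pair_graph X"
  then have "minor (graph_of (gs ! j)) X \<longleftrightarrow> minor (Zs ! j) X" if "j < length gs" for j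
    using minor_cong_isomorphic[OF iso(1) pg] that by blast
  then show "(\<exists>Z\<in>\<Z>. minor Z X) \<longleftrightarrow> (\<exists>g\<in>set gs. minor (graph_of g) X)"
    unfolding Zs(2)[symmetric] by (auto simp: set_conv_nth len)
qed

theorem theorem5p5:
  shows "\<exists>(P :: program) (T :: nat \<Rightarrow> nat).
    (\<lambda>n. real (T n)) \<in> O(\<lambda>n. real n) \<and>
    (\<forall>(\<Z> :: graph set) (gs :: nat list list list).
      minor_antichain \<Z> \<longrightarrow> represents gs \<Z> \<longrightarrow>
      (\<exists>t s. exec P (initial (encode_graphs gs)) t s \<and>
        t \<le> T (total_order \<Z>) \<and>
        answer s = (if \<exists>d. has_limiting_density (excl \<Z>) d \<and> d < 1 then 1 else 0)))"
proof (rule exI[of _ density_program], rule exI[of _ "\<lambda>n. 181 * n + 111"], intro conjI allI impI)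
  \<comment> \<open>With at most n + 1 graphs, 120 * n + 61 * (n + 1) + 50 = 181 * n + 111.\<close>
  let ?T = "\<lambda>n :: nat. 181 * n + 111"
  show "(\<lambda>n. real (?T n)) \<in> O(\<lambda>n. real n)"
  \<comment> \<open>For n at least 1 the constant is absorbed: 181 + 111 = 292.\<close>
  proof (rule bigoI[of _ 292])
    show "\<forall>\<^sub>F n in sequentially. norm (real (?T n)) \<le> 292 * norm (real n)"
      using eventually_ge_at_top[of 1] by eventually_elim simp
  qed
  fix \<Z> :: "graph set" and gs :: "nat list list list"
  assume Z: "minor_antichain \<Z>" and gs: "represents gs \<Z>"
  note rep = representsE[OF Z gs]
  have "\<Z> \<noteq> {}" "finite \<Z>" and pg: "\<And>Z. Z \<in> \<Z> \<Longrightarrow> pair_graph Z"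
    using Z by (simp_all add: minor_antichain_def)
  then have "gs \<noteq> []" using rep(1) by auto
  then interpret program_run gs using rep(3) by unfold_locales
  have "(\<exists>g\<in>set gs. \<exists>n. minor (graph_of g) (F n)) \<longleftrightarrow> (\<exists>Z\<in>\<Z>. \<exists>n. minor Z (F n))"
    if "\<And>n. pair_graph (F n)" for F :: "nat \<Rightarrow> graph"
    using rep(4)[OF that] by blast
  from this[of path_graph] this[of star_graph] this[of triangles]
  have answer: "(\<exists>g\<in>set gs. path_minor g) \<and> (\<exists>g\<in>set gs. star_minor g) \<and> (\<exists>g\<in>set gs. triangles_minor g)
      \<longleftrightarrow> (\<exists>d. has_limiting_density (excl \<Z>) d \<and> d < 1)"
    using limiting_density_less_one_iff[OF pg] by simp
  obtain t s where run: "exec density_program (initial (encode_graphs gs)) t s"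
    "t \<le> 120 * total_order \<Z> + 61 * length gs + 50"
    "answer s = flag (\<exists>d. has_limiting_density (excl \<Z>) d \<and> d < 1)"
    using density_program_correct unfolding wp_def answer rep(2) by blast
  have "t \<le> ?T (total_order \<Z>)"
    using run(2) rep(1) card_le_total_order[OF Z] by simp
  then show "\<exists>t s. exec density_program (initial (encode_graphs gs)) t s \<and> t \<le> ?T (total_order \<Z>) \<and>
      answer s = (if \<exists>d. has_limiting_density (excl \<Z>) d \<and> d < 1 then 1 else 0)"
    using run(1,3) unfolding flag_def by blast
qed

end
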